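(* Let $\|\cdot\|$ be a norm on $\mathbb{R}^m$ whose dual norm $\|\cdot\|_*$ is strictly convex, and let $\mu\in\mathcal{P}_1(\mathbb{R}^m)$. The following are equivalent: (i) there exists $b>0$ such that $\overline{\mathbf{T}}_2^+(b)$ holds; (ii) there exist $\lambda,C>0$ such that for all $\varphi\in\mathcal{F}_\lambda(\mathbb{R}^m)$, $$\mathrm{Ent}_\mu(e^\varphi)\le C\int(\varphi-Q_{1/\lambda}\varphi)e^\varphi\,d\mu;$$ (iii) there exist $\rho,\lambda'>0$ such that for all $\mathcal{C}^1$-smooth functions $\varphi\in\mathcal{F}_{\lambda'}(\mathbb{R}^m)$, $$\mathrm{Ent}_\mu(e^\varphi)\le\frac1{2\rho}\int\|\nabla\varphi\|_*^2e^\varphi\,d\mu.$$ Moreover: $(i)\Rightarrow(ii)$ for all $\lambda\in(0,1/b)$ and with $C=1/(1-b\lambda)$; $(ii)\Rightarrow(iii)$ for all $\lambda'\in(0,\lambda)$ and with $\rho=\frac{\lambda-\lambda'}{C}$; $(iii)\Rightarrow(i)$ with $b=\frac{\rho+\lambda'}{\rho\lambda'}$.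
   Context: $\mathcal{P}_1(\mathbb{R}^m)$: Borel probability measures with finite first moment. $\|x\|_*=\max_{\|y\|=1}x\cdot y$; strictly convex means: $x\ne y$, $\|x\|_*=\|y\|_*=1$ imply $\|(1-t)x+ty\|_*<1$ for $t\in(0,1)$. Let $c(x,p)=\frac12\|x-\int y\,p(dy)\|^2$ for $x\in\mathbb{R}^m$, $p\in\mathcal{P}_1(\mathbb{R}^m)$, and $\mathcal{T}_c(\nu|\mu)=\inf_\pi\int c(x,p_x)\,\mu(dx)$, infimum over couplings $\pi(dxdy)=\mu(dx)p_x(dy)$ with first marginal $\mu$ and second marginal $\nu$. $H(\nu|\mu)$ is relative entropy ($+\infty$ if $\nu\not\ll\mu$). $\overline{\mathbf{T}}_2^+(b)$ means here: $\mathcal{T}_c(\nu|\mu)\le b\,H(\nu|\mu)$ for all $\nu\in\mathcal{P}_1(\mathbb{R}^m)$. $\mathrm{Ent}_\mu(g)=\int g\log\left(\frac{g}{\int g\,d\mu}\right)d\mu$ for $g\ge0$. $Q_t\varphi(x)=\inf_{y\in\mathbb{R}^m}\{\varphi(y)+\frac1{2t}\|x-y\|^2\}$. A function $f:\mathbb{R}^m\to\mathbb{R}\cup\{\pm\infty\}$ is $\frac\lambda2\|\cdot\|^2$-convex if there is $g:\mathbb{R}^m\to\mathbb{R}\cup\{\pm\infty\}$ with $f(x)=\sup_{y\in\mathbb{R}^m}\{g(y)-\frac\lambda2\|x-y\|^2\}$ for all $x$. For $\lambda>0$, $\mathcal{F}_\lambda(\mathbb{R}^m)$ is the class of all $f:\mathbb{R}^m\to\mathbb{R}$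 that are concave, Lipschitz, bounded from above and $\frac\lambda2\|\cdot\|^2$-convex. *)

theory Defs
  imports "HOL-Probability.Probability"
begin

text \<open>The norm is an arbitrary one, so it is a function \<open>N\<close>, not the Euclidean \<open>norm\<close>.\<close>

definition is_norm :: "('a::euclidean_space \<Rightarrow> real) \<Rightarrow> bool" where
  "is_norm N \<longleftrightarrow>
     (\<forall>x. 0 \<le> N x) \<and> (\<forall>x. N x = 0 \<longleftrightarrow> x = 0) \<and>
     (\<forall>a x. N (a *\<^sub>R x) = \<bar>a\<bar> * N x) \<and> (\<forall>x y. N (x + y) \<le> N x + N y)"

text \<open>For a norm \<open>N\<close> the unit sphere is compact and nonempty, so this supremum is a maximum.\<close>

definition dual_norm :: "('a::euclidean_space \<Rightarrow> real) \<Rightarrow> 'a \<Rightarrow> real" where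
  "dual_norm N x = (SUP y\<in>{y. N y = 1}. x \<bullet> y)"

definition strictly_convex_norm :: "('a::euclidean_space \<Rightarrow> real) \<Rightarrow> bool" where
  "strictly_convex_norm N \<longleftrightarrow>
     (\<forall>x y. x \<noteq> y \<and> N x = 1 \<and> N y = 1 \<longrightarrow>
        (\<forall>t. 0 < t \<and> t < 1 \<longrightarrow> N ((1 - t) *\<^sub>R x + t *\<^sub>R y) < 1))"

definition P1 :: "('a::euclidean_space) measure set" where
  "P1 = {\<mu>. sets \<mu> = sets borel \<and> prob_space \<mu> \<and> integrable \<mu> (\<lambda>x. norm x)}"

definition bary_cost :: "('a::euclidean_space \<Rightarrow> real) \<Rightarrow> 'a \<Rightarrow> 'a measure \<Rightarrow> real" where
  "bary_cost N x p = 1/2 * (N (x - (\<integral>y. y \<partial>p)))\<^sup>2"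

definition couplings ::
  "('a::euclidean_space) measure \<Rightarrow> 'a measure \<Rightarrow> ('a \<times> 'a) measure set" where
  "couplings \<mu> \<nu> =
     {\<pi>. sets \<pi> = sets (borel \<Otimes>\<^sub>M borel) \<and> distr \<pi> borel fst = \<mu> \<and> distr \<pi> borel snd = \<nu>}"

text \<open>\<open>disintegrates \<mu> p \<pi>\<close> renders \<open>\<pi>(dx dy) = \<mu>(dx) p\<^sub>x(dy)\<close>.\<close>

definition disintegrates ::
  "('a::euclidean_space) measure \<Rightarrow> ('a \<Rightarrow> 'a measure) \<Rightarrow> ('a \<times> 'a) measure \<Rightarrow> bool" where
  "disintegrates \<mu> p \<pi> \<longleftrightarrow>
     p \<in> borel \<rightarrow>\<^sub>M prob_algebra borel \<and>
     (\<forall>A\<in>sets (borel \<Otimes>\<^sub>M borel).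
        emeasure \<pi> A = (\<integral>\<^sup>+x. (\<integral>\<^sup>+y. indicator A (x, y) \<partial>p x) \<partial>\<mu>))"

text \<open>If \<open>\<nu>\<close> has a finite first moment then so does \<open>p x\<close> for \<open>\<mu>\<close>-almost every \<open>x\<close>;
  the value 0 that \<open>bary_cost\<close> gives to the barycenter of the other \<open>p x\<close> is irrelevant.\<close>

definition transport_cost ::
  "('a::euclidean_space \<Rightarrow> real) \<Rightarrow> 'a measure \<Rightarrow> 'a measure \<Rightarrow> ennreal" where
  "transport_cost N \<nu> \<mu> =
     (INF (\<pi>, p)\<in>{(\<pi>, p). \<pi> \<in> couplings \<mu> \<nu> \<and> disintegrates \<mu> p \<pi>}.
        \<integral>\<^sup>+x. ennreal (bary_cost N x (p x)) \<partial>\<mu>)"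

text \<open>With \<open>f = d\<nu>/d\<mu>\<close>, the negative part of \<open>f ln f\<close> is bounded by \<open>1/e\<close>, so for probability
  measures the integral of \<open>ln f\<close> against \<open>\<nu>\<close> is infinite exactly when \<open>ln f\<close> is not
  \<open>\<nu>\<close>-integrable (in which case the real-valued \<open>KL_divergence\<close> would return 0).\<close>

definition rel_entropy :: "('a::euclidean_space) measure \<Rightarrow> 'a measure \<Rightarrow> ereal" where
  "rel_entropy \<nu> \<mu> =
     (if absolutely_continuous \<mu> \<nu> \<and> integrable \<nu> (entropy_density (exp 1) \<mu> \<nu>)
      then ereal (KL_divergence (exp 1) \<mu> \<nu>) else \<infinity>)"

definition T2_plus ::
  "('a::euclidean_space \<Rightarrow> real) \<Rightarrow> 'a measure \<Rightarrow> real \<Rightarrow> bool" where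
  "T2_plus N \<mu> b \<longleftrightarrow>
     (\<forall>\<nu>\<in>P1. enn2ereal (transport_cost N \<nu> \<mu>) \<le> ereal b * rel_entropy \<nu> \<mu>)"

text \<open>Only used for bounded \<open>g > 0\<close>, where the integrand is bounded.\<close>

definition Ent :: "('a::euclidean_space) measure \<Rightarrow> ('a \<Rightarrow> real) \<Rightarrow> real" where
  "Ent \<mu> g = (\<integral>x. g x * ln (g x / (\<integral>y. g y \<partial>\<mu>)) \<partial>\<mu>)"

text \<open>Only used for Lipschitz \<open>\<phi>\<close> and \<open>t > 0\<close>, where the infimum is over a set bounded below.\<close>

definition inf_conv ::
  "('a::euclidean_space \<Rightarrow> real) \<Rightarrow> real \<Rightarrow> ('a \<Rightarrow> real) \<Rightarrow> 'a \<Rightarrow> real" where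
  "inf_conv N t \<phi> x = (INF y. \<phi> y + 1 / (2 * t) * (N (x - y))\<^sup>2)"

definition sq_norm_convex ::
  "('a::euclidean_space \<Rightarrow> real) \<Rightarrow> real \<Rightarrow> ('a \<Rightarrow> ereal) \<Rightarrow> bool" where
  "sq_norm_convex N lam f \<longleftrightarrow>
     (\<exists>g :: 'a \<Rightarrow> ereal. \<forall>x. f x = (SUP y. g y - ereal (lam / 2 * (N (x - y))\<^sup>2)))"

definition F_class ::
  "('a::euclidean_space \<Rightarrow> real) \<Rightarrow> real \<Rightarrow> ('a \<Rightarrow> real) set" where
  "F_class N lam =
     {f. concave_on UNIV f \<and> (\<exists>L. \<forall>x y. \<bar>f x - f y\<bar> \<le> L * N (x - y)) \<and>
         bdd_above (range f) \<and> sq_norm_convex N lam (\<lambda>x. ereal (f x))}"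

definition gradient :: "('a::euclidean_space \<Rightarrow> real) \<Rightarrow> 'a \<Rightarrow> 'a" where
  "gradient f x = (THE D. GDERIV f x :> D)"

definition C1_smooth :: "('a::euclidean_space \<Rightarrow> real) \<Rightarrow> bool" where
  "C1_smooth f \<longleftrightarrow> (\<forall>x. f differentiable (at x)) \<and> continuous_on UNIV (gradient f)"

definition inf_conv_log_Sobolev ::
  "('a::euclidean_space \<Rightarrow> real) \<Rightarrow> 'a measure \<Rightarrow> real \<Rightarrow> real \<Rightarrow> bool" where
  "inf_conv_log_Sobolev N \<mu> lam C \<longleftrightarrow>
     (\<forall>\<phi>\<in>F_class N lam.
        Ent \<mu> (\<lambda>x. exp (\<phi> x)) \<le> C * (\<integral>x. (\<phi> x - inf_conv N (1 / lam) \<phi> x) * exp (\<phi> x) \<partial>\<mu>))"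

definition gradient_log_Sobolev ::
  "('a::euclidean_space \<Rightarrow> real) \<Rightarrow> 'a measure \<Rightarrow> real \<Rightarrow> real \<Rightarrow> bool" where
  "gradient_log_Sobolev N \<mu> \<rho> lam \<longleftrightarrow>
     (\<forall>\<phi>\<in>F_class N lam. C1_smooth \<phi> \<longrightarrow>
        Ent \<mu> (\<lambda>x. exp (\<phi> x))
          \<le> 1 / (2 * \<rho>) * (\<integral>x. (dual_norm N (gradient \<phi> x))\<^sup>2 * exp (\<phi> x) \<partial>\<mu>))"

end

theory Submission
  imports Defs
begin

text \<open>
  Write \<open>P\<^sub>s f(x) = sup\<^sub>y f(y) - \<parallel>x - y\<parallel>^2 / (2s)\<close>.

  (i) to (ii): for \<open>\<nu> = e^\<phi> \<mu> / Z\<close>, Jensen gives \<open>H(\<nu>|\<mu>) \<le> \<integral> \<phi> d\<nu> - \<integral> \<phi> d\<mu>\<close>. As \<open>Q\<phi> = Q\<^bsub>1/\<lambda>\<^esub> \<phi>\<close> is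
  concave, every coupling satisfies \<open>\<integral> Q\<phi> d\<nu> - \<integral> \<phi> d\<mu> \<le> \<lambda> \<integral> c(x, p\<^sub>x) \<mu>(dx)\<close>, and \<open>T\<^sub>2\<close> absorbs this term.

  (ii) to (iii): if \<open>z\<close> realises the supremum that represents \<open>\<phi>\<close> at \<open>x\<close>, moving \<open>x\<close> towards \<open>z\<close> shows
  \<open>\<lambda>' \<parallel>x - z\<parallel> \<le> \<parallel>\<nabla>\<phi>(x)\<parallel>\<^sub>*\<close>, whence \<open>\<phi> - Q\<phi> \<le> \<parallel>\<nabla>\<phi>\<parallel>\<^sub>*^2 / (2 (\<lambda> - \<lambda>'))\<close>.

  (iii) to (i): by Herbst's argument \<open>t \<mapsto> log \<integral> exp(\<rho> t P\<^bsub>1-t\<^esub> f) d\<mu> / (\<rho> t)\<close> is nonincreasing as long as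
  \<open>\<rho> t / (1 - t) \<le> \<lambda>'\<close>, so that \<open>\<integral> e^(f/b) d\<mu> \<le> exp(\<integral> P\<^sub>1 f d\<mu> / b)\<close> for concave \<open>f\<close>; the strict convexity
  of the dual norm makes \<open>P\<^sub>s f\<close> differentiable. The bound makes \<open>\<mu>\<close> Gaussian-integrable, so \<open>\<nu>\<close> has a second
  moment when \<open>H(\<nu>|\<mu>)\<close> is finite. Then \<open>\<nu>\<close> may be replaced by its conditional expectations on a finite
  partition, at the price of replacing \<open>P\<^sub>1\<close> by \<open>P\<^bsub>1+\<epsilon>\<^esub>\<close>, and \<open>\<mu>\<close> is discretised as well. For the resulting
  finite problem a penalisation of the marginal constraint produces, without compactness, an almost
  optimal plan together with its Lagrange multipliers, which define the concave function \<open>f\<close> to be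
  tested.
\<close>

section \<open>Norms and dual norms\<close>

text \<open>The barycentric cost sees \<open>p\<^sub>x\<close> only through its mean, and Jensen's
  inequality carries a function from \<open>p\<^sub>x\<close> to that mean only if it is concave;
  this is why the test functions are concave. Lipschitz continuity makes them integrable under a
  first moment, and the upper bound makes their exponentials integrable. The value of b is dictated
  by the flow: the exponent stays in the class of parameter \<open>\<lambda>'\<close> up to the time
  at which \<open>\<rho> t / (1 - t) = \<lambda>'\<close>, that is
  \<open>t = \<lambda>' / (\<rho> + \<lambda>')\<close>, and there \<open>\<rho> t = 1 / b\<close>.
  The obstacle in the last implication is to get from an inequality for functions to an actual
  measurable kernel with the right second marginal. The kernel is built by hand: a matrix of weights
  between finitely many values of x and finitely many cells, each weight being spread over its cell
  in proportion to \<open>\<nu>\<close>. Discretising \<open>\<mu>\<close> costs two factors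
  \<open>1 + \<epsilon>\<close>, since Young's inequality is used on the way there and back, and all
  errors vanish as \<open>\<epsilon>\<close> tends to 0.\<close>

lemma convex_on_subgradient:
  fixes h :: "'a::euclidean_space \<Rightarrow> real"
  assumes h: "convex_on UNIV h"
  obtains D where "\<And>y. h x + D \<bullet> (y - x) \<le> h y"
proof -
  define S where "S = {p::'a \<times> real. h (fst p) < snd p}"
  have "convex S"
  proof (rule convexI)
    fix p q :: "'a \<times> real" and u v :: real
    assume *: "p \<in> S" "q \<in> S" "0 \<le> u" "0 \<le> v" "u + v = 1"
    have "h (u *\<^sub>R fst p + v *\<^sub>R fst q) \<le> u * h (fst p) + v * h (fst q)"
      using h * unfolding convex_on_def by auto
    also have "\<dots> < u * snd p + v * snd q"
      using * by (cases "u = 0")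
        (auto simp: S_def intro!: add_less_le_mono mult_left_mono mult_strict_left_mono)
    finally show "u *\<^sub>R p + v *\<^sub>R q \<in> S" by (simp add: S_def)
  qed
  moreover have "S \<noteq> {}" using lt_ex[of "- h x"] by (auto simp: S_def intro!: exI[of _ x] exI[of _ "h x + 1"])
  moreover have "{(x, h x)} \<inter> S = {}" by (auto simp: S_def)
  ultimately obtain a b where ab: "a \<noteq> 0" "\<forall>p\<in>{(x, h x)}. a \<bullet> p \<le> b" "\<forall>p\<in>S. b \<le> a \<bullet> p"
    using separating_hyperplane_sets[of "{(x, h x)}" S] by auto
  obtain c \<alpha> where a: "a = (c, \<alpha>)" by (cases a)
  have ineq: "c \<bullet> x + \<alpha> * h x \<le> c \<bullet> y + \<alpha> * r" if "h y < r" for y r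
  proof -
    have "(y, r) \<in> S" using that by (simp add: S_def)
    with ab a show ?thesis by force
  qed
  have "\<alpha> \<ge> 0" using ineq[of x "h x + 1"] by (simp add: algebra_simps)
  \<comment> \<open>A vertical hyperplane is impossible because \<open>h\<close> is finite at every
    point: testing at \<open>x - c\<close> would force \<open>c = 0\<close>.\<close>
  moreover have "\<alpha> \<noteq> 0"
  proof
    assume "\<alpha> = 0"
    with ineq[of "x - c" "h (x - c) + 1"] have "c \<bullet> c \<le> 0" by (simp add: inner_diff_right)
    then have "c = 0" by (metis inner_gt_zero_iff not_le)
    with \<open>\<alpha> = 0\<close> a ab(1) show False by (simp add: zero_prod_def)
  qed
  ultimately have pos: "\<alpha> > 0" by simp
  have "h x + (- c /\<^sub>R \<alpha>) \<bullet> (y - x) \<le> h y" for y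
  proof (rule field_le_epsilon)
    fix e :: real assume "e > 0"
    with ineq[of y "h y + e"] pos
    show "h x + (- c /\<^sub>R \<alpha>) \<bullet> (y - x) \<le> h y + e"
      by (simp add: field_simps inner_diff_right)
  qed
  then show ?thesis by (rule that)
qed

locale norm_fun =
  fixes N :: "'a::euclidean_space \<Rightarrow> real"
  assumes is_norm: "is_norm N"
begin

lemma N_nonneg [simp]: "0 \<le> N x"
  and N_eq_0 [simp]: "N x = 0 \<longleftrightarrow> x = 0"
  and N_scaleR [simp]: "N (a *\<^sub>R x) = \<bar>a\<bar> * N x"
  and N_triangle: "N (x + y) \<le> N x + N y"
  using is_norm unfolding is_norm_def by auto

lemma N_minus [simp]: "N (- x) = N x"
  using N_scaleR[of "-1" x] by simp

lemma N_zero [simp]: "N 0 = 0" by simp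

lemma N_commute: "N (x - y) = N (y - x)"
  by (metis N_minus minus_diff_eq)

lemma N_triangle_diff: "N (x - z) \<le> N (x - y) + N (y - z)"
  using N_triangle[of "x - y" "y - z"] by simp

lemma N_diff_le: "N x \<le> N y + N (x - y)"
  using N_triangle[of y "x - y"] by simp

lemma N_sum: "finite I \<Longrightarrow> N (\<Sum>i\<in>I. x i) \<le> (\<Sum>i\<in>I. N (x i))"
  by (induction I rule: finite_induct) (auto intro: order_trans[OF N_triangle])

lemma N_upper: obtains C where "C > 0" "\<And>x. N x \<le> C * norm x"
proof
  show "1 + (\<Sum>b\<in>Basis. N b) > 0" by (smt (verit) sum_nonneg N_nonneg)
  fix x
  have "N x = N (\<Sum>b\<in>Basis. (x \<bullet> b) *\<^sub>R b)" by (simp add: euclidean_representation)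
  also have "\<dots> \<le> (\<Sum>b\<in>Basis. N ((x \<bullet> b) *\<^sub>R b))" by (rule N_sum) simp
  also have "\<dots> \<le> (\<Sum>b\<in>Basis. norm x * N b)"
    by (intro sum_mono) (auto intro!: mult_right_mono simp: Basis_le_norm)
  also have "\<dots> = norm x * (\<Sum>b\<in>Basis. N b)" by (simp add: sum_distrib_left)
  also have "\<dots> \<le> (1 + (\<Sum>b\<in>Basis. N b)) * norm x"
    by (simp add: algebra_simps)
  finally show "N x \<le> (1 + (\<Sum>b\<in>Basis. N b)) * norm x" .
qed

lemma continuous_of_N_lipschitz:
  fixes f :: "'a \<Rightarrow> real"
  assumes "\<And>x y. \<bar>f x - f y\<bar> \<le> L * N (x - y)"
  shows "continuous_on A f"
proof -
  obtain C where C: "C > 0" "\<And>x. N x \<le> C * norm x" using N_upper by auto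
  have "\<bar>f x - f y\<bar> \<le> (\<bar>L\<bar> * C) * norm (x - y)" for x y
  proof -
    have "\<bar>f x - f y\<bar> \<le> \<bar>L\<bar> * N (x - y)"
      using assms[of x y] by (smt (verit) N_nonneg mult_right_mono)
    also have "\<dots> \<le> \<bar>L\<bar> * (C * norm (x - y))" by (intro mult_left_mono C) simp
    finally show ?thesis by (simp add: mult.assoc)
  qed
  then have "(\<bar>L\<bar> * C)-lipschitz_on A f"
    using C(1) by (intro lipschitz_onI) (auto simp: dist_norm)
  then show ?thesis by (rule lipschitz_on_continuous_on)
qed

lemma continuous_on_N: "continuous_on A N"
  by (rule continuous_of_N_lipschitz[of _ 1])
     (smt (verit) N_diff_le N_commute)

lemma continuous_on_N_comp [continuous_intros]:
  "continuous_on A f \<Longrightarrow> continuous_on A (\<lambda>x. N (f x))"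
  using continuous_on_compose2[OF continuous_on_N[of UNIV]] by auto

lemma measurable_N [measurable]: "N \<in> borel_measurable borel"
  by (intro borel_measurable_continuous_onI continuous_on_N)

lemma N_lower: obtains c where "c > 0" "\<And>x. c * norm x \<le> N x"
proof -
  have "\<exists>x\<in>sphere 0 1. \<forall>y\<in>sphere 0 1. N x \<le> N (y::'a)"
    by (rule continuous_attains_inf) (auto intro: continuous_on_N)
  then obtain x where x: "norm x = 1" "\<And>y. norm y = 1 \<Longrightarrow> N x \<le> N y" by auto
  have "N x > 0" using x(1) by (smt (verit) N_eq_0 N_nonneg norm_zero)
  moreover have "N x * norm y \<le> N y" for y
  proof (cases "y = 0")
    case False
    then have "N x \<le> N (y /\<^sub>R norm y)" by (intro x) simp
    with False show ?thesis by (simp add: field_simps)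
  qed simp
  ultimately show ?thesis by (rule that)
qed

lemma convex_on_N: "convex_on UNIV N"
proof (rule convex_onI)
  fix t x y assume "0 < t" "t < (1::real)"
  then show "N ((1 - t) *\<^sub>R x + t *\<^sub>R y) \<le> (1 - t) * N x + t * N y"
    using N_triangle[of "(1 - t) *\<^sub>R x" "t *\<^sub>R y"] by simp
qed auto

text \<open>Young's inequality for the cross term. It drives both the semigroup estimate, with
  \<open>e = s / d\<close>, and the discretisation errors, with small \<open>e\<close>.\<close>

lemma N_sq_add_le:
  assumes "e > 0"
  shows "(N (x + y))\<^sup>2 \<le> (1 + e) * (N x)\<^sup>2 + (1 + 1 / e) * (N y)\<^sup>2"
proof -
  have "(N (x + y))\<^sup>2 \<le> (N x + N y)\<^sup>2" by (intro power_mono N_triangle) simp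
  moreover have "2 * N x * N y \<le> e * (N x)\<^sup>2 + (N y)\<^sup>2 / e"
  proof -
    have "0 \<le> (e * N x - N y)\<^sup>2 / e" using assms by simp
    also have "\<dots> = e * (N x)\<^sup>2 + (N y)\<^sup>2 / e - 2 * N x * N y"
      using assms by (simp add: power2_eq_square field_simps)
    finally show ?thesis by simp
  qed
  ultimately show ?thesis by (simp add: power2_sum algebra_simps)
qed

lemma convex_on_N_sq: "convex_on UNIV (\<lambda>x. (N x)\<^sup>2)"
proof (rule convex_onI)
  fix t x y assume t: "0 < t" "t < (1::real)"
  have "(N ((1 - t) *\<^sub>R x + t *\<^sub>R y))\<^sup>2 \<le> ((1 - t) * N x + t * N y)\<^sup>2"
    using convex_onD[OF convex_on_N, of t x y] t by (intro power_mono) auto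
  also have "\<dots> \<le> (1 - t) * (N x)\<^sup>2 + t * (N y)\<^sup>2"
  proof -
    have "(1 - t) * (N x)\<^sup>2 + t * (N y)\<^sup>2 - ((1 - t) * N x + t * N y)\<^sup>2
        = t * (1 - t) * (N x - N y)\<^sup>2" by (simp add: power2_eq_square algebra_simps)
    moreover have "t * (1 - t) * (N x - N y)\<^sup>2 \<ge> 0" using t by simp
    ultimately show ?thesis by linarith
  qed
  finally show "(N ((1 - t) *\<^sub>R x + t *\<^sub>R y))\<^sup>2 \<le> (1 - t) * (N x)\<^sup>2 + t * (N y)\<^sup>2" .
qed auto

section \<open>The dual norm\<close>

lemma ex_N_eq_1: obtains v where "N v = 1"
proof -
  obtain b :: 'a where "b \<in> Basis" using nonempty_Basis by blast
  then have "N b > 0" by (smt (verit) N_eq_0 N_nonneg nonzero_Basis)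
  then have "N (b /\<^sub>R N b) = 1" by simp (metis left_inverse less_irrefl)
  then show ?thesis by (rule that)
qed

text \<open>A real \<open>SUP\<close> says nothing about an unbounded set, so this bound precedes
  every estimate of \<open>dual_norm\<close> from below.\<close>

lemma bdd_above_dual: "bdd_above ((\<lambda>y. x \<bullet> y) ` {y. N y = 1})"
proof -
  obtain c where c: "c > 0" "\<And>x. c * norm x \<le> N x" using N_lower by auto
  have "x \<bullet> y \<le> norm x / c" if "N y = 1" for y
  proof -
    have "norm y \<le> 1 / c" using c(2)[of y] c(1) that by (simp add: field_simps)
    then have "norm x * norm y \<le> norm x * (1 / c)" by (intro mult_left_mono) auto
    with norm_cauchy_schwarz[of x y] show ?thesis by simp
  qed
  then show ?thesis by (intro bdd_aboveI2[of _ _ "norm x / c"]) auto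
qed

lemma inner_le_dual: "x \<bullet> v \<le> dual_norm N x * N v"
proof (cases "v = 0")
  case False
  then have "N v > 0" by (smt (verit) N_eq_0 N_nonneg)
  then have "x \<bullet> (v /\<^sub>R N v) \<le> dual_norm N x"
    unfolding dual_norm_def by (intro cSUP_upper bdd_above_dual) (simp, metis left_inverse less_irrefl)
  with \<open>N v > 0\<close> show ?thesis by (simp add: field_simps)
qed simp

lemma dual_le: "(\<And>v. N v = 1 \<Longrightarrow> x \<bullet> v \<le> c) \<Longrightarrow> dual_norm N x \<le> c"
  unfolding dual_norm_def using ex_N_eq_1 by (intro cSUP_least) auto

lemma dual_nonneg [simp]: "0 \<le> dual_norm N x"
proof -
  obtain v where "N v = 1" using ex_N_eq_1 by auto
  with inner_le_dual[of x v] inner_le_dual[of x "-v"] show ?thesis by simp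
qed

lemma dual_less_ex: "c < dual_norm N x \<Longrightarrow> \<exists>v. N v = 1 \<and> c < x \<bullet> v"
  by (meson dual_le linorder_not_le)

lemma dual_add: "dual_norm N (x + y) \<le> dual_norm N x + dual_norm N y"
proof (rule dual_le)
  fix v assume "N v = 1"
  then show "(x + y) \<bullet> v \<le> dual_norm N x + dual_norm N y"
    using inner_le_dual[of x v] inner_le_dual[of y v] by (simp add: inner_add_left)
qed

lemma dual_scale_le: "dual_norm N (a *\<^sub>R x) \<le> \<bar>a\<bar> * dual_norm N x"
proof (rule dual_le)
  fix v assume v: "N v = 1"
  have "(a *\<^sub>R x) \<bullet> v = x \<bullet> (a *\<^sub>R v)" by simp
  also have "\<dots> \<le> dual_norm N x * N (a *\<^sub>R v)" by (rule inner_le_dual)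
  finally show "(a *\<^sub>R x) \<bullet> v \<le> \<bar>a\<bar> * dual_norm N x" using v by (simp add: mult.commute)
qed

lemma dual_scale: "dual_norm N (a *\<^sub>R x) = \<bar>a\<bar> * dual_norm N x"
proof (cases "a = 0")
  case True
  then show ?thesis using dual_scale_le[of 0 x] dual_nonneg[of 0] by simp
next
  case False
  have "dual_norm N x \<le> \<bar>1/a\<bar> * dual_norm N (a *\<^sub>R x)"
    using dual_scale_le[of "1/a" "a *\<^sub>R x"] False by simp
  with False dual_scale_le[of a x] show ?thesis by (simp add: field_simps)
qed

lemma dual_upper: obtains C where "C > 0" "\<And>x. dual_norm N x \<le> C * norm x"
proof -
  obtain c where c: "c > 0" "\<And>x. c * norm x \<le> N x" using N_lower by auto
  have "dual_norm N x \<le> (1 / c) * norm x" for x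
  proof (rule dual_le)
    fix v assume "N v = 1"
    then have "norm v \<le> 1 / c" using c(2)[of v] c(1) by (simp add: field_simps)
    then have "norm x * norm v \<le> norm x * (1 / c)" by (intro mult_left_mono) auto
    with norm_cauchy_schwarz[of x v] show "x \<bullet> v \<le> (1 / c) * norm x" by simp
  qed
  then show ?thesis using c(1) by (intro that[of "1 / c"]) auto
qed

lemma continuous_on_dual: "continuous_on A (dual_norm N)"
proof -
  obtain C where C: "C > 0" "\<And>x. dual_norm N x \<le> C * norm x" using dual_upper by auto
  have *: "dual_norm N x - dual_norm N y \<le> C * norm (x - y)" for x y
    using dual_add[of y "x - y"] C(2)[of "x - y"] by simp
  have "C-lipschitz_on A (dual_norm N)"
    using C(1) *
    by (intro lipschitz_onI) (auto simp: dist_norm abs_le_iff, metis norm_minus_commute)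
  then show ?thesis by (rule lipschitz_on_continuous_on)
qed

text \<open>Testing the functional x on the vector x gives
  \<open>norm x * norm x \<le> dual_norm N x * N x\<close>, and \<open>N\<close> is dominated by
  \<open>norm\<close>.\<close>

lemma norm_le_dual: obtains C where "C > 0" "\<And>x. norm x \<le> C * dual_norm N x"
proof -
  obtain C where C: "C > 0" "\<And>x. N x \<le> C * norm x" using N_upper by auto
  have "norm x \<le> C * dual_norm N x" for x
  proof (cases "x = 0")
    case False
    have "norm x * norm x \<le> dual_norm N x * N x"
      using inner_le_dual[of x x] by (simp add: dot_square_norm power2_eq_square)
    also have "\<dots> \<le> dual_norm N x * (C * norm x)" by (intro mult_left_mono C) simp
    finally show ?thesis using False by (simp add: field_simps)
  qed (use C(1) in simp)
  with C(1) show ?thesis by (rule that)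
qed

text \<open>A subgradient of \<open>N\<close> at u is norming: comparison with the points 0 and
  \<open>2 *\<^sub>R u\<close> and homogeneity force \<open>p \<bullet> u = N u\<close>.\<close>

lemma norming_functional:
  obtains p where "dual_norm N p \<le> 1" "p \<bullet> u = N u"
proof -
  obtain p where p: "\<And>y. N u + p \<bullet> (y - u) \<le> N y"
    using convex_on_subgradient[OF convex_on_N] by blast
  have eq: "p \<bullet> u = N u"
    using p[of 0] p[of "2 *\<^sub>R u"] by (simp add: inner_diff_right)
  then have "p \<bullet> v \<le> N v" for v using p[of v] by (simp add: inner_diff_right)
  then have "dual_norm N p \<le> 1" by (intro dual_le) (metis)
  with eq show ?thesis by (rule that[rotated])
qed

end

section \<open>Sup-convolutions of concave Lipschitz functions\<close>

context norm_fun
begin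

text \<open>This is \<open>F_class\<close> without its paraboloid condition. The Lipschitz constant
  is kept as a parameter because it bounds the speed of the Hopf-Lax flow by
  \<open>L\<^sup>2 / 2\<close>.\<close>

definition conc_lip :: "real \<Rightarrow> ('a \<Rightarrow> real) \<Rightarrow> bool" where
  "conc_lip L f \<longleftrightarrow>
     concave_on UNIV f \<and> (\<forall>x y. \<bar>f x - f y\<bar> \<le> L * N (x - y)) \<and> bdd_above (range f)"

definition sup_conv :: "real \<Rightarrow> ('a \<Rightarrow> real) \<Rightarrow> 'a \<Rightarrow> real" where
  "sup_conv s f x = (SUP y. f y - 1 / (2 * s) * (N (x - y))\<^sup>2)"

lemma conc_lipD:
  assumes "conc_lip L f"
  shows "concave_on UNIV f" "\<bar>f x - f y\<bar> \<le> L * N (x - y)" "bdd_above (range f)"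
    "f x \<le> f y + L * N (x - y)" "continuous_on A f" "f \<in> borel_measurable borel"
proof -
  show *: "concave_on UNIV f" "\<bar>f x - f y\<bar> \<le> L * N (x - y)" "bdd_above (range f)" for x y
    using assms by (auto simp: conc_lip_def)
  show "f x \<le> f y + L * N (x - y)" using *(2)[of x y] by simp
  show "continuous_on A f" for A by (rule continuous_of_N_lipschitz[OF *(2)])
  then show "f \<in> borel_measurable borel" by (intro borel_measurable_continuous_onI)
qed

lemma conc_lipI:
  assumes "\<And>t x y. 0 < t \<Longrightarrow> t < 1 \<Longrightarrow> (1 - t) * f x + t * f y \<le> f ((1 - t) *\<^sub>R x + t *\<^sub>R y)"
    and lip: "\<And>x y. f x \<le> f y + L * N (x - y)" and "\<And>x. f x \<le> B"
  shows "conc_lip L f"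
proof -
  have "\<bar>f x - f y\<bar> \<le> L * N (x - y)" for x y
    using lip[of x y] lip[of y x] by (simp add: abs_le_iff N_commute[of y x])
  moreover have "concave_on UNIV f"
    unfolding concave_on_def using assms(1) by (intro convex_onI) (auto simp: algebra_simps)
  moreover have "bdd_above (range f)" using assms(3) by (rule bdd_aboveI2)
  ultimately show ?thesis by (simp add: conc_lip_def)
qed

lemma conc_lip_concaveD:
  assumes "conc_lip L f" "0 < t" "t < 1"
  shows "(1 - t) * f x + t * f y \<le> f ((1 - t) *\<^sub>R x + t *\<^sub>R y)"
  using convex_onD[of UNIV "\<lambda>x. - f x" t x y] conc_lipD(1)[OF assms(1)] assms(2,3)
  by (simp add: concave_on_def)

lemma conc_lip_nonneg: assumes "conc_lip L f" shows "L \<ge> 0"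
proof -
  obtain v where "N v = 1" using ex_N_eq_1 by auto
  with conc_lipD(2)[OF assms, of v 0] show ?thesis by simp
qed

lemma conc_lip_bound: assumes "conc_lip L f" obtains M where "M \<ge> 0" "\<And>x. f x \<le> M"
proof -
  obtain M where "\<And>x. f x \<le> M" using conc_lipD(3)[OF assms] by (auto simp: bdd_above_def)
  then have "f x \<le> max M 0" for x by (simp add: le_max_iff_disj)
  then show ?thesis by (intro that[of "max M 0"]) auto
qed

lemma sup_conv_bdd:
  assumes "conc_lip L f" "s > 0"
  shows "bdd_above (range (\<lambda>y. f y - 1 / (2 * s) * (N (x - y))\<^sup>2))"
proof -
  obtain M where M: "\<And>x. f x \<le> M" using conc_lip_bound[OF assms(1)] by auto
  have "f y - 1 / (2 * s) * (N (x - y))\<^sup>2 \<le> M" for y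
    using M[of y] assms(2) by (smt (verit) divide_nonneg_nonneg mult_nonneg_nonneg zero_le_power2)
  then show ?thesis by (rule bdd_aboveI2)
qed

lemma sup_conv_ge:
  assumes "conc_lip L f" "s > 0"
  shows "f y - 1 / (2 * s) * (N (x - y))\<^sup>2 \<le> sup_conv s f x"
  unfolding sup_conv_def by (intro cSUP_upper sup_conv_bdd[OF assms]) auto

lemma sup_conv_le:
  "(\<And>y. f y - 1 / (2 * s) * (N (x - y))\<^sup>2 \<le> c) \<Longrightarrow> sup_conv s f x \<le> c"
  unfolding sup_conv_def by (intro cSUP_least) auto

lemma sup_conv_ge_self: "conc_lip L f \<Longrightarrow> s > 0 \<Longrightarrow> f x \<le> sup_conv s f x"
  using sup_conv_ge[of L f s x x] by simp

lemma sup_conv_attained: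
  assumes "conc_lip L f" "s > 0"
  obtains y where "sup_conv s f x = f y - 1 / (2 * s) * (N (x - y))\<^sup>2"
proof -
  define F where "F y = f y - 1 / (2 * s) * (N (x - y))\<^sup>2" for y
  obtain M where M: "\<And>x. f x \<le> M" using conc_lip_bound[OF assms(1)] by auto
  obtain c where c: "c > 0" "\<And>x. c * norm x \<le> N x" using N_lower by auto
  \<comment> \<open>Beyond this radius the penalty exceeds \<open>M - f x\<close>, so such points
    lose to x itself and a maximum over the ball is global.\<close>
  define R where "R = sqrt (2 * s * (M - f x)) / c"
  have R0: "R \<ge> 0" using c assms M[of x] by (simp add: R_def)
  have cont: "continuous_on (cball x R) F"
    unfolding F_def by (intro continuous_intros conc_lipD(5)[OF assms(1)])
  have "\<exists>y\<in>cball x R. \<forall>z\<in>cball x R. F z \<le> F y"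
    using R0 by (intro continuous_attains_sup cont) auto
  then obtain y where y: "y \<in> cball x R" "\<And>z. z \<in> cball x R \<Longrightarrow> F z \<le> F y" by auto
  have "F z \<le> F y" for z
  proof (cases "z \<in> cball x R")
    case False
    then have "R < norm (x - z)" by (simp add: dist_norm)
    then have "c * R < N (x - z)" using c by (smt (verit) mult_strict_left_mono)
    then have "sqrt (2 * s * (M - f x)) < N (x - z)" using c by (simp add: R_def)
    then have "2 * s * (M - f x) < (N (x - z))\<^sup>2"
      using real_less_rsqrt[of "N (x-z)"] by (metis N_nonneg linorder_not_less real_le_lsqrt real_sqrt_le_iff real_sqrt_unique)
    then have "M - f x < 1 / (2 * s) * (N (x - z))\<^sup>2" using assms(2) by (simp add: field_simps)
    then have "F z \<le> F x" using M[of z] by (simp add: F_def)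
    also have "F x \<le> F y" using y(2)[of x] R0 by simp
    finally show ?thesis .
  qed (rule y)
  then have "sup_conv s f x = F y"
    unfolding F_def using sup_conv_ge[OF assms] by (intro antisym sup_conv_le) blast+
  then show ?thesis by (auto simp: F_def intro: that)
qed

lemma sup_conv_le_bound:
  assumes "s > 0" "\<And>x. f x \<le> M"
  shows "sup_conv s f x \<le> M"
proof (rule sup_conv_le)
  fix y show "f y - 1 / (2 * s) * (N (x - y))\<^sup>2 \<le> M"
    using assms(2)[of y] assms(1) by (smt (verit) divide_nonneg_nonneg mult_nonneg_nonneg zero_le_power2)
qed

text \<open>A competitor z at x becomes \<open>z + y - x\<close> at y: the penalty is unchanged and
  \<open>f\<close> loses at most \<open>L * N (x - y)\<close>.\<close>

lemma sup_conv_diff: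
  assumes f: "conc_lip L f" and s: "s > 0"
  shows "sup_conv s f x \<le> sup_conv s f y + L * N (x - y)"
proof (rule sup_conv_le)
  fix z
  have "f z \<le> f (z + y - x) + L * N (x - y)"
    using conc_lipD(4)[OF f, of z "z + y - x"] by (simp add: algebra_simps)
  moreover have "f (z + y - x) - 1 / (2 * s) * (N (y - (z + y - x)))\<^sup>2 \<le> sup_conv s f y"
    by (rule sup_conv_ge[OF f s])
  ultimately show "f z - 1 / (2 * s) * (N (x - z))\<^sup>2 \<le> sup_conv s f y + L * N (x - y)"
    by (simp add: algebra_simps)
qed

text \<open>Partial maximisation of a function that is jointly concave in x and y preserves
  concavity: the convex combination w of the two maximisers competes at the combined point.\<close>

lemma conc_lip_sup_conv:
  assumes f: "conc_lip L f" and s: "s > 0"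
  shows "conc_lip L (sup_conv s f)"
proof -
  obtain M where "\<And>x. f x \<le> M" using conc_lip_bound[OF f] by auto
  then show ?thesis
  proof (intro conc_lipI sup_conv_diff[OF f s] sup_conv_le_bound[OF s])
    fix t x y assume t: "0 < t" "t < (1::real)"
    obtain u where u: "sup_conv s f x = f u - 1 / (2 * s) * (N (x - u))\<^sup>2"
      using sup_conv_attained[OF f s] by blast
    obtain v where v: "sup_conv s f y = f v - 1 / (2 * s) * (N (y - v))\<^sup>2"
      using sup_conv_attained[OF f s] by blast
    define w where "w = (1 - t) *\<^sub>R u + t *\<^sub>R v"
    define c where "c = (1 - t) *\<^sub>R x + t *\<^sub>R y"
    have "(1 - t) * f u + t * f v \<le> f w"
      unfolding w_def by (rule conc_lip_concaveD[OF f t])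
    moreover have "c - w = (1 - t) *\<^sub>R (x - u) + t *\<^sub>R (y - v)"
      by (simp add: w_def c_def algebra_simps)
    then have "(N (c - w))\<^sup>2 \<le> (1 - t) * (N (x - u))\<^sup>2 + t * (N (y - v))\<^sup>2"
      using convex_onD[OF convex_on_N_sq, of t "x - u" "y - v"] t by simp
    then have "1 / (2 * s) * (N (c - w))\<^sup>2
        \<le> 1 / (2 * s) * ((1 - t) * (N (x - u))\<^sup>2 + t * (N (y - v))\<^sup>2)"
      using s by (intro mult_left_mono) auto
    moreover have "f w - 1 / (2 * s) * (N (c - w))\<^sup>2 \<le> sup_conv s f c" by (rule sup_conv_ge[OF f s])
    ultimately show "(1 - t) * sup_conv s f x + t * sup_conv s f y
        \<le> sup_conv s f ((1 - t) *\<^sub>R x + t *\<^sub>R y)"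
      unfolding u v c_def[symmetric] by (simp add: algebra_simps diff_divide_distrib add_divide_distrib)
  qed
qed

text \<open>The inequality \<open>N (a + b)^2 / (s + d) \<le> N a^2 / s + N b^2 / d\<close> yields one half of the
  semigroup property of the Hopf-Lax operators, the only one that is needed.\<close>

lemma sup_conv_semigroup:
  assumes f: "conc_lip L f" and s: "s > 0" and d: "d > 0"
  shows "sup_conv s f y - 1 / (2 * d) * (N (x - y))\<^sup>2 \<le> sup_conv (s + d) f x"
proof -
  obtain z where z: "sup_conv s f y = f z - 1 / (2 * s) * (N (y - z))\<^sup>2"
    using sup_conv_attained[OF f s] by blast
  have "(N (x - z))\<^sup>2 \<le> (1 + s / d) * (N (x - y))\<^sup>2 + (1 + 1 / (s / d)) * (N (y - z))\<^sup>2"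
    using N_sq_add_le[of "s / d" "x - y" "y - z"] s d by simp
  then have "1 / (2 * (s + d)) * (N (x - z))\<^sup>2
      \<le> 1 / (2 * (s + d)) * ((1 + s / d) * (N (x - y))\<^sup>2 + (1 + 1 / (s / d)) * (N (y - z))\<^sup>2)"
    using s d by (intro mult_left_mono) auto
  also have "\<dots> = 1 / (2 * d) * (N (x - y))\<^sup>2 + 1 / (2 * s) * (N (y - z))\<^sup>2"
    using s d by (simp add: divide_simps) (simp add: algebra_simps)
  finally have "1 / (2 * (s + d)) * (N (x - z))\<^sup>2
      \<le> 1 / (2 * d) * (N (x - y))\<^sup>2 + 1 / (2 * s) * (N (y - z))\<^sup>2" .
  with sup_conv_ge[OF f, of "s + d" z x] s d z show ?thesis by simp
qed

lemma sup_conv_mono_time: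
  assumes "conc_lip L f" "0 < s" "s \<le> t"
  shows "sup_conv s f x \<le> sup_conv t f x"
proof (cases "s = t")
  case False
  with sup_conv_semigroup[of L f s "t - s" x x] assms show ?thesis by simp
qed simp

lemma sup_conv_sup_conv_le:
  assumes "conc_lip L f" "0 < s" "0 < d"
  shows "sup_conv d (sup_conv s f) x \<le> sup_conv (s + d) f x"
  using sup_conv_semigroup[OF assms] by (intro sup_conv_le) auto

text \<open>Each unit of extra time gains at most the maximum of
  \<open>L * q - q\<^sup>2 / 2\<close> over speeds q, which is \<open>L\<^sup>2 / 2\<close>.\<close>

lemma sup_conv_time_le:
  assumes f: "conc_lip L f" and s: "s > 0" and d: "d \<ge> 0"
  shows "sup_conv (s + d) f x \<le> sup_conv s f x + d * L\<^sup>2 / 2"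
proof (rule sup_conv_le)
  fix y
  \<comment> \<open>Here \<open>q\<close> is the speed of the straight path from x to y during time
    \<open>s + d\<close>, and \<open>y'\<close> is its position after time s; the remaining stretch
    has length \<open>d * q\<close>.\<close>
  define q where "q = N (x - y) / (s + d)"
  define y' where "y' = x + (s / (s + d)) *\<^sub>R (y - x)"
  have sd: "s + d > 0" using s d by simp
  have "y - y' = (d / (s + d)) *\<^sub>R (y - x)"
  proof -
    have "d / (s + d) = 1 - s / (s + d)" using sd by (simp add: field_simps)
    then show ?thesis by (simp add: y'_def scaleR_left_diff_distrib)
  qed
  then have "N (y - y') = d * q" using sd d by (simp add: q_def N_commute)
  then have 1: "f y \<le> f y' + L * (d * q)" using conc_lipD(4)[OF f, of y y'] by simp
  have "N (x - y') = s * q" using sd s by (simp add: q_def y'_def N_commute)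
  then have "f y' - 1 / (2 * s) * (s * q)\<^sup>2 \<le> sup_conv s f x"
    using sup_conv_ge[OF f s, of y' x] by simp
  moreover have "1 / (2 * s) * (s * q)\<^sup>2 = s * q\<^sup>2 / 2"
    using s by (simp add: power_mult_distrib power2_eq_square)
  ultimately have 2: "f y' - s * q\<^sup>2 / 2 \<le> sup_conv s f x" by simp
  have Nq: "N (x - y) = (s + d) * q" using sd by (simp add: q_def)
  have "1 / (2 * r) * (r * q)\<^sup>2 = r * q\<^sup>2 / 2" if "r > 0" for r
    using that by (simp add: power_mult_distrib power2_eq_square)
  from this[OF sd] have 3: "1 / (2 * (s + d)) * (N (x - y))\<^sup>2 = (s + d) * q\<^sup>2 / 2"
    unfolding Nq .
  have "d * (L * q - q\<^sup>2 / 2) \<le> d * (L\<^sup>2 / 2)"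
    using d zero_le_power2[of "L - q"] by (intro mult_left_mono) (auto simp: power2_diff)
  with 1 2 3 show "f y - 1 / (2 * (s + d)) * (N (x - y))\<^sup>2 \<le> sup_conv s f x + d * L\<^sup>2 / 2"
    by (simp add: algebra_simps add_divide_distrib)
qed

lemma sup_conv_time_lipschitz:
  assumes f: "conc_lip L f" and "s > 0" "t > 0"
  shows "\<bar>sup_conv s f x - sup_conv t f x\<bar> \<le> \<bar>s - t\<bar> * (L\<^sup>2 / 2)"
  using assms
proof (induction s t rule: linorder_wlog)
  case (le s t)
  then show ?case
    using sup_conv_time_le[OF f, of s "t - s" x] sup_conv_mono_time[OF f, of s t x] by simp
next
  case (sym s t)
  then show ?case by (simp add: abs_minus_commute)
qed

text \<open>Provides the lower bound under which the real \<open>INF\<close> in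
  \<open>inf_conv\<close> is meaningful. It is again
  \<open>L * q - q\<^sup>2 / 2 \<le> L\<^sup>2 / 2\<close>, at the speed
  \<open>q = N (x - y) / s\<close>.\<close>

lemma inf_conv_bdd:
  assumes f: "conc_lip L f" and s: "s > 0"
  shows "f x - s * L\<^sup>2 / 2 \<le> f y + 1 / (2 * s) * (N (x - y))\<^sup>2"
proof -
  define q where "q = N (x - y) / s"
  have q: "N (x - y) = s * q" using s by (simp add: q_def)
  have "f x \<le> f y + L * (s * q)"
    using conc_lipD(4)[OF f, of x y] by (simp add: q)
  moreover have "s * (L * q - q\<^sup>2 / 2) \<le> s * (L\<^sup>2 / 2)"
    using s zero_le_power2[of "L - q"] by (intro mult_left_mono) (auto simp: power2_diff)
  moreover have "1 / (2 * s) * (s * q)\<^sup>2 = s * q\<^sup>2 / 2"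
    using s by (simp add: power_mult_distrib power2_eq_square)
  ultimately show ?thesis
    unfolding q by (simp add: algebra_simps)
qed

lemma inf_conv_ge:
  assumes "\<And>y. c \<le> f y + 1 / (2 * s) * (N (x - y))\<^sup>2"
  shows "c \<le> inf_conv N s f x"
  unfolding inf_conv_def using assms by (intro cINF_greatest) auto

lemma inf_conv_le:
  assumes f: "conc_lip L f" and s: "s > 0"
  shows "inf_conv N s f x \<le> f y + 1 / (2 * s) * (N (x - y))\<^sup>2"
  unfolding inf_conv_def using inf_conv_bdd[OF f s, of x]
  by (intro cINF_lower) (auto intro!: bdd_belowI2)

lemma inf_conv_le_self: "conc_lip L f \<Longrightarrow> s > 0 \<Longrightarrow> inf_conv N s f x \<le> f x"
  using inf_conv_le[of L f s x x] by simp

text \<open>Written in terms of the displacement h, the infimum-convolution is an infimum over h of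
  \<open>f (x - h)\<close> plus a constant depending on h, and each of these functions is concave in
  x.\<close>

lemma conc_lip_inf_conv:
  assumes f: "conc_lip L f" and s: "s > 0"
  shows "conc_lip L (inf_conv N s f)"
proof -
  obtain M where M: "\<And>x. f x \<le> M" using conc_lip_bound[OF f] by auto
  show ?thesis
  proof (rule conc_lipI)
    show "inf_conv N s f x \<le> M" for x using inf_conv_le_self[OF f s, of x] M[of x] by simp
    fix x y
    have "inf_conv N s f x - L * N (x - y) \<le> inf_conv N s f y"
    proof (rule inf_conv_ge)
      fix z
      have "f (z + x - y) \<le> f z + L * N (x - y)"
        using conc_lipD(4)[OF f, of "z + x - y" z] by (simp add: algebra_simps)
      moreover have "inf_conv N s f x \<le> f (z + x - y) + 1 / (2 * s) * (N (x - (z + x - y)))\<^sup>2"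
        by (rule inf_conv_le[OF f s])
      ultimately show "inf_conv N s f x - L * N (x - y) \<le> f z + 1 / (2 * s) * (N (y - z))\<^sup>2"
        by (simp add: algebra_simps)
    qed
    then show "inf_conv N s f x \<le> inf_conv N s f y + L * N (x - y)" by simp
    fix t :: real assume t: "0 < t" "t < 1"
    show "(1 - t) * inf_conv N s f x + t * inf_conv N s f y
        \<le> inf_conv N s f ((1 - t) *\<^sub>R x + t *\<^sub>R y)"
    proof (rule inf_conv_ge)
      fix z
      define h where "h = (1 - t) *\<^sub>R x + t *\<^sub>R y - z"
      have "(1 - t) * inf_conv N s f x \<le> (1 - t) * (f (x - h) + 1 / (2 * s) * (N h)\<^sup>2)"
        using inf_conv_le[OF f s, of x "x - h"] t by (intro mult_left_mono) auto
      moreover have "t * inf_conv N s f y \<le> t * (f (y - h) + 1 / (2 * s) * (N h)\<^sup>2)"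
        using inf_conv_le[OF f s, of y "y - h"] t by (intro mult_left_mono) auto
      moreover have "(1 - t) *\<^sub>R (x - h) + t *\<^sub>R (y - h) = z"
        by (simp add: h_def algebra_simps)
      then have "(1 - t) * f (x - h) + t * f (y - h) \<le> f z"
        using conc_lip_concaveD[OF f t, of "x - h" "y - h"] by simp
      ultimately show "(1 - t) * inf_conv N s f x + t * inf_conv N s f y
          \<le> f z + 1 / (2 * s) * (N ((1 - t) *\<^sub>R x + t *\<^sub>R y - z))\<^sup>2"
        unfolding h_def[symmetric] by (simp add: algebra_simps diff_divide_distrib)
    qed
  qed
qed

end

section \<open>Smoothness of sup-convolutions\<close>

lemma gradient_eqI:
  fixes f :: "'a::euclidean_space \<Rightarrow> real"
  assumes "(f has_derivative (\<lambda>h. D \<bullet> h)) (at x)"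
  shows "gradient f x = D"
proof -
  have D: "GDERIV f x :> D" using assms by (simp add: gderiv_def inner_commute)
  have "E = D" if "GDERIV f x :> E" for E
  proof -
    have "(f has_derivative (\<lambda>h. E \<bullet> h)) (at x)" using that by (simp add: gderiv_def inner_commute)
    then have "(\<lambda>h. E \<bullet> h) = (\<lambda>h. D \<bullet> h)" using assms by (rule has_derivative_unique)
    then have "(E - D) \<bullet> (E - D) = 0" by (metis inner_diff_left right_minus_eq)
    then show ?thesis by simp
  qed
  with D show ?thesis unfolding gradient_def by (rule the_equality)
qed

lemma has_derivative_gradient:
  fixes f :: "'a::euclidean_space \<Rightarrow> real"
  assumes "f differentiable (at x)"
  shows "(f has_derivative (\<lambda>h. gradient f x \<bullet> h)) (at x)"
proof -
  obtain f' where f': "(f has_derivative f') (at x)" using assms by (auto simp: differentiable_def)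
  interpret f': bounded_linear f' using f' by (rule has_derivative_bounded_linear)
  define D where "D = (\<Sum>b\<in>Basis. f' b *\<^sub>R b)"
  have "f' h = D \<bullet> h" for h
  proof -
    have "f' h = f' (\<Sum>b\<in>Basis. (h \<bullet> b) *\<^sub>R b)" by (simp add: euclidean_representation)
    also have "\<dots> = (\<Sum>b\<in>Basis. (h \<bullet> b) * f' b)" by (simp add: f'.sum f'.scaleR)
    also have "\<dots> = D \<bullet> h"
      by (simp add: D_def inner_sum_left inner_commute[of h] mult.commute)
    finally show ?thesis .
  qed
  then have "(f has_derivative (\<lambda>h. D \<bullet> h)) (at x)" using f' by (metis ext)
  with gradient_eqI show ?thesis by metis
qed

text \<open>The lower bound comes directly from \<open>G\<close>. For the upper bound, concavity
  gives \<open>F y \<le> 2 * F x - F z\<close> at the reflected point z, and \<open>G\<close> bounds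
  \<open>F z\<close> from below.\<close>

lemma concave_has_derivative_if_touched_below:
  fixes F G :: "'a::euclidean_space \<Rightarrow> real"
  assumes F: "concave_on UNIV F"
    and G: "(G has_derivative G') (at x)" "G x = F x" "\<And>y. G y \<le> F y"
  shows "(F has_derivative G') (at x)"
proof -
  interpret G': bounded_linear G' using G(1) by (rule has_derivative_bounded_linear)
  show ?thesis
    unfolding has_derivative_at_alt
  proof (intro conjI allI impI)
    show "bounded_linear G'" by unfold_locales
    fix e :: real assume "e > 0"
    then obtain d where d: "d > 0"
      "\<And>y. norm (y - x) < d \<Longrightarrow> \<bar>G y - G x - G' (y - x)\<bar> \<le> e * norm (y - x)"
      using G(1) unfolding has_derivative_at_alt by auto
    have "\<bar>F y - F x - G' (y - x)\<bar> \<le> e * norm (y - x)" if "norm (y - x) < d" for y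
    proof -
      define z where "z = x - (y - x)"
      have z: "z - x = - (y - x)" by (simp add: z_def)
      then have nz: "norm (z - x) = norm (y - x)" by (metis norm_minus_cancel)
      have Gz: "G' (z - x) = - G' (y - x)" unfolding z by (rule linear_neg[OF G'.linear])
      have "(1 - 1/2) *\<^sub>R y + (1/2) *\<^sub>R z = x" by (simp add: z_def algebra_simps flip: scaleR_add_left)
      then have "F y + F z \<le> 2 * F x"
        using F convex_onD[of UNIV "\<lambda>x. - F x" "1/2" y z] unfolding concave_on_def by simp
      moreover have "\<bar>G y - G x - G' (y - x)\<bar> \<le> e * norm (y - x)" by (rule d(2)[OF that])
      moreover have "\<bar>G z - G x + G' (y - x)\<bar> \<le> e * norm (y - x)"
        using d(2)[of z] that unfolding nz Gz by simp
      ultimately show ?thesis using G(2) G(3)[of y] G(3)[of z] by linarith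
    qed
    with d(1) show "\<exists>d>0. \<forall>y. norm (y - x) < d \<longrightarrow> norm (F y - F x - G' (y - x)) \<le> e * norm (y - x)"
      by auto
  qed
qed

text \<open>The affine majorant minus \<open>F\<close> is minimal at x, so its derivative vanishes
  there.\<close>

lemma concave_supergradient_eq:
  fixes F :: "'a::euclidean_space \<Rightarrow> real"
  assumes "F differentiable (at x)" "\<And>y. F y \<le> F x + D \<bullet> (y - x)"
  shows "D = gradient F x"
proof -
  have "((\<lambda>y. F x + D \<bullet> (y - x) - F y) has_derivative (\<lambda>h. D \<bullet> h - gradient F x \<bullet> h)) (at x)"
    by (auto intro!: derivative_eq_intros has_derivative_gradient assms(1))
  then have "(\<lambda>h. D \<bullet> h - gradient F x \<bullet> h) = (\<lambda>v. 0)"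
    using assms(2) by (intro differential_zero_maxmin[of x UNIV]) auto
  then have "(D - gradient F x) \<bullet> (D - gradient F x) = 0" by (metis inner_diff_left)
  then show ?thesis by simp
qed

lemma concave_gradient:
  fixes F :: "'a::euclidean_space \<Rightarrow> real"
  assumes "concave_on UNIV F" "F differentiable (at x)"
  shows "F y \<le> F x + gradient F x \<bullet> (y - x)"
proof -
  obtain D where D: "\<And>y. - F x + D \<bullet> (y - x) \<le> - F y"
    using convex_on_subgradient[of "\<lambda>x. - F x"] assms(1) unfolding concave_on_def by blast
  have "F y \<le> F x + (- D) \<bullet> (y - x)" for y using D[of y] by simp
  with concave_supergradient_eq[OF assms(2)] show ?thesis by metis
qed

context norm_fun
begin

text \<open>The compact target of the closed graph arguments that make norming functionals and
  gradients continuous.\<close>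

lemma compact_dual_ball: "compact {p. dual_norm N p \<le> c}"
proof -
  obtain C where C: "C > 0" "\<And>x. norm x \<le> C * dual_norm N x" using norm_le_dual by auto
  have "norm p \<le> C * c" if "dual_norm N p \<le> c" for p
    using C(2)[of p] C(1) that by (meson less_imp_le mult_left_mono order_trans)
  then have "bounded {p. dual_norm N p \<le> c}" by (auto simp: bounded_iff)
  moreover have "closed {p. dual_norm N p \<le> c}"
    by (intro closed_Collect_le continuous_on_dual) auto
  ultimately show ?thesis by (simp add: compact_eq_bounded_closed)
qed

text \<open>The midpoint of two norming functionals still norms u and hence has dual norm at least
  1, which strict convexity forbids.\<close>

lemma norming_functional_unique:
  assumes "strictly_convex_norm (dual_norm N)" "u \<noteq> 0"
    and p: "dual_norm N p \<le> 1" "p \<bullet> u = N u" and q: "dual_norm N q \<le> 1" "q \<bullet> u = N u"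
  shows "p = q"
proof (rule ccontr)
  assume "p \<noteq> q"
  have Nu: "N u > 0" using assms(2) by (smt (verit) N_eq_0 N_nonneg)
  have *: "1 \<le> dual_norm N r" if "r \<bullet> u = N u" for r
    using inner_le_dual[of r u] Nu that by simp
  have "dual_norm N p = 1" "dual_norm N q = 1" using p q * by (auto intro: antisym)
  with assms(1) \<open>p \<noteq> q\<close>
  have "0 < t \<and> t < 1 \<longrightarrow> dual_norm N ((1 - t) *\<^sub>R p + t *\<^sub>R q) < 1" for t
    unfolding strictly_convex_norm_def by blast
  from this[of "1/2"] have "dual_norm N ((1 - 1/2) *\<^sub>R p + (1/2) *\<^sub>R q) < 1" by simp
  moreover have "((1 - 1/2) *\<^sub>R p + (1/2) *\<^sub>R q) \<bullet> u = N u"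
    using p q by (simp add: inner_add_left)
  ultimately show False using * by fastforce
qed

text \<open>Uniqueness makes the graph of the norming map \<open>p\<close> closed, and its values
  lie in a compact ball, so \<open>p\<close> is continuous near u. The error in the first-order
  expansion of \<open>N\<close> lies between 0 and
  \<open>(p v - p u) \<bullet> (v - u)\<close>.\<close>

lemma N_has_derivative:
  assumes sc: "strictly_convex_norm (dual_norm N)" and u: "u \<noteq> 0"
  shows "\<exists>D. (N has_derivative (\<lambda>h. D \<bullet> h)) (at u)"
proof -
  have "\<forall>v. \<exists>q. dual_norm N q \<le> 1 \<and> q \<bullet> v = N v" using norming_functional by blast
  then obtain p where p: "\<And>v. dual_norm N (p v) \<le> 1" "\<And>v. p v \<bullet> v = N v" by metis
  have pN: "p v \<bullet> w \<le> N w" for v w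
  proof -
    have "p v \<bullet> w \<le> dual_norm N (p v) * N w" by (rule inner_le_dual)
    also have "\<dots> \<le> 1 * N w" by (intro mult_right_mono p) simp
    finally show ?thesis by simp
  qed
  \<comment> \<open>This ball avoids the origin, at which every functional in the dual ball is
    norming.\<close>
  define S where "S = cball u (norm u / 2)"
  have S0: "v \<noteq> 0" if "v \<in> S" for v using that u by (auto simp: S_def)
  have "(\<lambda>v. (v, p v)) ` S = (S \<times> {q. dual_norm N q \<le> 1}) \<inter> {(v, q). q \<bullet> v = N v}"
  proof (intro set_eqI iffI)
    fix z assume "z \<in> (S \<times> {q. dual_norm N q \<le> 1}) \<inter> {(v, q). q \<bullet> v = N v}"
    then obtain v q where z: "z = (v, q)" "v \<in> S" "dual_norm N q \<le> 1" "q \<bullet> v = N v" by auto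
    then have "q = p v" using norming_functional_unique[OF sc S0] p by blast
    with z show "z \<in> (\<lambda>v. (v, p v)) ` S" by auto
  qed (use p in auto)
  moreover have "closed {(v, q). q \<bullet> v = N v}"
    unfolding case_prod_unfold by (intro closed_Collect_eq continuous_intros)
  moreover have "closed S" by (simp add: S_def)
  ultimately have "closed ((\<lambda>v. (v, p v)) ` S)"
    using compact_imp_closed[OF compact_dual_ball] by (auto intro!: closed_Int closed_Times)
  then have "continuous_on S p"
    using p by (intro continuous_from_closed_graph[OF compact_dual_ball[of 1]]) auto
  moreover have "u \<in> interior S" using u by (simp add: S_def)
  ultimately have cont: "isCont p u" by (rule continuous_on_interior)
  have "(N has_derivative (\<lambda>h. p u \<bullet> h)) (at u)"
    unfolding has_derivative_at_alt
  proof (intro conjI allI impI)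
    show "bounded_linear (\<lambda>h. p u \<bullet> h)" by (rule bounded_linear_inner_right)
    fix e :: real assume "e > 0"
    with cont obtain d where d: "d > 0" "\<And>v. norm (v - u) < d \<Longrightarrow> norm (p v - p u) < e"
      unfolding continuous_at_eps_delta dist_norm by metis
    have "\<bar>N v - N u - p u \<bullet> (v - u)\<bar> \<le> e * norm (v - u)" if "norm (v - u) < d" for v
    proof -
      have "0 \<le> N v - N u - p u \<bullet> (v - u)" using pN[of u v] p(2)[of u] by (simp add: inner_diff_right)
      moreover have "N v - N u - p u \<bullet> (v - u) \<le> (p v - p u) \<bullet> (v - u)"
        using pN[of v u] p(2)[of v] by (simp add: inner_diff_right inner_diff_left)
      moreover have "(p v - p u) \<bullet> (v - u) \<le> norm (p v - p u) * norm (v - u)" by (rule norm_cauchy_schwarz)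
      moreover have "\<dots> \<le> e * norm (v - u)" using d(2)[OF that] by (intro mult_right_mono) auto
      ultimately show ?thesis by linarith
    qed
    with d(1) show "\<exists>d>0. \<forall>v. norm (v - u) < d \<longrightarrow> norm (N v - N u - p u \<bullet> (v - u)) \<le> e * norm (v - u)"
      by auto
  qed
  then show ?thesis ..
qed

text \<open>Squaring removes the singularity of \<open>N\<close> at the origin, where the square is
  of second order; elsewhere the chain rule applies.\<close>

lemma N_sq_has_derivative:
  assumes sc: "strictly_convex_norm (dual_norm N)"
  shows "\<exists>D. ((\<lambda>x. (N x)\<^sup>2) has_derivative D) (at u)"
proof (cases "u = 0")
  case True
  obtain C where C: "C > 0" "\<And>x. N x \<le> C * norm x" using N_upper by auto
  have "((\<lambda>x. (N x)\<^sup>2) has_derivative (\<lambda>h. 0)) (at 0)"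
    unfolding has_derivative_at_alt
  proof (intro conjI allI impI)
    fix e :: real assume "e > 0"
    have "\<bar>(N y)\<^sup>2\<bar> \<le> e * norm y" if "norm y < e / C\<^sup>2" for y
    proof -
      have "(N y)\<^sup>2 \<le> (C * norm y)\<^sup>2" by (intro power_mono C) simp
      also have "\<dots> = (C\<^sup>2 * norm y) * norm y" by (simp add: power2_eq_square)
      also have "\<dots> \<le> e * norm y"
        using that C(1) by (intro mult_right_mono) (auto simp: field_simps)
      finally show ?thesis by simp
    qed
    moreover have "e / C\<^sup>2 > 0" using C(1) \<open>e > 0\<close> by simp
    ultimately show "\<exists>d>0. \<forall>y. norm (y - 0) < d \<longrightarrow> norm ((N y)\<^sup>2 - (N 0)\<^sup>2 - 0) \<le> e * norm (y - 0)"
      by (intro exI[of _ "e / C\<^sup>2"]) simp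
  qed simp
  with True show ?thesis by blast
next
  case False
  then obtain D where "(N has_derivative (\<lambda>h. D \<bullet> h)) (at u)" using N_has_derivative[OF sc] by auto
  then have "((\<lambda>x. (N x)\<^sup>2) has_derivative (\<lambda>h. 2 * (D \<bullet> h) * N u)) (at u)"
    by (auto intro!: derivative_eq_intros simp: algebra_simps)
  then show ?thesis by blast
qed

text \<open>If z is a maximiser at x, the paraboloid centred at z is differentiable at x and touches
  the concave function \<open>sup_conv s f\<close> there from below.\<close>

lemma sup_conv_differentiable:
  assumes sc: "strictly_convex_norm (dual_norm N)" and f: "conc_lip L f" and s: "s > 0"
  shows "sup_conv s f differentiable (at x)"
proof -
  obtain z where z: "sup_conv s f x = f z - 1 / (2 * s) * (N (x - z))\<^sup>2"
    using sup_conv_attained[OF f s] by blast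
  obtain D where D: "((\<lambda>x. (N x)\<^sup>2) has_derivative D) (at (x - z))"
    using N_sq_has_derivative[OF sc] by blast
  have "((\<lambda>y. y - z) has_derivative (\<lambda>h. h)) (at x)"
    by (auto intro!: derivative_eq_intros)
  from has_derivative_compose[OF this D]
  have "((\<lambda>y. f z - 1 / (2 * s) * (N (y - z))\<^sup>2) has_derivative (\<lambda>h. 0 - 1 / (2 * s) * D h)) (at x)"
    by (intro has_derivative_diff has_derivative_mult_right has_derivative_const)
  from concave_has_derivative_if_touched_below[OF conc_lipD(1)[OF conc_lip_sup_conv[OF f s]] this]
  show ?thesis using z sup_conv_ge[OF f s] by (auto simp: differentiable_def)
qed

lemma gradient_dual_le:
  assumes f: "conc_lip L f" and d: "f differentiable (at x)"
  shows "dual_norm N (gradient f x) \<le> L"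
proof (rule dual_le)
  fix v assume v: "N v = 1"
  have "f (x - v) \<le> f x - gradient f x \<bullet> v"
    using concave_gradient[OF conc_lipD(1)[OF f] d, of "x - v"] by simp
  moreover have "f x \<le> f (x - v) + L * N v" using conc_lipD(4)[OF f, of x "x - v"] by simp
  ultimately show "gradient f x \<bullet> v \<le> L" using v by simp
qed

text \<open>For a differentiable concave function the graph of the gradient is the set of all pairs
  of a point and a supergradient, an intersection of closed sets. By the Lipschitz bound the
  gradients stay in a compact dual ball.\<close>

lemma conc_lip_C1:
  assumes f: "conc_lip L f" and d: "\<And>x. f differentiable (at x)"
  shows "C1_smooth f"
proof -
  have "range (\<lambda>x. (x, gradient f x)) = (\<Inter>y. {(x, D). f y \<le> f x + D \<bullet> (y - x)})"
  proof (intro set_eqI iffI)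
    fix z assume "z \<in> (\<Inter>y. {(x, D). f y \<le> f x + D \<bullet> (y - x)})"
    then have "f y \<le> f (fst z) + snd z \<bullet> (y - fst z)" for y
      by (simp add: case_prod_unfold)
    then have "snd z = gradient f (fst z)" by (rule concave_supergradient_eq[OF d])
    then show "z \<in> range (\<lambda>x. (x, gradient f x))" by (auto simp: prod_eq_iff intro!: image_eqI[of _ _ "fst z"])
  qed (auto intro: concave_gradient[OF conc_lipD(1)[OF f] d])
  moreover have "closed (\<Inter>y. {(x, D). f y \<le> f x + D \<bullet> (y - x)})"
    unfolding case_prod_unfold
  proof (intro closed_INT ballI closed_Collect_le)
    have *: "continuous_on UNIV (\<lambda>z::'a \<times> 'a. f (fst z))"
      by (rule continuous_on_compose2[OF conc_lipD(5)[OF f, of UNIV]])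
        (auto intro: continuous_on_fst continuous_on_id)
    show "continuous_on UNIV (\<lambda>z. f (fst z) + snd z \<bullet> (y - fst z))" for y
      by (intro continuous_on_add[OF *] continuous_intros)
  qed simp
  ultimately have "continuous_on UNIV (gradient f)"
    using gradient_dual_le[OF f d]
    by (intro continuous_from_closed_graph[OF compact_dual_ball[of L]]) auto
  with d show ?thesis by (simp add: C1_smooth_def)
qed

text \<open>The lower half of the Hamilton-Jacobi equation. By the semigroup inequality, a
  displacement \<open>h *\<^sub>R v\<close> during time h gains
  \<open>h * (D \<bullet> v - (N v)\<^sup>2 / 2)\<close> to first order, and the supremum over v is
  half the squared dual norm of \<open>D\<close>.\<close>

lemma sup_conv_time_derivative_lower:
  assumes f: "conc_lip L f" and s: "s > 0" and d: "sup_conv s f differentiable (at x)"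
    and c: "c < (dual_norm N (gradient (sup_conv s f) x))\<^sup>2 / 2"
  shows "\<forall>\<^sub>F h in at_right 0. c < (sup_conv (s + h) f x - sup_conv s f x) / h"
proof -
  define D where "D = gradient (sup_conv s f) x"
  define n where "n = dual_norm N D"
  have "\<exists>v. c < D \<bullet> v - (N v)\<^sup>2 / 2"
  proof (cases "n = 0")
    case True
    with c show ?thesis by (intro exI[of _ 0]) (simp add: n_def D_def)
  next
    case False
    then have n: "n > 0" using dual_nonneg[of D] by (simp add: n_def less_le)
    \<comment> \<open>The optimal v is n times a norming vector; an almost norming one suffices
      because c lies strictly below the supremum.\<close>
    have "(c + n\<^sup>2 / 2) / n < n"
      using c n by (simp add: field_simps power2_eq_square n_def D_def)
    then obtain v where v: "N v = 1" "(c + n\<^sup>2 / 2) / n < D \<bullet> v"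
      using dual_less_ex unfolding n_def by blast
    then have "c + n\<^sup>2 / 2 < n * (D \<bullet> v)" using n by (simp add: field_simps)
    then show ?thesis using v n by (intro exI[of _ "n *\<^sub>R v"]) simp
  qed
  then obtain v where v: "c < D \<bullet> v - (N v)\<^sup>2 / 2" ..
  have "((\<lambda>h. sup_conv s f (x + h *\<^sub>R v)) has_derivative (\<lambda>h. D \<bullet> (h *\<^sub>R v))) (at 0)"
  proof (rule has_derivative_compose[of "\<lambda>h. x + h *\<^sub>R v" "\<lambda>h. h *\<^sub>R v" 0 UNIV, simplified])
    show "((\<lambda>h. x + h *\<^sub>R v) has_derivative (\<lambda>h. h *\<^sub>R v)) (at 0)"
      by (auto intro!: derivative_eq_intros)
    show "(sup_conv s f has_derivative (\<bullet>) D) (at x)"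
      using has_derivative_gradient[OF d] by (simp add: D_def)
  qed
  moreover have "(\<lambda>h. D \<bullet> (h *\<^sub>R v)) = (*) (D \<bullet> v)" by (auto simp: mult.commute)
  ultimately have "((\<lambda>h. sup_conv s f (x + h *\<^sub>R v)) has_real_derivative (D \<bullet> v)) (at 0)"
    unfolding has_field_derivative_def by simp
  then have "((\<lambda>h. (sup_conv s f (x + h *\<^sub>R v) - sup_conv s f x) / h) \<longlongrightarrow> D \<bullet> v) (at 0)"
    by (simp add: has_field_derivative_iff)
  then have "((\<lambda>h. (sup_conv s f (x + h *\<^sub>R v) - sup_conv s f x) / h) \<longlongrightarrow> D \<bullet> v) (at_right 0)"
    by (rule tendsto_within_subset) auto
  then have "\<forall>\<^sub>F h in at_right 0. c + (N v)\<^sup>2 / 2 < (sup_conv s f (x + h *\<^sub>R v) - sup_conv s f x) / h"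
    using v by (intro order_tendstoD(1)) auto
  moreover have "\<forall>\<^sub>F h::real in at_right 0. 0 < h" by (simp add: eventually_at_right_less)
  ultimately show ?thesis
  proof eventually_elim
    case (elim h)
    have "sup_conv s f (x + h *\<^sub>R v) - 1 / (2 * h) * (N (x - (x + h *\<^sub>R v)))\<^sup>2 \<le> sup_conv (s + h) f x"
      using elim by (intro sup_conv_semigroup[OF f s])
    then have "sup_conv s f (x + h *\<^sub>R v) - h * (N v)\<^sup>2 / 2 \<le> sup_conv (s + h) f x"
      using elim by (simp add: power_mult_distrib power2_eq_square mult_ac)
    then have "(sup_conv s f (x + h *\<^sub>R v) - h * (N v)\<^sup>2 / 2 - sup_conv s f x) / h
        \<le> (sup_conv (s + h) f x - sup_conv s f x) / h"
      using elim by (intro divide_right_mono) auto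
    then have "(sup_conv s f (x + h *\<^sub>R v) - sup_conv s f x) / h - (N v)\<^sup>2 / 2
        \<le> (sup_conv (s + h) f x - sup_conv s f x) / h"
      using elim by (simp add: diff_divide_distrib)
    with elim show ?case by linarith
  qed
qed

end

section \<open>The class of test functions\<close>

context norm_fun
begin

text \<open>Eliminates the extended-valued \<open>g\<close>: at every point some paraboloid below
  \<open>f\<close> comes within e of \<open>f\<close>. The error e is there because the supremum is
  not assumed to be attained.\<close>

lemma sq_norm_convex_iff:
  "sq_norm_convex N lam (\<lambda>x. ereal (f x)) \<longleftrightarrow>
    (\<forall>x. \<forall>e>0. \<exists>z. \<forall>w. f x - e + lam / 2 * (N (x - z))\<^sup>2 - lam / 2 * (N (w - z))\<^sup>2 \<le> f w)"
  (is "?A \<longleftrightarrow> ?B")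
proof
  assume ?A
  then obtain g :: "'a \<Rightarrow> ereal"
    where g: "\<And>x. ereal (f x) = (SUP y. g y - ereal (lam / 2 * (N (x - y))\<^sup>2))"
    unfolding sq_norm_convex_def by auto
  show ?B
  proof (intro allI impI)
    fix x and e :: real assume "e > 0"
    then have "ereal (f x - e) < (SUP y. g y - ereal (lam / 2 * (N (x - y))\<^sup>2))"
      unfolding g[symmetric] by simp
    then obtain z where z: "ereal (f x - e) < g z - ereal (lam / 2 * (N (x - z))\<^sup>2)"
      unfolding less_SUP_iff by auto
    have le: "g z - ereal (lam / 2 * (N (w - z))\<^sup>2) \<le> ereal (f w)" for w
      unfolding g by (rule SUP_upper) simp
    obtain r where r: "g z = ereal r"
      using z le[of x] by (cases "g z") auto
    have "f x - e + lam / 2 * (N (x - z))\<^sup>2 - lam / 2 * (N (w - z))\<^sup>2 \<le> f w" for w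
      using z le[of w] unfolding r by simp
    then show "\<exists>z. \<forall>w. f x - e + lam / 2 * (N (x - z))\<^sup>2 - lam / 2 * (N (w - z))\<^sup>2 \<le> f w" by blast
  qed
next
  assume B: ?B
  \<comment> \<open>The largest \<open>g\<close> whose paraboloids all stay below
    \<open>f\<close>.\<close>
  define g where "g y = (INF w. ereal (f w + lam / 2 * (N (w - y))\<^sup>2))" for y
  have "ereal (f x) = (SUP y. g y - ereal (lam / 2 * (N (x - y))\<^sup>2))" for x
  proof (rule antisym)
    show "(SUP y. g y - ereal (lam / 2 * (N (x - y))\<^sup>2)) \<le> ereal (f x)"
    proof (rule SUP_least)
      fix y
      have "g y \<le> ereal (f x + lam / 2 * (N (x - y))\<^sup>2)" unfolding g_def by (rule INF_lower) simp
      then show "g y - ereal (lam / 2 * (N (x - y))\<^sup>2) \<le> ereal (f x)"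
        by (cases "g y") auto
    qed
    show "ereal (f x) \<le> (SUP y. g y - ereal (lam / 2 * (N (x - y))\<^sup>2))"
    proof (rule ereal_le_epsilon2)
      fix e :: real assume "e > 0"
      with B obtain z where z: "\<And>w. f x - e + lam / 2 * (N (x - z))\<^sup>2 - lam / 2 * (N (w - z))\<^sup>2 \<le> f w"
        by blast
      have "f x - e + lam / 2 * (N (x - z))\<^sup>2 \<le> f w + lam / 2 * (N (w - z))\<^sup>2" for w
        using z[of w] by linarith
      then have "ereal (f x - e + lam / 2 * (N (x - z))\<^sup>2) \<le> g z"
        unfolding g_def by (intro INF_greatest) simp
      then have "ereal (f x) \<le> g z - ereal (lam / 2 * (N (x - z))\<^sup>2) + ereal e"
        by (cases "g z") (auto simp: algebra_simps)
      also have "\<dots> \<le> (SUP y. g y - ereal (lam / 2 * (N (x - y))\<^sup>2)) + ereal e"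
        by (intro add_right_mono SUP_upper) simp
      finally show "ereal (f x) \<le> (SUP y. g y - ereal (lam / 2 * (N (x - y))\<^sup>2)) + ereal e" .
    qed
  qed
  then show ?A unfolding sq_norm_convex_def by blast
qed

lemma F_class_iff:
  "\<phi> \<in> F_class N lam \<longleftrightarrow> (\<exists>L. conc_lip L \<phi>) \<and> sq_norm_convex N lam (\<lambda>x. ereal (\<phi> x))"
  unfolding F_class_def conc_lip_def by auto

text \<open>With \<open>t = lam' / lam\<close>, the point \<open>x - t (x - z)\<close> is where the paraboloid of opening \<open>lam\<close> centred
  at it touches the one of opening \<open>lam'\<close> centred at \<open>z\<close>.\<close>

lemma sq_norm_convex_mono:
  assumes "sq_norm_convex N lam' (\<lambda>x. ereal (f x))" "0 < lam'" "lam' \<le> lam"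
  shows "sq_norm_convex N lam (\<lambda>x. ereal (f x))"
  unfolding sq_norm_convex_iff
proof (intro allI impI)
  fix x and e :: real assume "e > 0"
  with assms(1) obtain z
    where z: "\<And>w. f x - e + lam' / 2 * (N (x - z))\<^sup>2 - lam' / 2 * (N (w - z))\<^sup>2 \<le> f w"
    unfolding sq_norm_convex_iff by blast
  define t where "t = lam' / lam"
  define b where "b = N (x - z)"
  have t: "lam' = lam * t" "0 < t" "t \<le> 1" using assms by (auto simp: t_def)
  define y where "y = x - t *\<^sub>R (x - z)"
  have xy: "N (x - y) = t * b" using t by (simp add: y_def b_def)
  have "y - z = (1 - t) *\<^sub>R (x - z)" by (simp add: y_def algebra_simps)
  then have yz: "N (y - z) = (1 - t) * b" using t by (simp add: b_def)
  have "f x - e + lam / 2 * (N (x - y))\<^sup>2 - lam / 2 * (N (w - y))\<^sup>2 \<le> f w" for w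
  proof -
    define a where "a = N (w - y)"
    have "N (w - z) \<le> a + (1 - t) * b"
      using N_triangle_diff[of w z y] by (simp add: a_def yz)
    then have "(N (w - z))\<^sup>2 \<le> (a + (1 - t) * b)\<^sup>2" by (rule power_mono) simp
    then have "lam' * (N (w - z))\<^sup>2 \<le> lam' * (a + (1 - t) * b)\<^sup>2"
      using assms by (intro mult_left_mono) auto
    moreover have "lam' * b\<^sup>2 - lam' * (a + (1 - t) * b)\<^sup>2 + lam * a\<^sup>2 - lam * (t * b)\<^sup>2
        = (lam - lam') * (a - t * b)\<^sup>2"
      unfolding t(1) by (simp add: power2_eq_square algebra_simps)
    moreover have "0 \<le> (lam - lam') * (a - t * b)\<^sup>2" using assms by simp
    ultimately show ?thesis
      using z[of w] unfolding xy b_def[symmetric] a_def[symmetric] by (simp add: algebra_simps)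
  qed
  then show "\<exists>z. \<forall>w. f x - e + lam / 2 * (N (x - z))\<^sup>2 - lam / 2 * (N (w - z))\<^sup>2 \<le> f w" by blast
qed

lemma conc_lip_scale:
  assumes f: "conc_lip L f" and k: "k \<ge> 0"
  shows "conc_lip (k * L) (\<lambda>x. k * f x)"
proof -
  obtain M where M: "\<And>x. f x \<le> M" using conc_lip_bound[OF f] by auto
  show ?thesis
  proof (rule conc_lipI)
    fix t x y
    show "k * f x \<le> k * M" using M k by (rule mult_left_mono)
    show "k * f x \<le> k * f y + k * L * N (x - y)"
      using mult_left_mono[OF conc_lipD(4)[OF f, of x y] k] by (simp add: algebra_simps)
    assume "0 < t" "t < (1::real)"
    from mult_left_mono[OF conc_lip_concaveD[OF f this] k]
    show "(1 - t) * (k * f x) + t * (k * f y) \<le> k * f ((1 - t) *\<^sub>R x + t *\<^sub>R y)"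
      by (simp add: algebra_simps)
  qed
qed

text \<open>Multiplication by k turns paraboloids of opening \<open>1 / s\<close> into ones of
  opening \<open>k / s\<close>. With \<open>k = \<rho> * t\<close> and \<open>s = 1 - t\<close> the
  hypothesis \<open>k / s \<le> lam\<close> is the time restriction of the flow.\<close>

lemma F_class_sup_conv:
  assumes f: "conc_lip L f" and s: "s > 0" and k: "k > 0" "k / s \<le> lam"
  shows "(\<lambda>x. k * sup_conv s f x) \<in> F_class N lam"
proof -
  have "sq_norm_convex N (k / s) (\<lambda>x. ereal (k * sup_conv s f x))"
    unfolding sq_norm_convex_iff
  proof (intro allI impI)
    fix x and e :: real assume "e > 0"
    obtain z where z: "sup_conv s f x = f z - 1 / (2 * s) * (N (x - z))\<^sup>2"
      using sup_conv_attained[OF f s] by blast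
    have "k * sup_conv s f x - e + k / s / 2 * (N (x - z))\<^sup>2 - k / s / 2 * (N (w - z))\<^sup>2
        \<le> k * sup_conv s f w" for w
    proof -
      have "k * (f z - 1 / (2 * s) * (N (w - z))\<^sup>2) \<le> k * sup_conv s f w"
        using k by (intro mult_left_mono sup_conv_ge[OF f s]) auto
      then show ?thesis using \<open>e > 0\<close> unfolding z by (simp add: algebra_simps)
    qed
    then show "\<exists>z. \<forall>w. k * sup_conv s f x - e + k / s / 2 * (N (x - z))\<^sup>2 - k / s / 2 * (N (w - z))\<^sup>2
        \<le> k * sup_conv s f w" by blast
  qed
  then show ?thesis
    unfolding F_class_iff using sq_norm_convex_mono[of "k / s"] k s
    using conc_lip_scale[OF conc_lip_sup_conv[OF f s], of k] by auto
qed


text \<open>Here \<open>f\<close> is recovered as the sup-convolution of its infimum-convolution,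
  and a sup-convolution of a concave Lipschitz function has a maximiser; this removes the e of
  \<open>sq_norm_convex_iff\<close>.\<close>

lemma sq_norm_convex_attained:
  assumes f: "conc_lip L f" and q: "sq_norm_convex N lam (\<lambda>x. ereal (f x))" and lam: "lam > 0"
  obtains z where "\<And>w. f x + lam / 2 * (N (x - z))\<^sup>2 - lam / 2 * (N (w - z))\<^sup>2 \<le> f w"
proof -
  define s where "s = 1 / lam"
  have s: "s > 0" "1 / (2 * s) = lam / 2" using lam by (auto simp: s_def)
  define g where "g = inf_conv N s f"
  have g: "conc_lip L g" unfolding g_def by (rule conc_lip_inf_conv[OF f s(1)])
  obtain z where z: "sup_conv s g x = g z - 1 / (2 * s) * (N (x - z))\<^sup>2"
    using sup_conv_attained[OF g s(1)] by blast
  have "f x \<le> sup_conv s g x"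
  proof (rule field_le_epsilon)
    fix e :: real assume "e > 0"
    with q obtain y where y: "\<And>w. f x - e + lam / 2 * (N (x - y))\<^sup>2 - lam / 2 * (N (w - y))\<^sup>2 \<le> f w"
      unfolding sq_norm_convex_iff by blast
    have "f x - e + lam / 2 * (N (x - y))\<^sup>2 \<le> g y"
      unfolding g_def
    proof (rule inf_conv_ge)
      fix w show "f x - e + lam / 2 * (N (x - y))\<^sup>2 \<le> f w + 1 / (2 * s) * (N (y - w))\<^sup>2"
        using y[of w] unfolding s(2) N_commute[of y w] by linarith
    qed
    with sup_conv_ge[OF g s(1), of y x] show "f x \<le> sup_conv s g x + e" unfolding s(2) by simp
  qed
  moreover have "g z - lam / 2 * (N (w - z))\<^sup>2 \<le> f w" for w
    using inf_conv_le[OF f s(1), of z w] unfolding g_def s(2) N_commute[of z w] by simp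
  ultimately have "f x + lam / 2 * (N (x - z))\<^sup>2 - lam / 2 * (N (w - z))\<^sup>2 \<le> f w" for w
    using z unfolding s(2) by (smt (verit))
  then show ?thesis by (rule that)
qed

text \<open>The paraboloid centred at z bounds \<open>f x - f y\<close> by
  \<open>lam' * u * a + lam' / 2 * a\<^sup>2\<close>. Subtracting the larger
  \<open>lam / 2 * a\<^sup>2\<close> and using \<open>lam' * u \<le> n\<close> leaves
  \<open>n * a - (lam - lam') / 2 * a\<^sup>2\<close>, whose maximum over a is the stated
  bound.\<close>

lemma inf_conv_gradient_bound:
  assumes f: "conc_lip L f" and q: "sq_norm_convex N lam' (\<lambda>x. ereal (f x))"
    and lam: "0 < lam'" "lam' < lam" and d: "f differentiable (at x)"
  shows "f x - inf_conv N (1 / lam) f x \<le> (dual_norm N (gradient f x))\<^sup>2 / (2 * (lam - lam'))"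
proof -
  define n where "n = dual_norm N (gradient f x)"
  obtain z where z: "\<And>w. f x + lam' / 2 * (N (x - z))\<^sup>2 - lam' / 2 * (N (w - z))\<^sup>2 \<le> f w"
    using sq_norm_convex_attained[OF f q lam(1)] by blast
  define u where "u = N (x - z)"
  have u0: "u \<ge> 0" by (simp add: u_def)
  have "lam' * u\<^sup>2 \<le> n * u"
  proof (rule field_le_epsilon)
    fix e :: real assume "e > 0"
    \<comment> \<open>Small enough that the second-order term
      \<open>t * (lam' * u\<^sup>2) / 2\<close> stays below e; the summand 1 keeps the denominator
      positive when \<open>u = 0\<close>.\<close>
    define t where "t = min 1 (2 * e / (lam' * u\<^sup>2 + 1))"
    have den: "lam' * u\<^sup>2 + 1 > 0" using lam by (smt (verit) mult_nonneg_nonneg zero_le_power2)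
    have t: "0 < t" "t \<le> 1" using \<open>e > 0\<close> den by (auto simp: t_def)
    have "t \<le> 2 * e / (lam' * u\<^sup>2 + 1)" by (simp add: t_def)
    then have "t * (lam' * u\<^sup>2 + 1) \<le> 2 * e" using den by (simp add: pos_le_divide_eq)
    then have te: "t * (lam' * u\<^sup>2) \<le> 2 * e" using t by (simp add: algebra_simps)
    have "x - t *\<^sub>R (x - z) - z = (1 - t) *\<^sub>R (x - z)" by (simp add: algebra_simps)
    then have "N (x - t *\<^sub>R (x - z) - z) = (1 - t) * u" using t by (simp add: u_def)
    with z[of "x - t *\<^sub>R (x - z)"]
    have "f x + lam' / 2 * u\<^sup>2 - lam' / 2 * ((1 - t) * u)\<^sup>2 \<le> f (x - t *\<^sub>R (x - z))"
      by (simp add: u_def)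
    also have "\<dots> \<le> f x + gradient f x \<bullet> (- (t *\<^sub>R (x - z)))"
      using concave_gradient[OF conc_lipD(1)[OF f] d, of "x - t *\<^sub>R (x - z)"] by simp
    also have "gradient f x \<bullet> (- (t *\<^sub>R (x - z))) \<le> t * (n * u)"
      using inner_le_dual[of "gradient f x" "- (t *\<^sub>R (x - z))"] t by (simp add: n_def u_def mult_ac)
    finally have "t * (lam' * u\<^sup>2) \<le> t * (n * u + t * (lam' * u\<^sup>2) / 2)"
      by (simp add: power2_eq_square algebra_simps)
    then have "lam' * u\<^sup>2 \<le> n * u + t * (lam' * u\<^sup>2) / 2" using t by simp
    with te show "lam' * u\<^sup>2 \<le> n * u + e" by linarith
  qed
  then have un: "lam' * u \<le> n"
    using u0 dual_nonneg[of "gradient f x"] by (cases "u = 0") (auto simp: power2_eq_square n_def)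
  have "f x - n\<^sup>2 / (2 * (lam - lam')) \<le> inf_conv N (1 / lam) f x"
  proof (rule inf_conv_ge)
    fix y
    define a where "a = N (x - y)"
    have a0: "a \<ge> 0" by (simp add: a_def)
    have "N (y - z) \<le> u + a"
      using N_triangle_diff[of y z x] by (simp add: a_def u_def N_commute add.commute)
    then have "(N (y - z))\<^sup>2 \<le> (u + a)\<^sup>2" by (rule power_mono) auto
    then have "lam' / 2 * (N (y - z))\<^sup>2 \<le> lam' / 2 * (u + a)\<^sup>2" using lam by (intro mult_left_mono) auto
    then have "f x - f y \<le> lam' / 2 * (u + a)\<^sup>2 - lam' / 2 * u\<^sup>2"
      using z[of y] unfolding u_def by linarith
    then have "f x - f y - lam / 2 * a\<^sup>2 \<le> (lam' * u) * a - (lam - lam') / 2 * a\<^sup>2"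
      by (simp add: power2_eq_square algebra_simps diff_divide_distrib)
    also have "(lam' * u) * a \<le> n * a" using un a0 by (intro mult_right_mono) auto
    also have "n * a - (lam - lam') / 2 * a\<^sup>2 \<le> n\<^sup>2 / (2 * (lam - lam'))"
    proof -
      have "0 \<le> (n - (lam - lam') * a)\<^sup>2 / (2 * (lam - lam'))" using lam by simp
      also have "\<dots> = n\<^sup>2 / (2 * (lam - lam')) - n * a + (lam - lam') / 2 * a\<^sup>2"
        using lam by (simp add: power2_eq_square field_simps)
      finally show ?thesis by linarith
    qed
    finally show "f x - n\<^sup>2 / (2 * (lam - lam')) \<le> f y + 1 / (2 * (1 / lam)) * (N (x - y))\<^sup>2"
      by (simp add: a_def)
  qed
  then show ?thesis by (simp add: n_def)
qed

end

section \<open>From the infimum-convolution to the gradient inequality\<close>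

text \<open>Continuous induction from the right end: the points t with
  \<open>F b - F t \<le> e * (b - t)\<close> form a compact set, and a left step leads from its
  least element to a smaller one unless it is a. The steps go left because the logarithmic Sobolev
  inequality at time t is compared with an earlier time.\<close>

lemma nonincreasing_if_left_steps:
  fixes F :: "real \<Rightarrow> real"
  assumes "a \<le> b" and cont: "continuous_on {a..b} F"
    and step: "\<And>t e. a < t \<Longrightarrow> t \<le> b \<Longrightarrow> 0 < e \<Longrightarrow> \<exists>d>0. d \<le> t - a \<and> F t - F (t - d) \<le> e * d"
  shows "F b \<le> F a"
proof (rule field_le_epsilon)
  fix e' :: real assume "e' > 0"
  define e where "e = e' / (b - a + 1)"
  have e: "e > 0" using \<open>e' > 0\<close> assms(1) by (simp add: e_def)
  define S where "S = {t \<in> {a..b}. F b - F t \<le> e * (b - t)}"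
  have "closed S"
    unfolding S_def by (intro continuous_closed_preimage_constant continuous_on_closed_Collect_le cont continuous_intros)
  then have "compact S"
    unfolding compact_eq_bounded_closed
    by (auto simp: S_def intro: bounded_subset[of "{a..b}"])
  moreover have "b \<in> S" using assms(1) by (simp add: S_def)
  ultimately obtain t where t: "t \<in> S" "\<And>u. u \<in> S \<Longrightarrow> t \<le> u"
    using compact_attains_inf[of S] by blast
  have "t = a"
  proof (rule ccontr)
    assume "t \<noteq> a"
    then have "a < t" "t \<le> b" using t(1) by (auto simp: S_def)
    then obtain d where d: "d > 0" "d \<le> t - a" "F t - F (t - d) \<le> e * d" using step e by blast
    then have "t - d \<in> S" using t(1) by (auto simp: S_def algebra_simps)
    with t(2)[of "t - d"] d(1) show False by simp
  qed
  then have "F b - F a \<le> e * (b - a)" using t(1) by (simp add: S_def)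
  also have "\<dots> \<le> e'" using \<open>e' > 0\<close> assms(1) by (simp add: e_def field_simps)
  finally show "F b \<le> F a + e'" by simp
qed

text \<open>Dominates the difference quotients \<open>(exp (k * g) - 1) / k\<close> as k tends to
  0.\<close>

lemma abs_exp_minus_one_le: "\<bar>exp y - 1\<bar> \<le> \<bar>y\<bar> * exp (max y 0)" for y :: real
proof (cases "y \<le> 0")
  case True
  have "1 - exp y \<le> - y" using exp_ge_add_one_self[of y] by linarith
  with True show ?thesis by (simp add: max_def)
next
  case False
  have "(1 - y) * exp y \<le> exp (- y) * exp y"
    using exp_ge_add_one_self[of "- y"] by (intro mult_right_mono) auto
  then have "(1 - y) * exp y \<le> 1" by (simp flip: exp_add)
  with False show ?thesis by (simp add: algebra_simps)
qed

section \<open>Integrals of concave Lipschitz functions\<close>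

locale norm_prob = norm_fun N + prob_space M
  for N :: "'a::euclidean_space \<Rightarrow> real" and M :: "'a measure" +
  assumes sets_M [measurable_cong]: "sets M = sets borel"
    and integrable_norm: "integrable M (\<lambda>x. norm x)"
begin

lemma space_M [simp]: "space M = UNIV"
  using sets_eq_imp_space_eq[OF sets_M] by simp

lemma borel_M: "f \<in> borel_measurable borel \<Longrightarrow> f \<in> borel_measurable M"
  by simp

lemma integrable_dominated:
  fixes f g :: "'a \<Rightarrow> real"
  assumes "integrable M g" "f \<in> borel_measurable M" "\<And>x. \<bar>f x\<bar> \<le> g x"
  shows "integrable M f"
  using assms(1,2)
proof (rule Bochner_Integration.integrable_bound)
  show "AE x in M. norm (f x) \<le> norm (g x)"
    using assms(3) by (intro AE_I2) (metis abs_ge_self order_trans real_norm_def)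
qed

lemma integrable_conc_lip:
  assumes f: "conc_lip L f"
  shows "integrable M f"
proof -
  obtain C where C: "C > 0" "\<And>x. N x \<le> C * norm x" using N_upper by auto
  have bound: "\<bar>f x\<bar> \<le> \<bar>f 0\<bar> + L * (C * norm x)" for x
  proof -
    have "\<bar>f x - f 0\<bar> \<le> L * N x" using conc_lipD(2)[OF f, of x 0] by simp
    also have "\<dots> \<le> L * (C * norm x)" using conc_lip_nonneg[OF f] C by (intro mult_left_mono) auto
    finally show ?thesis by linarith
  qed
  show ?thesis
  proof (rule integrable_dominated[OF _ borel_M[OF conc_lipD(6)[OF f]] bound])
    show "integrable M (\<lambda>x. \<bar>f 0\<bar> + L * (C * norm x))"
      using integrable_norm by (intro Bochner_Integration.integrable_add integrable_mult_right) auto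
  qed
qed

lemma integrable_bounded:
  fixes f :: "'a \<Rightarrow> real"
  assumes "f \<in> borel_measurable M" "\<And>x. \<bar>f x\<bar> \<le> B"
  shows "integrable M f"
  using assms by (intro integrable_const_bound[of _ B]) auto

lemma integrable_exp:
  assumes f: "conc_lip L f"
  shows "integrable M (\<lambda>x. exp (f x))"
proof -
  obtain B where "\<And>x. f x \<le> B" using conc_lip_bound[OF f] by auto
  then show ?thesis
    using borel_M[OF conc_lipD(6)[OF f]] by (intro integrable_bounded[of _ "exp B"]) auto
qed

lemma integrable_exp_mult:
  assumes f: "conc_lip L f" and g: "integrable M g"
  shows "integrable M (\<lambda>x. exp (f x) * g x)"
proof -
  obtain B where B: "\<And>x. f x \<le> B" using conc_lip_bound[OF f] by auto
  have [measurable]: "f \<in> borel_measurable M" "g \<in> borel_measurable M"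
    using borel_M[OF conc_lipD(6)[OF f]] g by auto
  show ?thesis
  proof (rule integrable_dominated)
    show "integrable M (\<lambda>x. exp B * \<bar>g x\<bar>)" using g by simp
    show "\<bar>exp (f x) * g x\<bar> \<le> exp B * \<bar>g x\<bar>" for x
      using B[of x] by (simp add: abs_mult mult_right_mono)
  qed measurable
qed

lemma integral_exp_pos:
  assumes f: "conc_lip L f"
  shows "0 < (\<integral>x. exp (f x) \<partial>M)"
proof -
  have "(\<integral>x. exp (f x) \<partial>M) \<noteq> 0"
    using integral_nonneg_eq_0_iff_AE[OF integrable_exp[OF f]] AE_False by auto
  moreover have "0 \<le> (\<integral>x. exp (f x) \<partial>M)" by (intro integral_nonneg_AE) auto
  ultimately show ?thesis by (simp add: less_le)
qed

lemma Ent_exp: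
  assumes f: "conc_lip L f"
  shows "Ent M (\<lambda>x. exp (f x))
    = (\<integral>x. exp (f x) * f x \<partial>M) - (\<integral>x. exp (f x) \<partial>M) * ln (\<integral>x. exp (f x) \<partial>M)"
proof -
  define Z where "Z = (\<integral>x. exp (f x) \<partial>M)"
  have "Z > 0" unfolding Z_def by (rule integral_exp_pos[OF f])
  then have "Ent M (\<lambda>x. exp (f x)) = (\<integral>x. exp (f x) * f x - exp (f x) * ln Z \<partial>M)"
    by (simp add: Ent_def ln_div right_diff_distrib flip: Z_def)
  also have "\<dots> = (\<integral>x. exp (f x) * f x \<partial>M) - Z * ln Z"
    using integrable_exp[OF f] integrable_exp_mult[OF f integrable_conc_lip[OF f]]
    by (simp add: Z_def)
  finally show ?thesis by (simp add: Z_def)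
qed

lemma measurable_dual_gradient:
  assumes "C1_smooth f"
  shows "(\<lambda>x. dual_norm N (gradient f x)) \<in> borel_measurable M"
  using assms continuous_on_compose2[OF continuous_on_dual[of UNIV]]
  by (intro borel_M borel_measurable_continuous_onI) (auto simp: C1_smooth_def)

theorem inf_conv_imp_gradient_log_Sobolev:
  assumes ls: "inf_conv_log_Sobolev N M lam C" and C: "C > 0" and lam: "0 < lam'" "lam' < lam"
  shows "gradient_log_Sobolev N M ((lam - lam') / C) lam'"
  unfolding gradient_log_Sobolev_def
proof (intro ballI impI)
  fix \<phi> assume \<phi>: "\<phi> \<in> F_class N lam'" and C1: "C1_smooth \<phi>"
  then obtain L where L: "conc_lip L \<phi>" and q: "sq_norm_convex N lam' (\<lambda>x. ereal (\<phi> x))"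
    unfolding F_class_iff by auto
  define Q where "Q = inf_conv N (1 / lam) \<phi>"
  define G where "G x = (dual_norm N (gradient \<phi> x))\<^sup>2" for x
  have Q: "conc_lip L Q" unfolding Q_def using lam by (intro conc_lip_inf_conv[OF L]) auto
  have d: "\<phi> differentiable (at x)" for x using C1 by (simp add: C1_smooth_def)
  have "\<phi> \<in> F_class N lam" using L sq_norm_convex_mono[OF q] lam by (auto simp: F_class_iff)
  then have "Ent M (\<lambda>x. exp (\<phi> x)) \<le> C * (\<integral>x. exp (\<phi> x) * (\<phi> x - Q x) \<partial>M)"
    using ls by (simp add: inf_conv_log_Sobolev_def Q_def mult.commute)
  also have "(\<integral>x. exp (\<phi> x) * (\<phi> x - Q x) \<partial>M) \<le> (\<integral>x. exp (\<phi> x) * (G x / (2 * (lam - lam'))) \<partial>M)"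
  proof (intro integral_mono integrable_exp_mult[OF L] mult_left_mono)
    show "integrable M (\<lambda>x. \<phi> x - Q x)"
      using integrable_conc_lip[OF L] integrable_conc_lip[OF Q] by auto
    note [measurable] = measurable_dual_gradient[OF C1]
    have "G x \<le> L\<^sup>2" for x
      unfolding G_def using gradient_dual_le[OF L d] by (intro power_mono) auto
    moreover have "G \<in> borel_measurable M" unfolding G_def by measurable
    ultimately have "integrable M G" by (intro integrable_bounded[of _ "L\<^sup>2"]) (auto simp: G_def)
    then show "integrable M (\<lambda>x. G x / (2 * (lam - lam')))" by simp
  next
    fix x show "\<phi> x - Q x \<le> G x / (2 * (lam - lam'))"
      unfolding Q_def G_def by (rule inf_conv_gradient_bound[OF L q lam d])
  qed simp
  also have "C * (\<integral>x. exp (\<phi> x) * (G x / (2 * (lam - lam'))) \<partial>M)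
      = 1 / (2 * ((lam - lam') / C)) * (\<integral>x. G x * exp (\<phi> x) \<partial>M)"
    by (simp add: mult.commute[of "exp _"])
  finally show "Ent M (\<lambda>x. exp (\<phi> x))
      \<le> 1 / (2 * ((lam - lam') / C)) * (\<integral>x. (dual_norm N (gradient \<phi> x))\<^sup>2 * exp (\<phi> x) \<partial>M)"
    using C by (simp add: G_def)
qed

text \<open>Convexity of the log-Laplace functional: its value at \<open>g\<close> lies above the
  tangent at \<open>f\<close>. For \<open>f = 0\<close> this is Jensen's inequality.\<close>

lemma ln_integral_exp_diff_le:
  assumes f: "conc_lip L f" and g: "conc_lip L' g"
  shows "(\<integral>x. exp (f x) \<partial>M) * (ln (\<integral>x. exp (f x) \<partial>M) - ln (\<integral>x. exp (g x) \<partial>M))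
    \<le> (\<integral>x. exp (f x) * (f x - g x) \<partial>M)"
proof -
  define W where "W = (\<integral>x. exp (f x) \<partial>M)"
  define A where "A = (\<integral>x. exp (f x) * (f x - g x) \<partial>M)"
  \<comment> \<open>The mean of \<open>g - f\<close> under the density \<open>exp f / W\<close>, the
    best centring for the inequality \<open>1 + v \<le> exp v\<close>.\<close>
  define c where "c = - A / W"
  have W: "W > 0" unfolding W_def by (rule integral_exp_pos[OF f])
  have int: "integrable M (\<lambda>x. exp (f x) * (f x - g x))"
    using integrable_conc_lip[OF f] integrable_conc_lip[OF g] by (intro integrable_exp_mult[OF f]) auto
  have "(1 - c) * W - A = W" using W by (simp add: c_def field_simps)
  then have "exp c * W = exp c * ((1 - c) * W - A)" by simp
  also have "\<dots> = (\<integral>x. exp c * ((1 - c) * exp (f x) - exp (f x) * (f x - g x)) \<partial>M)"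
  proof -
    have "(\<integral>x. (1 - c) * exp (f x) - exp (f x) * (f x - g x) \<partial>M) = (1 - c) * W - A"
      unfolding W_def A_def using int integrable_exp[OF f]
      by (subst Bochner_Integration.integral_diff) auto
    then show ?thesis by simp
  qed
  also have "\<dots> \<le> (\<integral>x. exp (g x) \<partial>M)"
  proof (rule integral_mono)
    fix x
    have "exp (f x) * exp c * (1 + (g x - f x - c)) \<le> exp (f x) * exp c * exp (g x - f x - c)"
      by (intro mult_left_mono exp_ge_add_one_self) simp
    also have "\<dots> = exp (g x)" by (simp flip: exp_add)
    finally show "exp c * ((1 - c) * exp (f x) - exp (f x) * (f x - g x)) \<le> exp (g x)"
      by (simp add: algebra_simps)
  qed (use int integrable_exp[OF f] integrable_exp[OF g] in auto)
  finally have "ln (exp c * W) \<le> ln (\<integral>x. exp (g x) \<partial>M)"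
    using W integral_exp_pos[OF g] by (subst ln_le_cancel_iff) auto
  then have "c + ln W \<le> ln (\<integral>x. exp (g x) \<partial>M)" using W by (simp add: ln_mult)
  then have "W * (ln W - ln (\<integral>x. exp (g x) \<partial>M)) \<le> W * (A / W)"
    using W by (intro mult_left_mono) (auto simp: c_def)
  then show ?thesis using W by (simp add: W_def A_def)
qed

end

section \<open>Monotonicity along the Hopf-Lax flow\<close>

context norm_prob
begin

text \<open>With growing t the weight \<open>\<rho> * t\<close> rises while the time of
  sup-convolution falls. After division by \<open>\<rho> * t\<close> the quantity leads from the
  mean of \<open>sup_conv 1 f\<close>, as t tends to 0, to an exponential integral.\<close>

definition hopf_lax_log :: "real \<Rightarrow> ('a \<Rightarrow> real) \<Rightarrow> real \<Rightarrow> real" where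
  "hopf_lax_log \<rho> f t = ln (\<integral>x. exp (\<rho> * t * sup_conv (1 - t) f x) \<partial>M)"

lemma continuous_on_hopf_lax_log:
  assumes f: "conc_lip L f" and \<rho>: "\<rho> > 0" and t0: "t0 < 1"
  shows "continuous_on {0..t0} (hopf_lax_log \<rho> f)"
proof (rule continuous_on_sequentiallyI)
  fix u :: "nat \<Rightarrow> real" and a
  assume u: "\<forall>n. u n \<in> {0..t0}" and a: "a \<in> {0..t0}" and lim: "u \<longlonglongrightarrow> a"
  have u': "0 \<le> u n" "u n < 1" "1 - u n > 0" for n using u t0 by (auto intro: le_less_trans)
  have a': "0 \<le> a" "1 - a > 0" using a t0 by auto
  obtain B where B: "B \<ge> 0" "\<And>x. f x \<le> B" using conc_lip_bound[OF f] by auto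
  define \<phi> where "\<phi> t x = \<rho> * t * sup_conv (1 - t) f x" for t x
  have cl: "conc_lip (\<rho> * t * L) (\<phi> t)" if "0 \<le> t" "1 - t > 0" for t
    unfolding \<phi>_def using that \<rho> by (intro conc_lip_scale conc_lip_sup_conv f) auto
  have "(\<lambda>n. \<integral>x. exp (\<phi> (u n) x) \<partial>M) \<longlonglongrightarrow> (\<integral>x. exp (\<phi> a x) \<partial>M)"
  proof (rule integral_dominated_convergence[where w = "\<lambda>x. exp (\<rho> * B)"])
    show "(\<lambda>x. exp (\<phi> a x)) \<in> borel_measurable M" "(\<lambda>x. exp (\<phi> (u n) x)) \<in> borel_measurable M" for n
      using integrable_exp[OF cl] a' u' by (auto intro: borel_measurable_integrable)
    show "AE x in M. (\<lambda>n. exp (\<phi> (u n) x)) \<longlonglongrightarrow> exp (\<phi> a x)"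
    proof (intro AE_I2 tendsto_exp)
      fix x
      have "(\<lambda>n. sup_conv (1 - u n) f x - sup_conv (1 - a) f x) \<longlonglongrightarrow> 0"
      proof (rule Lim_null_comparison)
        show "\<forall>\<^sub>F n in sequentially. norm (sup_conv (1 - u n) f x - sup_conv (1 - a) f x)
            \<le> \<bar>u n - a\<bar> * (L\<^sup>2 / 2)"
          using sup_conv_time_lipschitz[OF f u'(3) a'(2)] by (auto simp: abs_minus_commute)
        have "(\<lambda>n. \<bar>u n - a\<bar> * (L\<^sup>2 / 2)) \<longlonglongrightarrow> \<bar>a - a\<bar> * (L\<^sup>2 / 2)"
          by (intro tendsto_intros lim)
        then show "(\<lambda>n. \<bar>u n - a\<bar> * (L\<^sup>2 / 2)) \<longlonglongrightarrow> 0" by simp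
      qed
      then have "(\<lambda>n. sup_conv (1 - u n) f x) \<longlonglongrightarrow> sup_conv (1 - a) f x"
        by (simp add: LIM_zero_iff)
      then show "(\<lambda>n. \<phi> (u n) x) \<longlonglongrightarrow> \<phi> a x" unfolding \<phi>_def by (intro tendsto_intros lim)
    qed
    show "AE x in M. norm (exp (\<phi> (u n) x)) \<le> exp (\<rho> * B)" for n
    proof (rule AE_I2)
      fix x
      have "u n * sup_conv (1 - u n) f x \<le> u n * B"
        using u' sup_conv_le_bound[OF u'(3) B(2)] by (intro mult_left_mono) auto
      also have "\<dots> \<le> 1 * B" by (intro mult_right_mono less_imp_le u' B)
      finally have "\<rho> * (u n * sup_conv (1 - u n) f x) \<le> \<rho> * B" using \<rho> by simp
      then show "norm (exp (\<phi> (u n) x)) \<le> exp (\<rho> * B)" by (simp add: \<phi>_def mult.assoc)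
    qed
  qed auto
  then have "(\<lambda>n. ln (\<integral>x. exp (\<phi> (u n) x) \<partial>M)) \<longlonglongrightarrow> ln (\<integral>x. exp (\<phi> a x) \<partial>M)"
    using integral_exp_pos[OF cl[OF a']] by (intro tendsto_ln) auto
  then show "(\<lambda>n. hopf_lax_log \<rho> f (u n)) \<longlonglongrightarrow> hopf_lax_log \<rho> f a"
    by (simp add: hopf_lax_log_def \<phi>_def)
qed

text \<open>The discrete form of the differential inequality \<open>G' \<le> G / t\<close> for \<open>G = hopf_lax_log \<rho> f\<close>: the
  Hopf-Lax equation turns the gradient term of the logarithmic Sobolev inequality into a time
  derivative.\<close>

lemma hopf_lax_log_step:
  assumes ls: "gradient_log_Sobolev N M \<rho> lam" and sc: "strictly_convex_norm (dual_norm N)"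
    and f: "conc_lip L f" and \<rho>: "\<rho> > 0"
    and t: "0 < t" "t < 1" "\<rho> * t / (1 - t) \<le> lam" and e: "e > 0" and m: "m > 0"
  shows "\<exists>d>0. d < m \<and>
    hopf_lax_log \<rho> f t - hopf_lax_log \<rho> f (t - d) \<le> d * (hopf_lax_log \<rho> f t / t + e)"
proof -
  define P where "P s = sup_conv s f" for s
  define s where "s = 1 - t"
  have s: "s > 0" using t by (simp add: s_def)
  define k where "k = \<rho> * t"
  have k: "k > 0" using \<rho> t by (simp add: k_def)
  define \<phi> where "\<phi> x = k * P s x" for x
  define D where "D x = (dual_norm N (gradient (P s) x))\<^sup>2 / 2" for x
  have P: "conc_lip L (P r)" if "r > 0" for r
    unfolding P_def by (rule conc_lip_sup_conv[OF f that])
  have \<phi>: "conc_lip (k * L) \<phi>" unfolding \<phi>_def using k by (intro conc_lip_scale P s) auto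
  have Pd: "P s differentiable (at x)" for x unfolding P_def by (rule sup_conv_differentiable[OF sc f s])
  have grad: "gradient \<phi> x = k *\<^sub>R gradient (P s) x" for x
    unfolding \<phi>_def
    by (rule gradient_eqI) (auto intro!: derivative_eq_intros has_derivative_gradient[OF Pd])
  have \<phi>d: "\<phi> differentiable (at x)" for x
    unfolding \<phi>_def by (intro differentiable_mult Pd) auto
  note [measurable] = measurable_dual_gradient[OF conc_lip_C1[OF P[OF s] Pd]]
  have D: "0 \<le> D x" "D x \<le> L\<^sup>2 / 2" for x
    unfolding D_def using gradient_dual_le[OF P[OF s] Pd] by (auto intro!: power_mono divide_right_mono)
  have Dm [measurable]: "D \<in> borel_measurable M" unfolding D_def by measurable
  have Di: "integrable M D" using D by (intro integrable_bounded[of _ "L\<^sup>2 / 2"] Dm) auto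
  define W where "W = (\<integral>x. exp (\<phi> x) \<partial>M)"
  have W: "W > 0" unfolding W_def by (rule integral_exp_pos[OF \<phi>])
  define A where "A = (\<integral>x. exp (\<phi> x) * P s x \<partial>M)"
  define E where "E = (\<integral>x. exp (\<phi> x) * D x \<partial>M)"
  have H: "hopf_lax_log \<rho> f t = ln W"
    by (simp add: hopf_lax_log_def W_def \<phi>_def k_def P_def s_def)
  \<comment> \<open>The logarithmic Sobolev inequality for \<open>\<phi>\<close>: the gradient of
    \<open>\<phi>\<close> is k times that of \<open>P s\<close>, so the right-hand side is
    \<open>k\<^sup>2 / \<rho> * E\<close>, and dividing by t gives this form.\<close>
  have LS: "\<rho> * (A - t * E) \<le> W * ln W / t"
  proof -
    have "\<phi> \<in> F_class N lam"
      unfolding \<phi>_def P_def using t by (intro F_class_sup_conv[OF f s k]) (simp add: k_def s_def)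
    then have "Ent M (\<lambda>x. exp (\<phi> x)) \<le> 1 / (2 * \<rho>) * (\<integral>x. (dual_norm N (gradient \<phi> x))\<^sup>2 * exp (\<phi> x) \<partial>M)"
      using ls conc_lip_C1[OF \<phi> \<phi>d] by (simp add: gradient_log_Sobolev_def)
    also have "(\<lambda>x. (dual_norm N (gradient \<phi> x))\<^sup>2 * exp (\<phi> x)) = (\<lambda>x. 2 * k\<^sup>2 * (exp (\<phi> x) * D x))"
      by (simp add: grad dual_scale D_def power_mult_distrib mult_ac)
    also have "Ent M (\<lambda>x. exp (\<phi> x)) = k * A - W * ln W"
    proof -
      have "(\<integral>x. exp (\<phi> x) * \<phi> x \<partial>M) = (\<integral>x. k * (exp (\<phi> x) * P s x) \<partial>M)"
        by (intro Bochner_Integration.integral_cong) (auto simp: \<phi>_def)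
      then show ?thesis unfolding Ent_exp[OF \<phi>] by (simp add: A_def W_def)
    qed
    finally have "k * A - W * ln W \<le> k\<^sup>2 / \<rho> * E" using \<rho> by (simp add: E_def)
    moreover have "k\<^sup>2 / \<rho> * E = k * (t * E)" using \<rho> by (simp add: k_def power2_eq_square)
    ultimately have "k * (A - t * E) \<le> W * ln W" by (simp add: algebra_simps)
    then show ?thesis using t by (simp add: k_def field_simps)
  qed
  define h where "h n = 1 / real (Suc n)" for n
  have h: "h \<longlonglongrightarrow> 0" "h n > 0" for n
    unfolding h_def using LIMSEQ_inverse_real_of_nat by (auto simp: inverse_eq_divide)
  have h_right: "filterlim h (at_right 0) sequentially"
    using h by (intro tendsto_imp_filterlim_at_right) auto
  \<comment> \<open>The available derivative bound is one-sided. Cutting the time quotient off at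
    \<open>D\<close> makes the lower bound enough for convergence to \<open>D\<close>, and at the
    same time supplies the majorant for dominated convergence.\<close>
  define q where "q n x = min ((P (s + h n) x - P s x) / h n) (D x)" for n x
  have q0: "0 \<le> q n x" for n x
    unfolding q_def P_def using D(1) h(2)[of n] sup_conv_mono_time[OF f s, of "s + h n" x] by simp
  have qm [measurable]: "q n \<in> borel_measurable M" for n
  proof -
    have [measurable]: "P (s + h n) \<in> borel_measurable M" "P s \<in> borel_measurable M"
      using s h(2)[of n] by (auto intro!: borel_M conc_lipD(6)[OF P])
    show ?thesis unfolding q_def by measurable
  qed
  have q_lim: "(\<lambda>n. q n x) \<longlonglongrightarrow> D x" for x
  proof (rule LIMSEQ_I, goal_cases)
    case (1 r)
    have "\<forall>\<^sub>F h in at_right 0. D x - r < (sup_conv (s + h) f x - sup_conv s f x) / h"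
      using 1 Pd by (intro sup_conv_time_derivative_lower[OF f s]) (auto simp: P_def D_def)
    then have "\<forall>\<^sub>F n in sequentially. D x - r < (P (s + h n) x - P s x) / h n"
      using h_right unfolding filterlim_iff P_def by blast
    then have "\<forall>\<^sub>F n in sequentially. norm (q n x - D x) < r"
      by eventually_elim (use 1 in \<open>auto simp: q_def min_def\<close>)
    then show ?case by (simp add: eventually_sequentially)
  qed
  have "(\<lambda>n. \<integral>x. exp (\<phi> x) * q n x \<partial>M) \<longlonglongrightarrow> E"
    unfolding E_def
  proof (rule integral_dominated_convergence[where w = "\<lambda>x. exp (\<phi> x) * D x"])
    show "integrable M (\<lambda>x. exp (\<phi> x) * D x)" by (rule integrable_exp_mult[OF \<phi> Di])
    show "AE x in M. norm (exp (\<phi> x) * q n x) \<le> exp (\<phi> x) * D x" for n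
      using q0 by (auto simp: abs_mult) (simp add: q_def)
    show "AE x in M. (\<lambda>n. exp (\<phi> x) * q n x) \<longlonglongrightarrow> exp (\<phi> x) * D x"
      by (intro AE_I2 tendsto_intros q_lim)
    have [measurable]: "\<phi> \<in> borel_measurable M" by (intro borel_M conc_lipD(6)[OF \<phi>])
    show "(\<lambda>x. exp (\<phi> x) * D x) \<in> borel_measurable M" "(\<lambda>x. exp (\<phi> x) * q n x) \<in> borel_measurable M" for n
      by measurable
  qed
  then have "(\<lambda>n. k * (E - (\<integral>x. exp (\<phi> x) * q n x \<partial>M)) + \<rho> * h n * L\<^sup>2 / 2 * W)
      \<longlonglongrightarrow> k * (E - E) + \<rho> * 0 * L\<^sup>2 / 2 * W"
    by (intro tendsto_intros h) auto
  then have "\<forall>\<^sub>F n in sequentially. k * (E - (\<integral>x. exp (\<phi> x) * q n x \<partial>M)) + \<rho> * h n * L\<^sup>2 / 2 * W < e * W"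
    using e W by (intro order_tendstoD(2)) auto
  moreover have "\<forall>\<^sub>F n in sequentially. h n < m" using order_tendstoD(2)[OF h(1) m] .
  moreover have "\<forall>\<^sub>F n in sequentially. h n < t" using order_tendstoD(2)[OF h(1) t(1)] .
  ultimately have "\<forall>\<^sub>F n in sequentially. h n < m \<and> h n < t \<and>
      k * (E - (\<integral>x. exp (\<phi> x) * q n x \<partial>M)) + \<rho> * h n * L\<^sup>2 / 2 * W < e * W"
    by eventually_elim auto
  then obtain n where n: "h n < m" "h n < t"
      "k * (E - (\<integral>x. exp (\<phi> x) * q n x \<partial>M)) + \<rho> * h n * L\<^sup>2 / 2 * W < e * W"
    by (auto dest: eventually_happens)
  define d where "d = h n"
  have d: "d > 0" using h(2) by (simp add: d_def)
  \<comment> \<open>The exponent at the earlier time \<open>t - d\<close>, where the time of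
    sup-convolution is \<open>1 - (t - d) = s + d\<close>.\<close>
  define \<psi> where "\<psi> x = \<rho> * (t - d) * P (s + d) x" for x
  have \<psi>: "conc_lip (\<rho> * (t - d) * L) \<psi>"
    unfolding \<psi>_def using \<rho> n s d by (intro conc_lip_scale P) (auto simp: d_def)
  have H': "hopf_lax_log \<rho> f (t - d) = ln (\<integral>x. exp (\<psi> x) \<partial>M)"
    by (simp add: hopf_lax_log_def \<psi>_def P_def s_def algebra_simps)
  have qi: "integrable M (q n)"
  proof (rule integrable_bounded[OF qm])
    fix x
    have "q n x \<le> D x" by (simp add: q_def)
    with q0[of n x] D(2)[of x] show "\<bar>q n x\<bar> \<le> L\<^sup>2 / 2" by linarith
  qed
  have "W * (ln W - ln (\<integral>x. exp (\<psi> x) \<partial>M)) \<le> (\<integral>x. exp (\<phi> x) * (\<phi> x - \<psi> x) \<partial>M)"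
    unfolding W_def by (rule ln_integral_exp_diff_le[OF \<phi> \<psi>])
  also have "\<dots> \<le> (\<integral>x. exp (\<phi> x) * (d * (\<rho> * P s x - k * q n x + \<rho> * d * L\<^sup>2 / 2)) \<partial>M)"
  proof (intro integral_mono integrable_exp_mult[OF \<phi>] mult_left_mono)
    fix x
    have "d * q n x \<le> P (s + d) x - P s x"
      using d by (simp add: q_def d_def min_def field_simps)
    then have "k * (d * q n x) \<le> k * (P (s + d) x - P s x)" using k by (intro mult_left_mono) auto
    moreover have "\<rho> * d * P (s + d) x \<le> \<rho> * d * (P s x + d * L\<^sup>2 / 2)"
      unfolding P_def using \<rho> d by (intro mult_left_mono sup_conv_time_le[OF f s]) auto
    \<comment> \<open>The step separates into a change of the weight by \<open>\<rho> * d\<close>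
      and a change of the time of sup-convolution by d.\<close>
    moreover have "\<phi> x - \<psi> x = \<rho> * d * P (s + d) x - k * (P (s + d) x - P s x)"
      by (simp add: \<phi>_def \<psi>_def k_def algebra_simps)
    ultimately show "\<phi> x - \<psi> x \<le> d * (\<rho> * P s x - k * q n x + \<rho> * d * L\<^sup>2 / 2)"
      by (simp add: algebra_simps)
  qed (use integrable_conc_lip[OF \<phi>] integrable_conc_lip[OF \<psi>] integrable_conc_lip[OF P[OF s]] qi in auto)
  also have "\<dots> = d * (\<rho> * A - k * (\<integral>x. exp (\<phi> x) * q n x \<partial>M) + \<rho> * d * L\<^sup>2 / 2 * W)"
  proof -
    have "(\<integral>x. exp (\<phi> x) * (d * (\<rho> * P s x - k * q n x + \<rho> * d * L\<^sup>2 / 2)) \<partial>M)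
        = (\<integral>x. d * (\<rho> * (exp (\<phi> x) * P s x) - k * (exp (\<phi> x) * q n x) + \<rho> * d * L\<^sup>2 / 2 * exp (\<phi> x)) \<partial>M)"
      by (intro Bochner_Integration.integral_cong) (auto simp: algebra_simps)
    also have "\<dots> = d * (\<rho> * A - k * (\<integral>x. exp (\<phi> x) * q n x \<partial>M) + \<rho> * d * L\<^sup>2 / 2 * W)"
      using integrable_exp_mult[OF \<phi> integrable_conc_lip[OF P[OF s]]] integrable_exp_mult[OF \<phi> qi]
        integrable_exp[OF \<phi>] by (simp add: A_def W_def)
    finally show ?thesis .
  qed
  also have "\<dots> \<le> d * (\<rho> * (A - t * E) + e * W)"
    using n(3) d by (intro mult_left_mono) (auto simp: d_def k_def algebra_simps)
  also have "\<dots> \<le> d * (W * ln W / t + e * W)" using LS d by (intro mult_left_mono) auto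
  also have "\<dots> = W * (d * (ln W / t + e))" by (simp add: algebra_simps)
  finally have "ln W - ln (\<integral>x. exp (\<psi> x) \<partial>M) \<le> d * (ln W / t + e)" using W by simp
  then have "hopf_lax_log \<rho> f t - hopf_lax_log \<rho> f (t - d) \<le> d * (hopf_lax_log \<rho> f t / t + e)"
    unfolding H H' .
  moreover have "d < m" using n(1) by (simp add: d_def)
  ultimately show ?thesis using d by blast
qed

text \<open>The discrete form of \<open>(G / t)' \<le> 0\<close>. The bound on
  \<open>\<rho> * t / (1 - t)\<close> passes to all earlier times because this quotient increases
  with t.\<close>

lemma hopf_lax_log_quotient_antimono:
  assumes ls: "gradient_log_Sobolev N M \<rho> lam" and sc: "strictly_convex_norm (dual_norm N)"
    and f: "conc_lip L f" and \<rho>: "\<rho> > 0"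
    and t: "0 < a" "a \<le> t" "t < 1" "\<rho> * t / (1 - t) \<le> lam"
  shows "hopf_lax_log \<rho> f t / t \<le> hopf_lax_log \<rho> f a / a"
proof (rule nonincreasing_if_left_steps[OF t(2)])
  show "continuous_on {a..t} (\<lambda>t. hopf_lax_log \<rho> f t / t)"
    using t by (intro continuous_intros continuous_on_subset[OF continuous_on_hopf_lax_log[OF f \<rho> t(3)]]) auto
  fix r e :: real assume r: "a < r" "r \<le> t" and e: "0 < e"
  define G where "G = hopf_lax_log \<rho> f"
  have "\<rho> * r / (1 - r) \<le> \<rho> * t / (1 - t)"
    using r t \<rho> by (intro frac_le mult_left_mono) auto
  \<comment> \<open>The tolerance is \<open>e * a\<close> because the division by
    \<open>r - d > a\<close> that follows costs a factor of at most \<open>1 / a\<close>.\<close>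
  then obtain d where d: "d > 0" "d < r - a" "G r - G (r - d) \<le> d * (G r / r + e * a)"
    using hopf_lax_log_step[OF ls sc f \<rho>, of r "e * a" "r - a"] r t e unfolding G_def by auto
  have "G r - d * (G r / r + e * a) \<le> G (r - d)" using d(3) by linarith
  then have "(G r - d * (G r / r + e * a)) / (r - d) \<le> G (r - d) / (r - d)"
    using d t by (intro divide_right_mono) auto
  moreover have "(G r - d * (G r / r + e * a)) / (r - d) = G r / r - d * e * (a / (r - d))"
    using d t r by (simp add: field_simps)
  moreover have "d * e * (a / (r - d)) \<le> d * e * 1"
    using d t e by (intro mult_left_mono) (auto simp: field_simps)
  ultimately have "G r / r - G (r - d) / (r - d) \<le> e * d" by (simp add: mult.commute)
  with d show "\<exists>d>0. d \<le> r - a \<and>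
      hopf_lax_log \<rho> f r / r - hopf_lax_log \<rho> f (r - d) / (r - d) \<le> e * d"
    unfolding G_def by (intro exI[of _ d]) auto
qed

theorem gradient_log_Sobolev_imp_exp_integral_le:
  assumes ls: "gradient_log_Sobolev N M \<rho> lam" and sc: "strictly_convex_norm (dual_norm N)"
    and \<rho>: "\<rho> > 0" and lam: "lam > 0" and b: "b = (\<rho> + lam) / (\<rho> * lam)" and f: "conc_lip L f"
  shows "b * ln (\<integral>x. exp (f x / b) \<partial>M) \<le> (\<integral>x. sup_conv 1 f x \<partial>M)"
proof -
  define t where "t = lam / (\<rho> + lam)"
  have "1 - t = \<rho> / (\<rho> + lam)" using \<rho> lam by (simp add: t_def field_simps)
  then have t: "0 < t" "t < 1" "\<rho> * t / (1 - t) = lam" "1 / b = \<rho> * t"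
    using \<rho> lam by (simp_all add: t_def b)
  have b0: "b > 0" using \<rho> lam by (simp add: b)
  define g where "g = sup_conv 1 f"
  have g: "conc_lip L g" unfolding g_def by (rule conc_lip_sup_conv[OF f]) simp
  obtain B where B: "B \<ge> 0" "\<And>x. g x \<le> B" using conc_lip_bound[OF g] by auto
  \<comment> \<open>Weights of early times: they tend to 0, which recovers the mean of
    \<open>sup_conv 1 f\<close> in the limit, and never exceed the final weight
    \<open>\<rho> * t\<close>.\<close>
  define k where "k n = \<rho> * t / real (Suc n)" for n
  have k: "k n > 0" "k n \<le> \<rho> * t" for n
    using \<rho> t by (auto simp: k_def field_simps)
  have "(\<integral>x. exp (f x / b) \<partial>M) \<le> (\<integral>x. exp (\<rho> * t * sup_conv (1 - t) f x) \<partial>M)"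
  proof (rule integral_mono)
    show "integrable M (\<lambda>x. exp (f x / b))"
      using integrable_exp[OF conc_lip_scale[OF f, of "1 / b"]] b0 by simp
    show "integrable M (\<lambda>x. exp (\<rho> * t * sup_conv (1 - t) f x))"
      using \<rho> t by (intro integrable_exp[OF conc_lip_scale[OF conc_lip_sup_conv[OF f]]]) auto
    fix x
    have "f x / b = \<rho> * t * f x" using t(4) by (metis mult.commute mult_1 times_divide_eq_right)
    also have "\<dots> \<le> \<rho> * t * sup_conv (1 - t) f x"
      using \<rho> t by (intro mult_left_mono sup_conv_ge_self[OF f]) auto
    finally show "exp (f x / b) \<le> exp (\<rho> * t * sup_conv (1 - t) f x)" by simp
  qed
  moreover have "0 < (\<integral>x. exp (f x / b) \<partial>M)"
    using integral_exp_pos[OF conc_lip_scale[OF f, of "1 / b"]] b0 by simp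
  ultimately have "ln (\<integral>x. exp (f x / b) \<partial>M) \<le> hopf_lax_log \<rho> f t"
    unfolding hopf_lax_log_def by simp
  then have "b * ln (\<integral>x. exp (f x / b) \<partial>M) \<le> b * hopf_lax_log \<rho> f t" using b0 by simp
  also have "b = 1 / (\<rho> * t)" unfolding t(4)[symmetric] by simp
  finally have lower: "b * ln (\<integral>x. exp (f x / b) \<partial>M) \<le> hopf_lax_log \<rho> f t / t / \<rho>"
    unfolding \<open>b = 1 / (\<rho> * t)\<close> by (simp add: mult.commute)
  \<comment> \<open>At the early time a, \<open>ln y \<le> y - 1\<close> linearises the logarithm
    and monotonicity in time replaces \<open>sup_conv (1 - a) f\<close> by
    \<open>sup_conv 1 f\<close>.\<close>
  have upper: "hopf_lax_log \<rho> f t / t / \<rho> \<le> (\<integral>x. (exp (k n * g x) - 1) / k n \<partial>M)" for n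
  proof -
    define a where "a = k n / \<rho>"
    have a: "0 < a" "a \<le> t" "\<rho> * a = k n" using k[of n] \<rho> by (auto simp: a_def field_simps)
    have cl: "conc_lip (k n * L) (\<lambda>x. k n * sup_conv (1 - a) f x)"
      using k[of n] a t by (intro conc_lip_scale conc_lip_sup_conv f) auto
    have cl': "conc_lip (k n * L) (\<lambda>x. k n * g x)" using k[of n] by (intro conc_lip_scale g) auto
    have "hopf_lax_log \<rho> f a \<le> (\<integral>x. exp (k n * g x) \<partial>M) - 1"
    proof -
      have "hopf_lax_log \<rho> f a \<le> (\<integral>x. exp (k n * sup_conv (1 - a) f x) \<partial>M) - 1"
        unfolding hopf_lax_log_def a(3) by (intro ln_le_minus_one integral_exp_pos[OF cl])
      also have "(\<integral>x. exp (k n * sup_conv (1 - a) f x) \<partial>M) \<le> (\<integral>x. exp (k n * g x) \<partial>M)"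
        unfolding g_def using k[of n] a t
        by (intro integral_mono integrable_exp[OF cl] integrable_exp[OF cl'[unfolded g_def]])
           (auto intro!: mult_left_mono sup_conv_mono_time[OF f])
      finally show ?thesis by simp
    qed
    also have "\<dots> = (\<integral>x. exp (k n * g x) - 1 \<partial>M)"
      using integrable_exp[OF cl'] prob_space by simp
    finally have "hopf_lax_log \<rho> f a / k n \<le> (\<integral>x. (exp (k n * g x) - 1) / k n \<partial>M)"
      using k[of n] by (simp add: divide_right_mono)
    moreover have "hopf_lax_log \<rho> f t / t \<le> hopf_lax_log \<rho> f a / a"
      using a t by (intro hopf_lax_log_quotient_antimono[OF ls sc f \<rho>]) auto
    then have "hopf_lax_log \<rho> f t / t / \<rho> \<le> hopf_lax_log \<rho> f a / a / \<rho>"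
      using \<rho> by (intro divide_right_mono) auto
    ultimately show ?thesis using a(3) by (simp add: mult.commute)
  qed
  have "(\<lambda>n. \<integral>x. (exp (k n * g x) - 1) / k n \<partial>M) \<longlonglongrightarrow> (\<integral>x. g x \<partial>M)"
  proof (rule integral_dominated_convergence[where w = "\<lambda>x. exp (\<rho> * t * B) * \<bar>g x\<bar>"])
    have [measurable]: "g \<in> borel_measurable M" by (intro borel_M conc_lipD(6)[OF g])
    show "g \<in> borel_measurable M" "(\<lambda>x. (exp (k n * g x) - 1) / k n) \<in> borel_measurable M" for n
      by measurable
    show "integrable M (\<lambda>x. exp (\<rho> * t * B) * \<bar>g x\<bar>)" using integrable_conc_lip[OF g] by auto
    show "AE x in M. norm ((exp (k n * g x) - 1) / k n) \<le> exp (\<rho> * t * B) * \<bar>g x\<bar>" for n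
    proof (rule AE_I2)
      fix x
      have "max (k n * g x) 0 \<le> \<rho> * t * B"
      proof -
        have "k n * g x \<le> k n * B" using k[of n] B by (intro mult_left_mono) auto
        also have "\<dots> \<le> \<rho> * t * B" using k[of n] B by (intro mult_right_mono) auto
        finally show ?thesis using \<rho> t B by simp
      qed
      then have "\<bar>k n * g x\<bar> * exp (max (k n * g x) 0) \<le> \<bar>k n * g x\<bar> * exp (\<rho> * t * B)"
        by (intro mult_left_mono) auto
      with abs_exp_minus_one_le[of "k n * g x"]
      have "\<bar>exp (k n * g x) - 1\<bar> \<le> \<bar>k n * g x\<bar> * exp (\<rho> * t * B)" by linarith
      then show "norm ((exp (k n * g x) - 1) / k n) \<le> exp (\<rho> * t * B) * \<bar>g x\<bar>"
        using k[of n] by (simp add: abs_mult field_simps)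
    qed
    show "AE x in M. (\<lambda>n. (exp (k n * g x) - 1) / k n) \<longlonglongrightarrow> g x"
    proof (rule AE_I2)
      fix x
      have "((\<lambda>k. exp (k * g x)) has_real_derivative g x) (at 0)"
        by (auto intro!: derivative_eq_intros)
      then have "((\<lambda>h. (exp (h * g x) - 1) / h) \<longlongrightarrow> g x) (at 0)"
        by (simp add: has_field_derivative_iff)
      moreover have "filterlim k (at 0) sequentially"
      proof -
        have "(\<lambda>n. \<rho> * t * inverse (real (Suc n))) \<longlonglongrightarrow> \<rho> * t * 0"
          by (intro tendsto_intros LIMSEQ_inverse_real_of_nat)
        then have "k \<longlonglongrightarrow> 0" by (simp add: k_def[abs_def] divide_inverse)
        then show ?thesis using k(1) by (auto simp: filterlim_at less_imp_neq[THEN not_sym])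
      qed
      ultimately show "(\<lambda>n. (exp (k n * g x) - 1) / k n) \<longlonglongrightarrow> g x"
        by (rule filterlim_compose)
    qed
  qed
  then show ?thesis
    unfolding g_def[symmetric] using order_trans[OF lower upper] by (intro LIMSEQ_le_const) blast+
qed

end

section \<open>From the transport inequality to the infimum-convolution inequality\<close>

lemma concave_jensen:
  fixes h :: "'a::euclidean_space \<Rightarrow> real"
  assumes "prob_space P" "integrable P (\<lambda>y. y)" "integrable P h" "concave_on UNIV h"
  shows "(\<integral>y. h y \<partial>P) \<le> h (\<integral>y. y \<partial>P)"
proof -
  interpret P: prob_space P by fact
  define m where "m = (\<integral>y. y \<partial>P)"
  obtain D where D: "\<And>y. - h m + D \<bullet> (y - m) \<le> - h y"
    using convex_on_subgradient[of "\<lambda>x. - h x"] assms(4) unfolding concave_on_def by blast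
  have "(\<integral>y. h y \<partial>P) \<le> (\<integral>y. h m - D \<bullet> (y - m) \<partial>P)"
  proof (rule integral_mono[OF assms(3)])
    show "integrable P (\<lambda>y. h m - D \<bullet> (y - m))" using assms(2) by (auto intro!: integrable_inner_right)
    show "h y \<le> h m - D \<bullet> (y - m)" for y using D[of y] by linarith
  qed
  also have "\<dots> = h m - D \<bullet> (m - m)"
    using assms(2) P.prob_space by (simp add: m_def integrable_inner_right)
  finally show ?thesis by (simp add: m_def)
qed

context norm_prob
begin

text \<open>Trades the Radon-Nikodym derivative inside \<open>rel_entropy\<close>, determined only
  almost everywhere, for the explicit density.\<close>

lemma rel_entropy_density:
  fixes g :: "'a \<Rightarrow> real"
  assumes [measurable]: "g \<in> borel_measurable M" and nn: "\<And>x. 0 \<le> g x"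
    and int: "integrable M (\<lambda>x. g x * ln (g x))"
  shows "rel_entropy (density M g) M = ereal (\<integral>x. g x * ln (g x) \<partial>M)"
proof -
  have "AE x in M. ennreal (g x) = RN_deriv M (density M g) x"
    by (rule RN_deriv_unique) auto
  then have eq: "AE x in M. entropy_density (exp 1) M (density M g) x = ln (g x)"
  proof eventually_elim
    case (elim x)
    have "enn2real (RN_deriv M (density M g) x) = g x" unfolding elim[symmetric] by (simp add: nn)
    then show ?case by (simp add: entropy_density_def log_def)
  qed
  have "integrable (density M g) (entropy_density (exp 1) M (density M g))
      \<longleftrightarrow> integrable M (\<lambda>x. g x * entropy_density (exp 1) M (density M g) x)"
    by (intro integrable_real_density) (auto simp: nn)
  also have "\<dots> \<longleftrightarrow> integrable M (\<lambda>x. g x * ln (g x))"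
    using eq by (intro integrable_cong_AE) auto
  finally show ?thesis
    using int KL_density[of "exp 1" g] nn
    by (simp add: rel_entropy_def absolutely_continuousI_density log_def)
qed

lemma rel_entropy_finiteE:
  assumes "rel_entropy \<nu> M \<noteq> \<infinity>" "prob_space \<nu>" "sets \<nu> = sets borel"
  obtains g where "g \<in> borel_measurable M" "\<And>x. 0 \<le> g x" "\<nu> = density M g"
    "integrable M (\<lambda>x. g x * ln (g x))" "rel_entropy \<nu> M = ereal (\<integral>x. g x * ln (g x) \<partial>M)"
proof -
  interpret \<nu>: prob_space \<nu> by fact
  have ac: "absolutely_continuous M \<nu>" and int: "integrable \<nu> (entropy_density (exp 1) M \<nu>)"
    using assms(1) by (auto simp: rel_entropy_def split: if_splits)
  have sets: "sets \<nu> = sets M" using assms(3) sets_M by simp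
  obtain g where g [measurable]: "g \<in> borel_measurable M"
    and eq: "AE x in M. RN_deriv M \<nu> x = ennreal (g x)" and nn: "\<And>x. 0 \<le> g x"
    using real_RN_deriv[OF \<nu>.finite_measure_axioms ac sets] by metis
  have "\<nu> = density M (RN_deriv M \<nu>)" using density_RN_deriv[OF ac sets] by simp
  also have "\<dots> = density M g" using eq by (intro density_cong) auto
  finally have \<nu>: "\<nu> = density M g" .
  have "integrable M (\<lambda>x. g x * entropy_density (exp 1) M \<nu> x)"
    using int nn by (subst (asm) \<nu>, subst (asm) integrable_real_density) (auto simp: \<nu>[symmetric])
  moreover have "AE x in M. g x * entropy_density (exp 1) M \<nu> x = g x * ln (g x)"
    using eq by eventually_elim (simp add: entropy_density_def log_def nn)
  then have "integrable M (\<lambda>x. g x * entropy_density (exp 1) M \<nu> x) \<longleftrightarrow> integrable M (\<lambda>x. g x * ln (g x))"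
    by (intro integrable_cong_AE) auto
  ultimately have "integrable M (\<lambda>x. g x * ln (g x))" by simp
  with rel_entropy_density[OF g nn] show ?thesis by (intro that[OF g nn \<nu>]) (auto simp: \<nu>)
qed

text \<open>The easy half of Kantorovich duality: Jensen's inequality moves \<open>h\<close> from
  \<open>p x\<close> to its barycentre, where the hypothesis \<open>le\<close> produces the
  barycentric cost.\<close>

lemma transport_cost_ge:
  assumes \<nu>: "\<nu> \<in> P1" and h: "conc_lip L h" and \<phi>: "integrable M \<phi>" "\<And>x. \<phi> x \<le> B"
    and lam: "lam > 0" and le: "\<And>x y. h y \<le> \<phi> x + lam / 2 * (N (x - y))\<^sup>2"
  shows "ennreal (((\<integral>x. h x \<partial>\<nu>) - (\<integral>x. \<phi> x \<partial>M)) / lam) \<le> transport_cost N \<nu> M"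
  unfolding transport_cost_def
proof (rule INF_greatest, safe)
  fix \<pi> p assume \<pi>: "\<pi> \<in> couplings M \<nu>" and dis: "disintegrates M p \<pi>"
  define C where "C = (\<integral>\<^sup>+x. ennreal (bary_cost N x (p x)) \<partial>M)"
  interpret \<nu>: norm_prob N \<nu>
    using \<nu> by (simp add: norm_prob_def norm_prob_axioms_def norm_fun_axioms P1_def)
  have p_prob: "p \<in> borel \<rightarrow>\<^sub>M prob_algebra borel" using dis by (simp add: disintegrates_def)
  have p [measurable]: "p \<in> measurable M (subprob_algebra borel)"
    using measurable_prob_algebraD[OF p_prob] sets_M by (simp cong: measurable_cong_sets)
  have px: "prob_space (p x)" "sets (p x) = sets borel" for x
    using measurable_space[OF p_prob, of x] by (auto simp: space_prob_algebra)
  have "\<nu> = M \<bind> p"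
  proof (rule measure_eqI)
    show "sets \<nu> = sets (M \<bind> p)" using \<nu>.sets_M by (subst sets_bind[OF px(2)]) auto
    fix A assume "A \<in> sets \<nu>"
    then have A: "A \<in> sets borel" using \<nu>.sets_M by simp
    have "\<nu> = distr \<pi> borel snd" "sets \<pi> = sets (borel \<Otimes>\<^sub>M borel)"
      using \<pi> by (auto simp: couplings_def)
    then have "emeasure \<nu> A = emeasure \<pi> (snd -` A \<inter> space (borel \<Otimes>\<^sub>M borel))"
      using A by (auto simp: emeasure_distr cong: measurable_cong_sets dest: sets_eq_imp_space_eq)
    also have "snd -` A \<inter> space (borel \<Otimes>\<^sub>M borel) = UNIV \<times> A" by (auto simp: space_pair_measure)
    also have "emeasure \<pi> (UNIV \<times> A) = (\<integral>\<^sup>+x. (\<integral>\<^sup>+y. indicator (UNIV \<times> A) (x, y) \<partial>p x) \<partial>M)"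
      using dis A by (auto simp: disintegrates_def intro!: pair_measureI)
    also have "\<dots> = (\<integral>\<^sup>+x. emeasure (p x) A \<partial>M)"
    proof (intro nn_integral_cong)
      fix x
      have "(\<integral>\<^sup>+y. indicator (UNIV \<times> A) (x, y) \<partial>p x) = (\<integral>\<^sup>+y. indicator A y \<partial>p x)"
        by (intro nn_integral_cong) (auto simp: indicator_def)
      also have "\<dots> = emeasure (p x) A" using A px(2)[of x] by simp
      finally show "(\<integral>\<^sup>+y. indicator (UNIV \<times> A) (x, y) \<partial>p x) = emeasure (p x) A" .
    qed
    also have "\<dots> = emeasure (M \<bind> p) A"
      using A by (subst emeasure_bind[OF _ p]) auto
    finally show "emeasure \<nu> A = emeasure (M \<bind> p) A" .
  qed
  then have bind: "(\<integral>\<^sup>+y. f y \<partial>\<nu>) = (\<integral>\<^sup>+x. \<integral>\<^sup>+y. f y \<partial>p x \<partial>M)" if "f \<in> borel_measurable borel" for f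
    using nn_integral_bind[OF that p] by simp
  obtain B' where B': "B' \<ge> 0" "\<And>x. h x \<le> B'" using conc_lip_bound[OF h] by auto
  \<comment> \<open>Both \<open>K - \<phi>\<close> and \<open>K - h\<close> are nonnegative, so the
    estimate can be integrated in \<open>ennreal\<close> whether or not the cost \<open>C\<close> is
    finite.\<close>
  define K where "K = max B B'"
  have K: "\<phi> x \<le> K" "h x \<le> K" for x using \<phi>(2)[of x] B'(2)[of x] by (auto simp: K_def)
  have [measurable]: "h \<in> borel_measurable borel" by (rule conc_lipD(6)[OF h])
  have bary_m [measurable]: "(\<lambda>x. bary_cost N x (p x)) \<in> borel_measurable M"
  proof -
    have "(\<lambda>x. \<integral>y. y \<partial>p x) \<in> borel_measurable M"
      by (rule measurable_compose[OF p integral_measurable_subprob_algebra]) simp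
    then show ?thesis unfolding bary_cost_def by measurable
  qed
  have "(\<integral>\<^sup>+x. \<integral>\<^sup>+y. ennreal (norm y) \<partial>p x \<partial>M) < \<infinity>"
    using \<nu>.integrable_norm by (subst bind[symmetric]) (auto simp: integrable_iff_bounded)
  then have "AE x in M. (\<integral>\<^sup>+y. ennreal (norm y) \<partial>p x) \<noteq> \<infinity>"
    by (intro nn_integral_PInf_AE) auto
  \<comment> \<open>Jensen's inequality needs a first moment of \<open>p x\<close>, which is
    inherited from \<open>\<nu>\<close> only for almost every x.\<close>
  then have "AE x in M. ennreal (K - \<phi> x)
      \<le> ennreal lam * ennreal (bary_cost N x (p x)) + (\<integral>\<^sup>+y. ennreal (K - h y) \<partial>p x)"
  proof eventually_elim
    case (elim x)
    interpret px: norm_prob N "p x"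
      using px[of x] elim
      by (auto simp: norm_prob_def norm_prob_axioms_def norm_fun_axioms integrable_iff_bounded top.not_eq_extremum
          cong: measurable_cong_sets)
    have hi: "integrable (p x) h" by (rule px.integrable_conc_lip[OF h])
    have idi: "integrable (p x) (\<lambda>y. y)"
      using px.integrable_norm px(2)[of x] by (simp add: integrable_norm_iff cong: measurable_cong_sets)
    have "(\<integral>y. h y \<partial>p x) \<le> h (\<integral>y. y \<partial>p x)"
      by (rule concave_jensen[OF px(1) idi hi conc_lipD(1)[OF h]])
    also have "\<dots> \<le> \<phi> x + lam * bary_cost N x (p x)"
      using le by (simp add: bary_cost_def)
    finally have "K - \<phi> x \<le> lam * bary_cost N x (p x) + (\<integral>y. K - h y \<partial>p x)"
      using hi px.prob_space by simp
    then have "ennreal (K - \<phi> x) \<le> ennreal (lam * bary_cost N x (p x) + (\<integral>y. K - h y \<partial>p x))"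
      by (rule ennreal_leI)
    also have "\<dots> = ennreal lam * ennreal (bary_cost N x (p x)) + ennreal (\<integral>y. K - h y \<partial>p x)"
    proof -
      have "0 \<le> bary_cost N x (p x)" by (simp add: bary_cost_def)
      then show ?thesis using lam K by (simp add: ennreal_plus ennreal_mult integral_nonneg_AE)
    qed
    also have "ennreal (\<integral>y. K - h y \<partial>p x) = (\<integral>\<^sup>+y. ennreal (K - h y) \<partial>p x)"
      using hi K by (intro nn_integral_eq_integral[symmetric]) auto
    finally show ?case .
  qed
  then have "(\<integral>\<^sup>+x. ennreal (K - \<phi> x) \<partial>M)
      \<le> (\<integral>\<^sup>+x. ennreal lam * ennreal (bary_cost N x (p x)) + (\<integral>\<^sup>+y. ennreal (K - h y) \<partial>p x) \<partial>M)"
    by (rule nn_integral_mono_AE)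
  also have "\<dots> = ennreal lam * C + (\<integral>\<^sup>+y. ennreal (K - h y) \<partial>\<nu>)"
    unfolding C_def
    by (subst nn_integral_add) (auto simp: nn_integral_cmult bind intro!: measurable_compose[OF p nn_integral_measurable_subprob_algebra])
  also have "(\<integral>\<^sup>+y. ennreal (K - h y) \<partial>\<nu>) = ennreal (\<integral>y. K - h y \<partial>\<nu>)"
    using \<nu>.integrable_conc_lip[OF h] K by (intro nn_integral_eq_integral) auto
  also have "(\<integral>y. K - h y \<partial>\<nu>) = K - (\<integral>y. h y \<partial>\<nu>)"
    using \<nu>.integrable_conc_lip[OF h] \<nu>.prob_space by simp
  also have "(\<integral>\<^sup>+x. ennreal (K - \<phi> x) \<partial>M) = ennreal (\<integral>x. K - \<phi> x \<partial>M)"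
    using \<phi> K by (intro nn_integral_eq_integral) auto
  also have "(\<integral>x. K - \<phi> x \<partial>M) = K - (\<integral>x. \<phi> x \<partial>M)" using \<phi> prob_space by simp
  finally have main: "ennreal (K - (\<integral>x. \<phi> x \<partial>M)) \<le> ennreal lam * C + ennreal (K - (\<integral>y. h y \<partial>\<nu>))" .
  have "(\<integral>y. h y \<partial>\<nu>) \<le> (\<integral>y. K \<partial>\<nu>)"
    using \<nu>.integrable_conc_lip[OF h] K by (intro integral_mono) auto
  then have hK: "(\<integral>y. h y \<partial>\<nu>) \<le> K" using \<nu>.prob_space by simp
  have "ennreal (((\<integral>x. h x \<partial>\<nu>) - (\<integral>x. \<phi> x \<partial>M)) / lam) \<le> C"
  proof (cases C)
    case (real c)
    then have "ennreal (K - (\<integral>x. \<phi> x \<partial>M)) \<le> ennreal (lam * c + (K - (\<integral>y. h y \<partial>\<nu>)))"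
      using main lam hK by (simp add: ennreal_plus ennreal_mult)
    then have "K - (\<integral>x. \<phi> x \<partial>M) \<le> lam * c + (K - (\<integral>y. h y \<partial>\<nu>))"
      using real lam hK by (subst (asm) ennreal_le_iff) auto
    then have "((\<integral>x. h x \<partial>\<nu>) - (\<integral>x. \<phi> x \<partial>M)) / lam \<le> c" using lam by (simp add: field_simps)
    then show ?thesis using real by (auto intro: ennreal_leI)
  qed simp
  then show "ennreal (((\<integral>x. h x \<partial>\<nu>) - (\<integral>x. \<phi> x \<partial>M)) / lam) \<le> (\<integral>\<^sup>+x. ennreal (bary_cost N x (p x)) \<partial>M)"
    by (simp add: C_def)
qed

theorem T2_plus_imp_inf_conv_log_Sobolev:
  assumes T2: "T2_plus N M b" and b: "b > 0" and lam: "0 < lam" "lam < 1 / b"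
  shows "inf_conv_log_Sobolev N M lam (1 / (1 - b * lam))"
  unfolding inf_conv_log_Sobolev_def
proof
  fix \<phi> assume "\<phi> \<in> F_class N lam"
  then obtain L where \<phi>: "conc_lip L \<phi>" unfolding F_class_iff by auto
  define Q where "Q = inf_conv N (1 / lam) \<phi>"
  have Q: "conc_lip L Q" unfolding Q_def using lam by (intro conc_lip_inf_conv[OF \<phi>]) auto
  obtain B where B: "B \<ge> 0" "\<And>x. \<phi> x \<le> B" using conc_lip_bound[OF \<phi>] by auto
  have [measurable]: "\<phi> \<in> borel_measurable borel" "Q \<in> borel_measurable borel"
    by (rule conc_lipD(6)[OF \<phi>], rule conc_lipD(6)[OF Q])
  define Z where "Z = (\<integral>x. exp (\<phi> x) \<partial>M)"
  have Z: "Z > 0" unfolding Z_def by (rule integral_exp_pos[OF \<phi>])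
  define g where "g x = exp (\<phi> x) / Z" for x
  have g0: "0 \<le> g x" for x using Z by (simp add: g_def)
  have gm [measurable]: "g \<in> borel_measurable M" unfolding g_def by measurable
  define \<nu> where "\<nu> = density M g"
  have gi: "integrable M (\<lambda>x. g x * f x)" if "integrable M f" for f
    using integrable_exp_mult[OF \<phi> that] by (simp add: g_def field_simps)
  have \<nu>_int: "(\<integral>x. f x \<partial>\<nu>) = (\<integral>x. g x * f x \<partial>M)" if "f \<in> borel_measurable M" for f :: "'a \<Rightarrow> real"
    unfolding \<nu>_def using that g0 by (intro integral_real_density) auto
  have "prob_space \<nu>"
  proof
    have "emeasure \<nu> (space \<nu>) = (\<integral>\<^sup>+x. ennreal (g x) \<partial>M)"
      unfolding \<nu>_def by (subst emeasure_density) (auto intro!: nn_integral_cong)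
    also have "\<dots> = ennreal (\<integral>x. g x \<partial>M)"
      using gi[of "\<lambda>x. 1"] g0 by (intro nn_integral_eq_integral) auto
    also have "(\<integral>x. g x \<partial>M) = 1" using Z by (simp add: g_def Z_def)
    finally show "emeasure \<nu> (space \<nu>) = 1" by simp
  qed
  moreover have "integrable \<nu> (\<lambda>x. norm x)"
    unfolding \<nu>_def using gi[OF integrable_norm] g0 by (subst integrable_real_density) auto
  ultimately have \<nu>P: "\<nu> \<in> P1" by (simp add: P1_def \<nu>_def sets_M)
  define a where "a = (\<integral>x. g x * \<phi> x \<partial>M)"
  have g_ln: "g x * ln (g x) = g x * \<phi> x - g x * ln Z" for x
    using Z by (simp add: g_def ln_div right_diff_distrib)
  have gint: "integrable M g" "(\<integral>x. g x \<partial>M) = 1"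
    using gi[of "\<lambda>x. 1"] Z by (simp, simp add: g_def Z_def)
  have gphi: "integrable M (\<lambda>x. g x * \<phi> x)" by (rule gi[OF integrable_conc_lip[OF \<phi>]])
  have H: "rel_entropy \<nu> M = ereal (a - ln Z)"
    unfolding \<nu>_def using gint gphi g_ln
    by (subst rel_entropy_density[OF gm g0]) (auto simp: a_def)
  have zero: "conc_lip 0 (\<lambda>_. 0)"
    by (rule conc_lipI[where B = 0]) auto
  have "(\<integral>x. \<phi> x \<partial>M) \<le> ln Z"
    using ln_integral_exp_diff_le[OF zero \<phi>] prob_space by (simp add: Z_def)
  have "ennreal (((\<integral>x. Q x \<partial>\<nu>) - (\<integral>x. \<phi> x \<partial>M)) / lam) \<le> transport_cost N \<nu> M"
  proof (rule transport_cost_ge[OF \<nu>P Q integrable_conc_lip[OF \<phi>] B(2) lam(1)])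
    fix x y show "Q y \<le> \<phi> x + lam / 2 * (N (x - y))\<^sup>2"
      using inf_conv_le[OF \<phi>, of "1 / lam" y x] lam by (simp add: Q_def N_commute)
  qed
  \<comment> \<open>Here \<open>ennreal\<close> sends a negative difference to 0; the real
    inequality is one of the two bounds contained in that maximum.\<close>
  then have "ereal (((\<integral>x. Q x \<partial>\<nu>) - (\<integral>x. \<phi> x \<partial>M)) / lam) \<le> enn2ereal (transport_cost N \<nu> M)"
    unfolding less_eq_ennreal.rep_eq ennreal.rep_eq sup.bounded_iff by blast
  also have "\<dots> \<le> ereal b * rel_entropy \<nu> M" using T2 \<nu>P by (simp add: T2_plus_def)
  finally have "((\<integral>x. Q x \<partial>\<nu>) - (\<integral>x. \<phi> x \<partial>M)) / lam \<le> b * (a - ln Z)" unfolding H by simp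
  then have 1: "(\<integral>x. Q x \<partial>\<nu>) - (\<integral>x. \<phi> x \<partial>M) \<le> b * lam * (a - ln Z)"
    using lam by (simp add: field_simps)
  have "(\<integral>x. Q x \<partial>\<nu>) = (\<integral>x. g x * Q x \<partial>M)" by (rule \<nu>_int) simp
  also have "\<dots> = a - (\<integral>x. g x * (\<phi> x - Q x) \<partial>M)"
    using gphi gi[OF integrable_conc_lip[OF Q]] by (simp add: a_def right_diff_distrib)
  finally have "a - ln Z \<le> (\<integral>x. g x * (\<phi> x - Q x) \<partial>M) + b * lam * (a - ln Z)"
    using 1 \<open>(\<integral>x. \<phi> x \<partial>M) \<le> ln Z\<close> by linarith
  \<comment> \<open>The entropy \<open>a - ln Z\<close> occurs on both sides; collecting it leaves
    the factor \<open>1 - b * lam\<close>, positive because \<open>lam < 1 / b\<close>.\<close>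
  then have "(1 - b * lam) * (a - ln Z) \<le> (\<integral>x. g x * (\<phi> x - Q x) \<partial>M)" by (simp add: algebra_simps)
  moreover have "b * lam < 1" using lam b by (simp add: field_simps)
  ultimately have "a - ln Z \<le> 1 / (1 - b * lam) * (\<integral>x. g x * (\<phi> x - Q x) \<partial>M)"
    by (simp add: field_simps)
  then have "Z * (a - ln Z) \<le> Z * (1 / (1 - b * lam) * (\<integral>x. g x * (\<phi> x - Q x) \<partial>M))"
    using Z by (intro mult_left_mono) auto
  moreover have "Z * a = (\<integral>x. exp (\<phi> x) * \<phi> x \<partial>M)"
  proof -
    have "a = (\<integral>x. (exp (\<phi> x) * \<phi> x) / Z \<partial>M)"
      unfolding a_def by (intro Bochner_Integration.integral_cong) (auto simp: g_def)
    then show ?thesis using Z by simp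
  qed
  moreover have "Z * (\<integral>x. g x * (\<phi> x - Q x) \<partial>M) = (\<integral>x. (\<phi> x - Q x) * exp (\<phi> x) \<partial>M)"
  proof -
    have "(\<integral>x. g x * (\<phi> x - Q x) \<partial>M) = (\<integral>x. ((\<phi> x - Q x) * exp (\<phi> x)) / Z \<partial>M)"
      by (intro Bochner_Integration.integral_cong) (auto simp: g_def)
    then show ?thesis using Z by simp
  qed
  ultimately show "Ent M (\<lambda>x. exp (\<phi> x))
      \<le> 1 / (1 - b * lam) * (\<integral>x. (\<phi> x - inf_conv N (1 / lam) \<phi> x) * exp (\<phi> x) \<partial>M)"
    unfolding Ent_exp[OF \<phi>] Z_def[symmetric] Q_def[symmetric] by (simp add: algebra_simps)
qed

end

section \<open>Gaussian moments and the entropy inequality\<close>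

text \<open>The Fenchel-Young inequality for the conjugate pair \<open>g * ln g - g\<close> and
  \<open>exp\<close>.\<close>

lemma exp_young:
  fixes g v :: real
  assumes "0 \<le> g"
  shows "g * v \<le> g * ln g - g + exp v"
proof (cases "g = 0")
  case False
  with assms have g: "g > 0" by simp
  have "g * (1 + (v - ln g)) \<le> g * exp (v - ln g)"
    using g by (intro mult_left_mono exp_ge_add_one_self) auto
  also have "\<dots> = exp v" using g by (simp add: exp_diff)
  finally show ?thesis by (simp add: algebra_simps)
qed simp

context norm_prob
begin

text \<open>The Bobkov-Goetze dual form of \<open>T2_plus N M b\<close>.\<close>

definition T2_dual :: "real \<Rightarrow> bool" where
  "T2_dual b \<longleftrightarrow> b > 0 \<and>
    (\<forall>L f. conc_lip L f \<longrightarrow> b * ln (\<integral>x. exp (f x / b) \<partial>M) \<le> (\<integral>x. sup_conv 1 f x \<partial>M))"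

lemma integrable_id: "integrable M (\<lambda>x. x)"
  using integrable_norm by (simp add: integrable_norm_iff)

text \<open>Linear functions are not bounded above, so they are cut off at n and recovered by
  Fatou's lemma. Sup-convolution at time 1 raises a linear function by at most
  \<open>(dual_norm N a)\<^sup>2 / 2\<close>.\<close>

lemma T2_dual_linear:
  assumes b: "T2_dual b"
  shows "(\<integral>\<^sup>+x. ennreal (exp (a \<bullet> x / b)) \<partial>M)
    \<le> ennreal (exp ((a \<bullet> (\<integral>x. x \<partial>M) + (dual_norm N a)\<^sup>2 / 2) / b))"
    (is "_ \<le> ennreal (exp (?c / b))")
proof -
  have b0: "b > 0" using b by (simp add: T2_dual_def)
  define f where "f n x = min (a \<bullet> x) (real n)" for n :: nat and x
  have f: "conc_lip (dual_norm N a) (f n)" for n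
  proof (rule conc_lipI)
    fix x y and t :: real
    show "f n x \<le> real n" by (simp add: f_def)
    have "f n x \<le> f n y + \<bar>a \<bullet> x - a \<bullet> y\<bar>" by (auto simp: f_def min_def abs_if)
    also have "\<bar>a \<bullet> x - a \<bullet> y\<bar> \<le> dual_norm N a * N (x - y)"
      using inner_le_dual[of a "x - y"] inner_le_dual[of a "y - x"]
      by (simp add: inner_diff_right N_commute abs_le_iff)
    finally show "f n x \<le> f n y + dual_norm N a * N (x - y)" by simp
    assume t: "0 < t" "t < 1"
    have "(1 - t) * f n x + t * f n y \<le> (1 - t) * (a \<bullet> x) + t * (a \<bullet> y)"
      using t by (intro add_mono mult_left_mono) (auto simp: f_def)
    moreover have "(1 - t) * f n x + t * f n y \<le> (1 - t) * real n + t * real n"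
      using t by (intro add_mono mult_left_mono) (auto simp: f_def)
    moreover have "(1 - t) * real n + t * real n = real n" by (simp add: algebra_simps)
    ultimately show "(1 - t) * f n x + t * f n y \<le> f n ((1 - t) *\<^sub>R x + t *\<^sub>R y)"
      unfolding f_def[of _ "_ + _"] by (simp add: inner_add_right)
  qed
  have bound: "(\<integral>x. exp (f n x / b) \<partial>M) \<le> exp (?c / b)" for n
  proof -
    have "b * ln (\<integral>x. exp (f n x / b) \<partial>M) \<le> (\<integral>x. sup_conv 1 (f n) x \<partial>M)"
      using b f by (auto simp: T2_dual_def)
    also have "\<dots> \<le> (\<integral>x. a \<bullet> x + (dual_norm N a)\<^sup>2 / 2 \<partial>M)"
    proof (rule integral_mono)
      show "integrable M (sup_conv 1 (f n))"
        by (intro integrable_conc_lip[OF conc_lip_sup_conv[OF f]]) simp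
      show "integrable M (\<lambda>x. a \<bullet> x + (dual_norm N a)\<^sup>2 / 2)"
        using integrable_id by (auto intro: integrable_inner_right)
      fix x show "sup_conv 1 (f n) x \<le> a \<bullet> x + (dual_norm N a)\<^sup>2 / 2"
      proof (rule sup_conv_le)
        fix y
        have "f n y \<le> a \<bullet> x + a \<bullet> (y - x)" by (simp add: f_def inner_diff_right)
        also have "a \<bullet> (y - x) \<le> dual_norm N a * N (x - y)"
          using inner_le_dual[of a "y - x"] by (simp add: N_commute)
        also have "\<dots> \<le> (dual_norm N a)\<^sup>2 / 2 + (N (x - y))\<^sup>2 / 2"
          using zero_le_power2[of "dual_norm N a - N (x - y)"] by (simp add: power2_diff)
        finally show "f n y - 1 / (2 * 1) * (N (x - y))\<^sup>2 \<le> a \<bullet> x + (dual_norm N a)\<^sup>2 / 2" by simp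
      qed
    qed
    also have "\<dots> = ?c" using integrable_id prob_space by (simp add: integrable_inner_right)
    finally have "ln (\<integral>x. exp (f n x / b) \<partial>M) \<le> ?c / b" using b0 by (simp add: field_simps)
    moreover have "0 < (\<integral>x. exp (f n x / b) \<partial>M)"
      using integral_exp_pos[OF conc_lip_scale[OF f, of "1 / b"]] b0 by simp
    ultimately show ?thesis by (metis exp_le_cancel_iff exp_ln)
  qed
  have "(\<integral>\<^sup>+x. ennreal (exp (a \<bullet> x / b)) \<partial>M) = (\<integral>\<^sup>+x. liminf (\<lambda>n. ennreal (exp (f n x / b))) \<partial>M)"
  proof (rule nn_integral_cong)
    fix x
    obtain k where "a \<bullet> x \<le> real k" using real_arch_simple by blast
    then have "\<forall>\<^sub>F n in sequentially. ennreal (exp (f n x / b)) = ennreal (exp (a \<bullet> x / b))"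
      by (intro eventually_sequentiallyI[of k]) (auto simp: f_def min_def dest: of_nat_mono[where 'a = real])
    then have "(\<lambda>n. ennreal (exp (f n x / b))) \<longlonglongrightarrow> ennreal (exp (a \<bullet> x / b))"
      by (rule tendsto_eventually)
    then show "ennreal (exp (a \<bullet> x / b)) = liminf (\<lambda>n. ennreal (exp (f n x / b)))"
      by (rule lim_imp_Liminf[OF sequentially_bot, symmetric])
  qed
  also have "\<dots> \<le> liminf (\<lambda>n. \<integral>\<^sup>+x. ennreal (exp (f n x / b)) \<partial>M)"
  proof (rule nn_integral_liminf)
    fix n
    have [measurable]: "f n \<in> borel_measurable M" by (intro borel_M conc_lipD(6)[OF f])
    show "(\<lambda>x. ennreal (exp (f n x / b))) \<in> borel_measurable M" by measurable
  qed
  also have "\<dots> \<le> liminf (\<lambda>n. ennreal (exp (?c / b)))"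
  proof (intro Liminf_mono always_eventually allI)
    fix n
    have "(\<integral>\<^sup>+x. ennreal (exp (f n x / b)) \<partial>M) = ennreal (\<integral>x. exp (f n x / b) \<partial>M)"
      using integrable_exp[OF conc_lip_scale[OF f, of "1 / b"]] b0
      by (intro nn_integral_eq_integral) auto
    also have "\<dots> \<le> ennreal (exp (?c / b))" using bound by (rule ennreal_leI)
    finally show "(\<integral>\<^sup>+x. ennreal (exp (f n x / b)) \<partial>M) \<le> ennreal (exp (?c / b))" .
  qed
  finally show ?thesis by (simp add: Liminf_const)
qed

text \<open>Taking \<open>n\<close> to be the integer part of \<open>\<bar>u\<bar>\<close>, \<open>u^2 \<le> 1 + 2 n \<bar>u\<bar> - n^2\<close>: the Gaussian weight is
  dominated by a sum of exponentials of linear functions.\<close>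

lemma T2_dual_gaussian:
  assumes b: "T2_dual b"
  shows "\<exists>c>0. (\<integral>\<^sup>+x. ennreal (exp (c * (e \<bullet> x)\<^sup>2)) \<partial>M) < \<infinity>"
proof -
  have b0: "b > 0" using b by (simp add: T2_dual_def)
  define K where "K = (dual_norm N e)\<^sup>2"
  \<comment> \<open>Chosen so that \<open>4 * b * c * K \<le> 1\<close>: the quadratic term produced
    by the linear exponential moments then uses up at most half of
    \<open>c * (real n)\<^sup>2\<close>.\<close>
  define c where "c = 1 / (4 * b * (K + 1))"
  have K: "K \<ge> 0" by (simp add: K_def)
  have "4 * b * c * K = K / (K + 1)" using b0 K by (simp add: c_def)
  with b0 K have c: "c > 0" "4 * b * c * K \<le> 1" by (simp_all add: c_def)
  define m where "m = \<bar>e \<bullet> (\<integral>x. x \<partial>M)\<bar>"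
  define T where "T \<sigma> n x = ennreal (exp (c - c * (real n)\<^sup>2) * exp (2 * c * real n * \<sigma> * (e \<bullet> x)))"
    for \<sigma> :: real and n :: nat and x
  have Tm [measurable]: "T \<sigma> n \<in> borel_measurable M" for \<sigma> n unfolding T_def by measurable
  \<comment> \<open>A geometric bound obtained by completing a square. In \<open>2 * m + 1\<close>
    the part \<open>2 * m\<close> absorbs the contribution of the mean, and the 1 leaves the decay
    \<open>exp (- c)\<close> per step.\<close>
  define r where "r n = exp (c + c * (2 * m + 1)\<^sup>2 / 2) * exp (- c) ^ n" for n :: nat
  have T_le: "(\<integral>\<^sup>+x. T \<sigma> n x \<partial>M) \<le> ennreal (r n)" if \<sigma>: "\<bar>\<sigma>\<bar> = 1" for \<sigma> n
  proof -
    define k where "k = 2 * c * real n * \<sigma>"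
    have k2: "k\<^sup>2 = 4 * c\<^sup>2 * (real n)\<^sup>2"
      using \<sigma> by (simp add: k_def power_mult_distrib) (metis abs_1 power2_abs one_power2)
    have "(\<integral>\<^sup>+x. T \<sigma> n x \<partial>M) = ennreal (exp (c - c * (real n)\<^sup>2)) * (\<integral>\<^sup>+x. ennreal (exp ((b * k) *\<^sub>R e \<bullet> x / b)) \<partial>M)"
      unfolding T_def k_def[symmetric] using b0
      by (subst nn_integral_cmult[symmetric]) (auto simp: ennreal_mult)
    also have "\<dots> \<le> ennreal (exp (c - c * (real n)\<^sup>2)) *
        ennreal (exp (((b * k) *\<^sub>R e \<bullet> (\<integral>x. x \<partial>M) + (dual_norm N ((b * k) *\<^sub>R e))\<^sup>2 / 2) / b))"
      by (intro mult_left_mono T2_dual_linear[OF b]) simp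
    also have "((b * k) *\<^sub>R e \<bullet> (\<integral>x. x \<partial>M) + (dual_norm N ((b * k) *\<^sub>R e))\<^sup>2 / 2) / b
        = k * (e \<bullet> (\<integral>x. x \<partial>M)) + b * k\<^sup>2 * K / 2"
      using b0 by (simp add: dual_scale K_def power_mult_distrib field_simps power2_eq_square)
    also have "ennreal (exp (c - c * (real n)\<^sup>2)) * ennreal (exp (k * (e \<bullet> (\<integral>x. x \<partial>M)) + b * k\<^sup>2 * K / 2))
        = ennreal (exp (c - c * (real n)\<^sup>2 + (k * (e \<bullet> (\<integral>x. x \<partial>M)) + b * k\<^sup>2 * K / 2)))"
      by (simp add: exp_add ennreal_mult)
    also have "\<dots> \<le> ennreal (r n)"
    proof (rule ennreal_leI)
      have "k * (e \<bullet> (\<integral>x. x \<partial>M)) \<le> \<bar>k\<bar> * m" by (metis abs_ge_self abs_mult m_def)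
      also have "\<bar>k\<bar> = 2 * c * real n" using \<sigma> c by (simp add: k_def abs_mult)
      finally have 1: "k * (e \<bullet> (\<integral>x. x \<partial>M)) \<le> c * (2 * real n * m)" by (simp add: mult_ac)
      have "b * k\<^sup>2 * K / 2 = (4 * b * c * K) * (c * (real n)\<^sup>2 / 2)"
        unfolding k2 by (simp add: power2_eq_square)
      also have "\<dots> \<le> 1 * (c * (real n)\<^sup>2 / 2)" using c by (intro mult_right_mono) auto
      finally have 2: "b * k\<^sup>2 * K / 2 \<le> c * ((real n)\<^sup>2 / 2)" by simp
      have "0 \<le> c * ((2 * m + 1 - real n)\<^sup>2 / 2)" using c by simp
      also have "\<dots> = c * ((2 * m + 1)\<^sup>2 / 2 - (2 * m + 1) * real n + (real n)\<^sup>2 / 2)"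
        by (simp add: power2_eq_square field_simps)
      finally have "c - c * (real n)\<^sup>2 + (k * (e \<bullet> (\<integral>x. x \<partial>M)) + b * k\<^sup>2 * K / 2)
          \<le> (c + c * (2 * m + 1)\<^sup>2 / 2) + real n * (- c)"
        using 1 2 by (simp add: algebra_simps)
      then have "exp (c - c * (real n)\<^sup>2 + (k * (e \<bullet> (\<integral>x. x \<partial>M)) + b * k\<^sup>2 * K / 2))
          \<le> exp ((c + c * (2 * m + 1)\<^sup>2 / 2) + real n * (- c))" by simp
      also have "\<dots> = r n" unfolding r_def exp_add exp_of_nat_mult ..
      finally show "exp (c - c * (real n)\<^sup>2 + (k * (e \<bullet> (\<integral>x. x \<partial>M)) + b * k\<^sup>2 * K / 2)) \<le> r n" .
    qed
    finally show ?thesis .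
  qed
  have "(\<integral>\<^sup>+x. ennreal (exp (c * (e \<bullet> x)\<^sup>2)) \<partial>M) \<le> (\<integral>\<^sup>+x. (\<Sum>n. T 1 n x + T (-1) n x) \<partial>M)"
  proof (rule nn_integral_mono)
    fix x
    define u where "u = \<bar>e \<bullet> x\<bar>"
    define \<sigma> where "\<sigma> = (if e \<bullet> x \<ge> 0 then 1 else - 1 :: real)"
    have \<sigma>: "\<sigma> * (e \<bullet> x) = u" by (simp add: \<sigma>_def u_def)
    define n where "n = nat \<lfloor>u\<rfloor>"
    have n: "real n \<le> u" "u < real n + 1" unfolding n_def u_def by (auto simp: of_nat_nat)
    have "(u - real n)\<^sup>2 \<le> 1" using n by (simp add: power_le_one)
    then have "u\<^sup>2 \<le> 1 - (real n)\<^sup>2 + 2 * real n * u" by (simp add: power2_diff mult_ac)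
    then have "c * u\<^sup>2 \<le> c * (1 - (real n)\<^sup>2 + 2 * real n * u)" using c by (intro mult_left_mono) auto
    also have "\<dots> = (c - c * (real n)\<^sup>2) + 2 * c * real n * \<sigma> * (e \<bullet> x)"
      unfolding mult.assoc \<sigma> by (simp add: algebra_simps)
    finally have "exp (c * u\<^sup>2) \<le> exp ((c - c * (real n)\<^sup>2) + 2 * c * real n * \<sigma> * (e \<bullet> x))" by simp
    then have "exp (c * (e \<bullet> x)\<^sup>2) \<le> exp (c - c * (real n)\<^sup>2) * exp (2 * c * real n * \<sigma> * (e \<bullet> x))"
      by (simp add: u_def exp_add)
    then have "ennreal (exp (c * (e \<bullet> x)\<^sup>2)) \<le> T \<sigma> n x" unfolding T_def by (rule ennreal_leI)
    also have "\<dots> \<le> T 1 n x + T (-1) n x" by (simp add: \<sigma>_def add_increasing add_increasing2)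
    also have "\<dots> = (\<Sum>k\<in>{n}. T 1 k x + T (-1) k x)" by simp
    also have "\<dots> \<le> (\<Sum>k. T 1 k x + T (-1) k x)" by (intro sum_le_suminf) auto
    finally show "ennreal (exp (c * (e \<bullet> x)\<^sup>2)) \<le> (\<Sum>n. T 1 n x + T (-1) n x)" .
  qed
  also have "\<dots> = (\<Sum>n. \<integral>\<^sup>+x. T 1 n x + T (-1) n x \<partial>M)" by (intro nn_integral_suminf) measurable
  also have "\<dots> \<le> (\<Sum>n. ennreal (2 * r n))"
  proof (intro suminf_le summableI)
    fix n
    have "(\<integral>\<^sup>+x. T 1 n x + T (-1) n x \<partial>M) = (\<integral>\<^sup>+x. T 1 n x \<partial>M) + (\<integral>\<^sup>+x. T (-1) n x \<partial>M)"
      by (rule nn_integral_add) auto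
    also have "\<dots> \<le> ennreal (r n) + ennreal (r n)" by (intro add_mono T_le) auto
    also have "\<dots> = ennreal (2 * r n)" by (simp add: r_def flip: ennreal_plus)
    finally show "(\<integral>\<^sup>+x. T 1 n x + T (-1) n x \<partial>M) \<le> ennreal (2 * r n)" .
  qed
  also have "\<dots> < \<infinity>"
  proof -
    have "summable (\<lambda>n. 2 * r n)"
      unfolding r_def using c by (intro summable_mult summable_geometric) auto
    then have "(\<Sum>n. ennreal (2 * r n)) = ennreal (\<Sum>n. 2 * r n)"
      by (intro suminf_ennreal2) (auto simp: r_def)
    then show ?thesis by simp
  qed
  finally show ?thesis using c(1) by blast
qed

text \<open>With the exponent \<open>c * (e \<bullet> x)\<^sup>2\<close>, \<open>exp_young\<close>
  bounds the second moment by the entropy and the Gaussian moment, one coordinate at a time.\<close>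

lemma T2_dual_second_moment:
  assumes b: "T2_dual b" and g: "integrable M g" "\<And>x. 0 \<le> g x" "integrable M (\<lambda>x. g x * ln (g x))"
  shows "integrable M (\<lambda>x. g x * (norm x)\<^sup>2)"
proof -
  have "integrable M (\<lambda>x. g x * (e \<bullet> x)\<^sup>2)" for e
  proof -
    obtain c where c: "c > 0" "(\<integral>\<^sup>+x. ennreal (exp (c * (e \<bullet> x)\<^sup>2)) \<partial>M) < \<infinity>"
      using T2_dual_gaussian[OF b] by blast
    then have int: "integrable M (\<lambda>x. exp (c * (e \<bullet> x)\<^sup>2))" by (intro integrableI_bounded) auto
    have [measurable]: "g \<in> borel_measurable M" using g(1) by auto
    have "integrable M (\<lambda>x. g x * (c * (e \<bullet> x)\<^sup>2))"
    proof (rule integrable_dominated)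
      show "integrable M (\<lambda>x. g x * ln (g x) - g x + exp (c * (e \<bullet> x)\<^sup>2))" using g int by auto
      show "\<bar>g x * (c * (e \<bullet> x)\<^sup>2)\<bar> \<le> g x * ln (g x) - g x + exp (c * (e \<bullet> x)\<^sup>2)" for x
        using exp_young[OF g(2), of x "c * (e \<bullet> x)\<^sup>2"] g(2)[of x] c by simp
    qed measurable
    then have "integrable M (\<lambda>x. (1 / c) * (g x * (c * (e \<bullet> x)\<^sup>2)))" by (rule integrable_mult_right)
    then show ?thesis using c(1) by simp
  qed
  then have "integrable M (\<lambda>x. \<Sum>e\<in>Basis. g x * (e \<bullet> x)\<^sup>2)" by (intro Bochner_Integration.integrable_sum)
  moreover have "(\<Sum>e\<in>Basis. g x * (e \<bullet> x)\<^sup>2) = g x * (norm x)\<^sup>2" for x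
    by (subst norm_eq_sqrt_inner, subst euclidean_inner)
       (simp add: sum_distrib_left power2_eq_square inner_commute sum_nonneg)
  ultimately show ?thesis by simp
qed

text \<open>This is \<open>exp_young\<close> with the normalised exponent \<open>f - ln Z\<close>,
  integrated.\<close>

lemma donsker_varadhan:
  assumes f: "conc_lip L f" and g: "integrable M g" "\<And>x. 0 \<le> g x" "(\<integral>x. g x \<partial>M) = 1"
    and ent: "integrable M (\<lambda>x. g x * ln (g x))" and gf: "integrable M (\<lambda>x. g x * f x)"
  shows "(\<integral>x. g x * f x \<partial>M) \<le> (\<integral>x. g x * ln (g x) \<partial>M) + ln (\<integral>x. exp (f x) \<partial>M)"
proof -
  define Z where "Z = (\<integral>x. exp (f x) \<partial>M)"
  have Z: "Z > 0" unfolding Z_def by (rule integral_exp_pos[OF f])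
  have "(\<integral>x. g x * f x - ln Z * g x \<partial>M) \<le> (\<integral>x. g x * ln (g x) - g x + exp (f x) / Z \<partial>M)"
  proof (rule integral_mono)
    fix x show "g x * f x - ln Z * g x \<le> g x * ln (g x) - g x + exp (f x) / Z"
      using exp_young[OF g(2), of x "f x - ln Z"] Z by (simp add: exp_diff algebra_simps)
  qed (use g ent gf integrable_exp[OF f] in auto)
  also have "\<dots> = (\<integral>x. g x * ln (g x) \<partial>M)"
    using g ent integrable_exp[OF f] Z by (simp flip: Z_def)
  finally show ?thesis using g gf by (simp add: Z_def)
qed

end

section \<open>Finite duality\<close>

text \<open>Weights are total functions whose values off \<open>J\<close> are left free.\<close>

definition prob_simplex :: "'j set \<Rightarrow> ('j \<Rightarrow> real) set" where
  "prob_simplex J = {p. (\<forall>j\<in>J. 0 \<le> p j) \<and> (\<Sum>j\<in>J. p j) = 1}"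

lemma simplex_mix:
  assumes "p \<in> prob_simplex J" "q \<in> prob_simplex J" "0 \<le> t" "t \<le> 1"
  shows "(\<lambda>j. (1 - t) * p j + t * q j) \<in> prob_simplex J"
  using assms by (auto simp: prob_simplex_def sum.distrib simp flip: sum_distrib_left)

lemma simplex_le_1:
  assumes "p \<in> prob_simplex J" "finite J" "j \<in> J"
  shows "0 \<le> p j" "p j \<le> 1"
  using assms member_le_sum[of j J p] by (auto simp: prob_simplex_def)

lemma simplex_average:
  assumes "finite Y" "\<And>y. y \<in> Y \<Longrightarrow> 0 \<le> m y" "(\<Sum>y\<in>Y. m y) = 1" "\<And>y. y \<in> Y \<Longrightarrow> q y \<in> prob_simplex J"
  shows "(\<lambda>j. \<Sum>y\<in>Y. m y * q y j) \<in> prob_simplex J"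
proof -
  have "(\<Sum>j\<in>J. \<Sum>y\<in>Y. m y * q y j) = (\<Sum>y\<in>Y. m y * (\<Sum>j\<in>J. q y j))"
    unfolding sum_distrib_left by (rule sum.swap)
  also have "\<dots> = (\<Sum>y\<in>Y. m y)" using assms(4) by (intro sum.cong) (auto simp: prob_simplex_def)
  finally show ?thesis using assms by (auto simp: prob_simplex_def intro!: sum_nonneg)
qed

lemma simplex_ne: "finite J \<Longrightarrow> J \<noteq> {} \<Longrightarrow> prob_simplex J \<noteq> {}"
proof -
  assume J: "finite J" "J \<noteq> {}"
  then have "(\<lambda>_. 1 / real (card J)) \<in> prob_simplex J" by (simp add: prob_simplex_def)
  then show ?thesis by blast
qed

lemma simplex_linear_le:
  assumes "finite J" "p \<in> prob_simplex J"
  shows "(\<Sum>j\<in>J. \<beta> j * p j) \<le> (\<Sum>j\<in>J. \<bar>\<beta> j\<bar>)"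
proof (rule sum_mono)
  fix j assume "j \<in> J"
  with simplex_le_1[OF assms(2,1)] have p: "0 \<le> p j" "p j \<le> 1" by auto
  have "\<beta> j * p j \<le> \<bar>\<beta> j\<bar> * p j" using p by (intro mult_right_mono) auto
  also have "\<dots> \<le> \<bar>\<beta> j\<bar> * 1" using p by (intro mult_left_mono) auto
  finally show "\<beta> j * p j \<le> \<bar>\<beta> j\<bar>" by simp
qed

text \<open>Existence of multipliers by penalisation: at an almost minimiser of \<open>C q + |a q - w|^2 / (2 \<eta>)\<close> the
  derivative of the penalty provides \<open>\<beta> = (w - a q) / \<eta>\<close>, and the small violation of the constraint
  \<open>a q = w\<close> is repaired by a convex combination because \<open>w\<close> is positive.\<close>

lemma finite_penalty_duality:
  fixes m :: "'y \<Rightarrow> real" and w :: "'j \<Rightarrow> real" and c :: "'y \<Rightarrow> ('j \<Rightarrow> real) \<Rightarrow> real"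
  assumes fin: "finite Y" "finite J" "J \<noteq> {}"
    and m: "\<And>y. y \<in> Y \<Longrightarrow> 0 \<le> m y" "(\<Sum>y\<in>Y. m y) = 1"
    and w: "\<And>j. j \<in> J \<Longrightarrow> 0 < w j" "(\<Sum>j\<in>J. w j) = 1"
    and conv: "\<And>y p q t. y \<in> Y \<Longrightarrow> p \<in> prob_simplex J \<Longrightarrow> q \<in> prob_simplex J \<Longrightarrow> 0 \<le> t \<Longrightarrow> t \<le> 1 \<Longrightarrow>
        c y (\<lambda>j. (1 - t) * p j + t * q j) \<le> (1 - t) * c y p + t * c y q"
    and bnd: "\<And>y p. y \<in> Y \<Longrightarrow> p \<in> prob_simplex J \<Longrightarrow> 0 \<le> c y p \<and> c y p \<le> B"
    and dual: "\<And>\<beta> e. e > 0 \<Longrightarrow> \<exists>q. (\<forall>y\<in>Y. q y \<in> prob_simplex J) \<and>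
        (\<Sum>y\<in>Y. m y * (c y (q y) - (\<Sum>j\<in>J. \<beta> j * q y j))) + (\<Sum>j\<in>J. \<beta> j * w j) \<le> K + e"
    and e: "e > 0"
  shows "\<exists>q. (\<forall>y\<in>Y. q y \<in> prob_simplex J) \<and> (\<forall>j\<in>J. (\<Sum>y\<in>Y. m y * q y j) = w j) \<and>
    (\<Sum>y\<in>Y. m y * c y (q y)) \<le> K + e"
proof -
  define a where "a q j = (\<Sum>y\<in>Y. m y * q y j)" for q :: "'y \<Rightarrow> 'j \<Rightarrow> real" and j
  define C where "C q = (\<Sum>y\<in>Y. m y * c y (q y))" for q
  define S where "S q = (\<Sum>j\<in>J. (a q j - w j)\<^sup>2)" for q
  define Q where "Q = {q :: 'y \<Rightarrow> 'j \<Rightarrow> real. \<forall>y\<in>Y. q y \<in> prob_simplex J}"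
  define mix where "mix t q r = (\<lambda>y j. (1 - t) * q y j + t * r y j)" for t :: real and q r :: "'y \<Rightarrow> 'j \<Rightarrow> real"
  have wJ: "w \<in> prob_simplex J" using w by (auto simp: prob_simplex_def less_imp_le)
  have C: "0 \<le> C q" "C q \<le> B" if "q \<in> Q" for q
  proof -
    show "0 \<le> C q" using that bnd m by (auto simp: C_def Q_def intro!: sum_nonneg mult_nonneg_nonneg)
    have "C q \<le> (\<Sum>y\<in>Y. m y * B)"
      unfolding C_def using that bnd m by (intro sum_mono mult_left_mono) (auto simp: Q_def)
    then show "C q \<le> B" using m by (simp flip: sum_distrib_right)
  qed
  have aQ: "a q \<in> prob_simplex J" if "q \<in> Q" for q
    unfolding a_def[abs_def] using that m fin by (intro simplex_average) (auto simp: Q_def)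
  have mixQ: "mix t q r \<in> Q" if "q \<in> Q" "r \<in> Q" "0 \<le> t" "t \<le> 1" for q r t
    using that simplex_mix[of "q y" J "r y" t for y] by (auto simp: Q_def mix_def)
  have Cmix: "C (mix t q r) \<le> (1 - t) * C q + t * C r" if "q \<in> Q" "r \<in> Q" "0 \<le> t" "t \<le> 1" for q r t
  proof -
    have "C (mix t q r) \<le> (\<Sum>y\<in>Y. m y * ((1 - t) * c y (q y) + t * c y (r y)))"
      unfolding C_def mix_def using that conv m by (intro sum_mono mult_left_mono) (auto simp: Q_def)
    also have "\<dots> = (1 - t) * C q + t * C r"
      by (simp add: C_def sum_distrib_left sum.distrib[symmetric] algebra_simps)
    finally show ?thesis .
  qed
  have amix: "a (mix t q r) j = (1 - t) * a q j + t * a r j" for t q r j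
    by (simp add: a_def mix_def sum_distrib_left sum.distrib[symmetric] algebra_simps)
  have S0: "0 \<le> S q" for q by (auto simp: S_def intro: sum_nonneg)
  define n where "n = real (card J)"
  have n0: "n > 0" using fin by (simp add: n_def card_gt_0_iff)
  have Smix: "S (mix t q r) \<le> S q + 2 * t * (\<Sum>j\<in>J. (a q j - w j) * (a r j - a q j)) + t\<^sup>2 * n"
    if "q \<in> Q" "r \<in> Q" for t q r
  proof -
    have "S (mix t q r) = (\<Sum>j\<in>J. (a q j - w j)\<^sup>2 + 2 * t * ((a q j - w j) * (a r j - a q j)) + t\<^sup>2 * (a r j - a q j)\<^sup>2)"
      unfolding S_def amix by (intro sum.cong refl) (simp add: power2_eq_square algebra_simps)
    also have "\<dots> \<le> (\<Sum>j\<in>J. (a q j - w j)\<^sup>2 + 2 * t * ((a q j - w j) * (a r j - a q j)) + t\<^sup>2 * 1)"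
    proof (intro sum_mono add_left_mono mult_left_mono)
      fix j assume "j \<in> J"
      then have "\<bar>a r j - a q j\<bar> \<le> 1"
        using simplex_le_1[OF aQ[OF that(1)] fin(2)] simplex_le_1[OF aQ[OF that(2)] fin(2)]
        by (smt (verit))
      then show "(a r j - a q j)\<^sup>2 \<le> 1" by (simp add: abs_square_le_1)
    qed simp
    also have "\<dots> = S q + 2 * t * (\<Sum>j\<in>J. (a q j - w j) * (a r j - a q j)) + t\<^sup>2 * n"
      by (simp add: S_def sum.distrib sum_distrib_left n_def)
    finally show ?thesis .
  qed
  \<comment> \<open>First-order optimality of an almost minimiser q against its mixture with r. The
    penalty carries \<open>1 / (2 * \<eta>)\<close>, and differentiating the square doubles this to
    \<open>1 / \<eta>\<close>.\<close>
  have near: "\<exists>q\<in>Q. C q + S q / \<eta> \<le> K + d" if \<eta>: "\<eta> > 0" and d: "d > 0" for \<eta> d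
  proof -
    \<comment> \<open>The step length is fixed first, so small that the second-order term
      \<open>t * n / (2 * \<eta>)\<close> is at most \<open>d / 3\<close>. The tolerance of the
      almost minimiser is then \<open>t * (d / 3)\<close>, so that division by t leaves only
      \<open>d / 3\<close>.\<close>
    define t where "t = min 1 (2 * \<eta> * (d / 3) / n)"
    have t: "0 < t" "t \<le> 1" using \<eta> d n0 by (auto simp: t_def)
    have "t \<le> 2 * \<eta> * (d / 3) / n" by (simp add: t_def)
    then have tn: "t * n / (2 * \<eta>) \<le> d / 3" using \<eta> n0 by (simp add: field_simps)
    define F where "F q = C q + S q / (2 * \<eta>)" for q
    have F0: "0 \<le> F q" if "q \<in> Q" for q using C[OF that] S0[of q] \<eta> by (simp add: F_def)
    have ne: "F ` Q \<noteq> {}" using wJ by (auto simp: Q_def)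
    have bdd: "bdd_below (F ` Q)" using F0 by (intro bdd_belowI2[of _ 0])
    have "Inf (F ` Q) < Inf (F ` Q) + t * (d / 3)" using t d by simp
    then obtain q where q: "q \<in> Q" "F q < Inf (F ` Q) + t * (d / 3)"
      using cInf_lessD[OF ne] by blast
    have Fq: "F q \<le> F r + t * (d / 3)" if "r \<in> Q" for r
      using q(2) cInf_lower[OF imageI[OF that] bdd] by linarith
    define \<beta> where "\<beta> j = (w j - a q j) / \<eta>" for j
    obtain r where r: "\<forall>y\<in>Y. r y \<in> prob_simplex J"
      "(\<Sum>y\<in>Y. m y * (c y (r y) - (\<Sum>j\<in>J. \<beta> j * r y j))) + (\<Sum>j\<in>J. \<beta> j * w j) \<le> K + d / 3"
      using dual[of "d / 3" \<beta>] d by auto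
    have rQ: "r \<in> Q" using r(1) by (simp add: Q_def)
    have "(\<Sum>y\<in>Y. m y * (c y (r y) - (\<Sum>j\<in>J. \<beta> j * r y j))) = C r - (\<Sum>j\<in>J. \<beta> j * a r j)"
    proof -
      have "(\<Sum>y\<in>Y. m y * (\<Sum>j\<in>J. \<beta> j * r y j)) = (\<Sum>j\<in>J. \<beta> j * a r j)"
        unfolding a_def sum_distrib_left by (subst sum.swap) (simp add: mult_ac)
      then show ?thesis by (simp add: C_def right_diff_distrib sum_subtractf)
    qed
    with r(2) have r2: "C r - (\<Sum>j\<in>J. \<beta> j * a r j) + (\<Sum>j\<in>J. \<beta> j * w j) \<le> K + d / 3" by simp
    define X where "X = (\<Sum>j\<in>J. (a q j - w j) * (a r j - a q j))"
    have "X = (\<Sum>j\<in>J. - (\<eta> * \<beta> j * a r j) + \<eta> * \<beta> j * w j - (a q j - w j)\<^sup>2)"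
    proof -
      have eb: "\<eta> * \<beta> j = w j - a q j" for j using \<eta> by (simp add: \<beta>_def)
      show ?thesis
        unfolding X_def eb by (intro sum.cong refl) (simp add: power2_eq_square algebra_simps)
    qed
    also have "\<dots> = \<eta> * (- (\<Sum>j\<in>J. \<beta> j * a r j) + (\<Sum>j\<in>J. \<beta> j * w j)) - S q"
      by (simp add: sum.distrib sum_subtractf sum_negf S_def sum_distrib_left algebra_simps)
    finally have X: "X / \<eta> = - (\<Sum>j\<in>J. \<beta> j * a r j) + (\<Sum>j\<in>J. \<beta> j * w j) - S q / \<eta>"
      using \<eta> by (simp add: diff_divide_distrib)
    have "F q \<le> F (mix t q r) + t * (d / 3)" using Fq[OF mixQ[OF q(1) rQ]] t by simp
    also have "F (mix t q r) \<le> ((1 - t) * C q + t * C r) + (S q + 2 * t * X + t\<^sup>2 * n) / (2 * \<eta>)"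
      unfolding F_def X_def using Cmix[OF q(1) rQ] Smix[OF q(1) rQ] t \<eta>
      by (intro add_mono divide_right_mono) auto
    also have "(S q + 2 * t * X + t\<^sup>2 * n) / (2 * \<eta>) = S q / (2 * \<eta>) + t * (X / \<eta>) + t * (t * n / (2 * \<eta>))"
      using \<eta> by (simp add: add_divide_distrib power2_eq_square)
    also have "t * (t * n / (2 * \<eta>)) \<le> t * (d / 3)" using tn t by (intro mult_left_mono) auto
    finally have "t * C q \<le> t * (C r + X / \<eta> + d / 3 + d / 3)"
      unfolding F_def by (simp add: algebra_simps)
    then have "C q \<le> C r + X / \<eta> + d / 3 + d / 3" using t by simp
    with r2 X have "C q + S q / \<eta> \<le> K + d" by simp
    with q(1) show ?thesis by blast
  qed
  have K: "K \<ge> 0"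
  proof (rule field_le_epsilon)
    fix d :: real assume "d > 0"
    then obtain q where "q \<in> Q" "C q + S q / 1 \<le> K + d" using near[of 1 d] by auto
    with C[of q] S0[of q] show "0 \<le> K + d" by simp
  qed
  have B: "B \<ge> 0" using C[of "\<lambda>_. w"] wJ by (force simp: Q_def)
  \<comment> \<open>The share of the repairing kernel in the final mixture; its cost is at most
    \<open>th * B \<le> e / 2\<close>.\<close>
  define th where "th = min (1 / 2) (e / (2 * (B + 1)))"
  have th: "0 < th" "th < 1" "th * B \<le> e / 2"
  proof -
    show "0 < th" "th < 1" using e B by (auto simp: th_def)
    have "th * B \<le> e / (2 * (B + 1)) * B" using B by (intro mult_right_mono) (auto simp: th_def)
    also have "\<dots> \<le> e / 2" using e B by (simp add: field_simps)
    finally show "th * B \<le> e / 2" .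
  qed
  define wm where "wm = Min (w ` J)"
  have wm: "wm > 0" "\<And>j. j \<in> J \<Longrightarrow> wm \<le> w j" using fin w by (auto simp: wm_def)
  \<comment> \<open>Small enough that the violation, bounded through
    \<open>S q / \<eta> \<le> K + e / 2\<close>, is at most \<open>th * wm\<close> in each
    coordinate.\<close>
  define \<eta> where "\<eta> = (th * wm)\<^sup>2 / (K + e / 2)"
  have \<eta>: "\<eta> > 0" using th wm K e by (simp add: \<eta>_def)
  obtain q where q: "q \<in> Q" "C q + S q / \<eta> \<le> K + e / 2" using near[OF \<eta>, of "e / 2"] e by auto
  have "S q / \<eta> \<le> K + e / 2" using q C[OF q(1)] by simp
  then have "S q \<le> (K + e / 2) * \<eta>" using \<eta> by (simp add: pos_divide_le_eq)
  also have "\<dots> = (th * wm)\<^sup>2" using K e by (simp add: \<eta>_def)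
  finally have Sq: "S q \<le> (th * wm)\<^sup>2" .
  have aq: "a q j - w j \<le> th * w j" if "j \<in> J" for j
  proof -
    have "(a q j - w j)\<^sup>2 \<le> S q" unfolding S_def using that fin by (intro member_le_sum) auto
    with Sq have "\<bar>a q j - w j\<bar> \<le> th * wm" using th wm by (metis abs_le_square_iff abs_of_pos mult_pos_pos order_trans)
    also have "th * wm \<le> th * w j" using th wm that by (intro mult_left_mono) auto
    finally show ?thesis by simp
  qed
  \<comment> \<open>Solves \<open>(1 - th) * a q j + th * r j = w j\<close>. It is nonnegative
    because \<open>a q j \<le> (1 + th) * w j\<close> and
    \<open>(1 - th) * (1 + th) \<le> 1\<close>.\<close>
  define r where "r j = (w j - (1 - th) * a q j) / th" for j
  have "r \<in> prob_simplex J"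
  proof -
    have "0 \<le> w j - (1 - th) * a q j" if "j \<in> J" for j
    proof -
      have "(1 - th) * a q j \<le> (1 - th) * ((1 + th) * w j)"
        using aq[OF that] th by (intro mult_left_mono) (auto simp: algebra_simps)
      also have "\<dots> = w j - th\<^sup>2 * w j" by (simp add: power2_eq_square algebra_simps)
      finally show ?thesis using w(1)[OF that] by (smt (verit) mult_nonneg_nonneg zero_le_power2)
    qed
    moreover have "(\<Sum>j\<in>J. r j) = ((\<Sum>j\<in>J. w j) - (1 - th) * (\<Sum>j\<in>J. a q j)) / th"
      by (simp add: r_def sum_divide_distrib[symmetric] sum_subtractf sum_distrib_left)
    then have "(\<Sum>j\<in>J. r j) = 1" using w aQ[OF q(1)] th by (simp add: prob_simplex_def)
    ultimately show ?thesis using th by (auto simp: prob_simplex_def r_def)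
  qed
  then have rQ: "(\<lambda>_. r) \<in> Q" by (simp add: Q_def)
  have "a (\<lambda>_. r) j = r j" for j using m by (simp add: a_def flip: sum_distrib_right)
  then have "a (mix th q (\<lambda>_. r)) j = w j" for j
    unfolding amix using th by (simp add: r_def)
  moreover have "C (mix th q (\<lambda>_. r)) \<le> K + e"
  proof -
    have "C (mix th q (\<lambda>_. r)) \<le> (1 - th) * C q + th * C (\<lambda>_. r)"
      using th by (intro Cmix q rQ) auto
    also have "\<dots> \<le> 1 * C q + th * B"
      using th C[OF q(1)] C[OF rQ] by (intro add_mono mult_right_mono mult_left_mono) auto
    also have "\<dots> \<le> K + e" using q(2) S0[of q] \<eta> th by (smt (verit) divide_nonneg_pos field_sum_of_halves)
    finally show ?thesis .
  qed
  moreover have "mix th q (\<lambda>_. r) \<in> Q" using th by (intro mixQ q rQ) auto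
  ultimately show ?thesis by (auto simp: Q_def a_def C_def intro!: exI[of _ "mix th q (\<lambda>_. r)"])
qed

text \<open>The left-hand side is the Huber function of w, quadratic up to \<open>s * L\<close> and
  linear with slope L beyond. It is nondecreasing and the infimum-convolution of
  \<open>L * r\<close> and \<open>u\<^sup>2 / (2 * s)\<close>, whence the bound whenever
  \<open>w \<le> r + u\<close>.\<close>

lemma huber_ineq:
  fixes s L r u w :: real
  assumes "s > 0" "L \<ge> 0" "r \<ge> 0" "u \<ge> 0" "w \<ge> 0" "w \<le> r + u"
  shows "w\<^sup>2 / (2 * s) - (max 0 (w - s * L))\<^sup>2 / (2 * s) \<le> L * r + u\<^sup>2 / (2 * s)"
proof -
  have "w\<^sup>2 - (max 0 (w - s * L))\<^sup>2 \<le> 2 * s * L * r + u\<^sup>2"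
  proof (cases "w \<le> r")
    case True
    have "w\<^sup>2 - (max 0 (w - s * L))\<^sup>2 \<le> 2 * s * L * w"
    proof (cases "w \<le> s * L")
      case True
      then have "w * w \<le> w * (s * L)" using assms by (intro mult_left_mono) auto
      moreover have "0 \<le> w * (s * L)" using assms by simp
      ultimately show ?thesis using True by (simp add: power2_eq_square max_def algebra_simps)
    next
      case False
      have "0 \<le> (s * L)\<^sup>2" by simp
      with False show ?thesis by (simp add: power2_eq_square max_def algebra_simps)
    qed
    also have "\<dots> \<le> 2 * s * L * r" using True assms by (intro mult_left_mono) auto
    finally show ?thesis by (simp add: add_increasing2)
  next
    case False
    then have "(w - r)\<^sup>2 \<le> u\<^sup>2" using assms by (intro power_mono) auto
    moreover have "w\<^sup>2 - (max 0 (w - s * L))\<^sup>2 \<le> 2 * s * L * r + (w - r)\<^sup>2"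
    proof (cases "w \<le> s * L")
      case True
      have "0 \<le> 2 * r * (s * L - w) + r\<^sup>2" using assms True by simp
      then show ?thesis using True by (simp add: power2_eq_square max_def algebra_simps)
    next
      case False
      have "0 \<le> (r - (w - s * L))\<^sup>2" by simp
      with False show ?thesis by (simp add: power2_eq_square max_def algebra_simps)
    qed
    ultimately show ?thesis by simp
  qed
  then have "(w\<^sup>2 - (max 0 (w - s * L))\<^sup>2) / (2 * s) \<le> (2 * s * L * r + u\<^sup>2) / (2 * s)"
    using assms by (intro divide_right_mono) auto
  then show ?thesis using assms by (simp add: diff_divide_distrib add_divide_distrib)
qed

section \<open>Lipschitz envelopes of multipliers\<close>

context norm_fun
begin

definition bary :: "'j set \<Rightarrow> ('j \<Rightarrow> 'a) \<Rightarrow> ('j \<Rightarrow> real) \<Rightarrow> 'a" where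
  "bary J z p = (\<Sum>j\<in>J. p j *\<^sub>R z j)"

lemma bary_mix: "bary J z (\<lambda>j. (1 - t) * p j + t * q j) = (1 - t) *\<^sub>R bary J z p + t *\<^sub>R bary J z q"
  by (simp add: bary_def scaleR_sum_right sum.distrib[symmetric] scaleR_left_distrib)

lemma N_bary_le:
  assumes "finite J" "p \<in> prob_simplex J"
  shows "N (bary J z p) \<le> (\<Sum>j\<in>J. N (z j))"
proof -
  have "N (bary J z p) \<le> (\<Sum>j\<in>J. N (p j *\<^sub>R z j))" unfolding bary_def by (rule N_sum[OF assms(1)])
  also have "\<dots> \<le> (\<Sum>j\<in>J. 1 * N (z j))"
    unfolding N_scaleR using simplex_le_1[OF assms(2,1)] by (intro sum_mono mult_right_mono) auto
  finally show ?thesis by simp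
qed

text \<open>At \<open>z j\<close> this concave Lipschitz function dominates \<open>\<beta> j\<close>, and in its sup-convolution \<open>N^2 / (2 s)\<close>
  is replaced by the Huber function, which falls short of it by \<open>(N - s L)_+^2 / (2 s)\<close>.\<close>

definition simplex_env :: "'j set \<Rightarrow> ('j \<Rightarrow> 'a) \<Rightarrow> ('j \<Rightarrow> real) \<Rightarrow> real \<Rightarrow> 'a \<Rightarrow> real" where
  "simplex_env J z \<beta> L x = (SUP p\<in>prob_simplex J. (\<Sum>j\<in>J. \<beta> j * p j) - L * N (x - bary J z p))"

lemma simplex_env_ge:
  assumes "finite J" "L \<ge> 0" "p \<in> prob_simplex J"
  shows "(\<Sum>j\<in>J. \<beta> j * p j) - L * N (x - bary J z p) \<le> simplex_env J z \<beta> L x"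
  unfolding simplex_env_def
proof (rule cSUP_upper[OF assms(3)], rule bdd_aboveI2)
  fix q assume "q \<in> prob_simplex J"
  then show "(\<Sum>j\<in>J. \<beta> j * q j) - L * N (x - bary J z q) \<le> (\<Sum>j\<in>J. \<bar>\<beta> j\<bar>)"
    using simplex_linear_le[OF assms(1), of q \<beta>] assms(2) by (smt (verit) N_nonneg mult_nonneg_nonneg)
qed

lemma simplex_env_le:
  assumes "finite J" "J \<noteq> {}"
    "\<And>p. p \<in> prob_simplex J \<Longrightarrow> (\<Sum>j\<in>J. \<beta> j * p j) - L * N (x - bary J z p) \<le> c"
  shows "simplex_env J z \<beta> L x \<le> c"
  unfolding simplex_env_def using assms by (intro cSUP_least simplex_ne) auto

text \<open>A partial supremum of a jointly concave function of x and p. No maximising weights are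
  at hand, so p and q are eliminated one after the other through least upper bounds.\<close>

lemma conc_lip_simplex_env:
  assumes J: "finite J" "J \<noteq> {}" and L: "L \<ge> 0"
  shows "conc_lip L (simplex_env J z \<beta> L)"
proof -
  define f where "f = simplex_env J z \<beta> L"
  define v where "v x p = (\<Sum>j\<in>J. \<beta> j * p j) - L * N (x - bary J z p)" for x p
  have ge: "v x p \<le> f x" if "p \<in> prob_simplex J" for x p
    unfolding f_def v_def by (rule simplex_env_ge[OF J(1) L that])
  have le: "f x \<le> c" if "\<And>p. p \<in> prob_simplex J \<Longrightarrow> v x p \<le> c" for x c
    unfolding f_def using that by (intro simplex_env_le[OF J]) (simp add: v_def)
  have lip: "f x \<le> f y + L * N (x - y)" for x y
  proof (rule le)
    fix p assume "p \<in> prob_simplex J"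
    moreover have "L * N (y - bary J z p) \<le> L * (N (x - y) + N (x - bary J z p))"
      using L N_triangle_diff[of y "bary J z p" x] by (intro mult_left_mono) (auto simp: N_commute)
    ultimately show "v x p \<le> f y + L * N (x - y)" using ge[of p y] by (simp add: v_def algebra_simps)
  qed
  have "conc_lip L f"
  proof (rule conc_lipI[OF _ lip])
    show "f x \<le> (\<Sum>j\<in>J. \<bar>\<beta> j\<bar>)" for x
    proof (rule le)
      fix p assume "p \<in> prob_simplex J"
      then show "v x p \<le> (\<Sum>j\<in>J. \<bar>\<beta> j\<bar>)"
        using simplex_linear_le[OF J(1), of p \<beta>] L unfolding v_def by (smt (verit) N_nonneg mult_nonneg_nonneg)
    qed
    fix t x y assume t: "0 < t" "t < (1::real)"
    define F where "F = f ((1 - t) *\<^sub>R x + t *\<^sub>R y)"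
    have *: "(1 - t) * v x p + t * v y q \<le> F" if p: "p \<in> prob_simplex J" and q: "q \<in> prob_simplex J" for p q
    proof -
      define r where "r j = (1 - t) * p j + t * q j" for j
      have r: "r \<in> prob_simplex J" using simplex_mix[OF p q, of t] t by (simp add: r_def[abs_def])
      have "(1 - t) *\<^sub>R x + t *\<^sub>R y - bary J z r = (1 - t) *\<^sub>R (x - bary J z p) + t *\<^sub>R (y - bary J z q)"
        unfolding r_def[abs_def] bary_mix by (simp add: algebra_simps)
      then have "N ((1 - t) *\<^sub>R x + t *\<^sub>R y - bary J z r) \<le> (1 - t) * N (x - bary J z p) + t * N (y - bary J z q)"
        using N_triangle[of "(1 - t) *\<^sub>R (x - bary J z p)" "t *\<^sub>R (y - bary J z q)"] t by simp
      then have "L * N ((1 - t) *\<^sub>R x + t *\<^sub>R y - bary J z r)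
          \<le> L * ((1 - t) * N (x - bary J z p) + t * N (y - bary J z q))" using L by (rule mult_left_mono)
      moreover have "(\<Sum>j\<in>J. \<beta> j * r j) = (1 - t) * (\<Sum>j\<in>J. \<beta> j * p j) + t * (\<Sum>j\<in>J. \<beta> j * q j)"
        by (simp add: r_def sum_distrib_left sum.distrib[symmetric] algebra_simps)
      ultimately have "(1 - t) * v x p + t * v y q \<le> v ((1 - t) *\<^sub>R x + t *\<^sub>R y) r"
        by (simp add: v_def algebra_simps)
      also have "\<dots> \<le> F" unfolding F_def by (rule ge[OF r])
      finally show ?thesis .
    qed
    have "(1 - t) * f x \<le> F - t * v y q" if q: "q \<in> prob_simplex J" for q
    proof -
      have "f x \<le> (F - t * v y q) / (1 - t)"
        using *[OF _ q] t by (intro le) (simp add: field_simps)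
      then show ?thesis using t by (simp add: field_simps)
    qed
    then have "f y \<le> (F - (1 - t) * f x) / t"
      using t by (intro le) (simp add: field_simps)
    then show "(1 - t) * f x + t * f y \<le> f ((1 - t) *\<^sub>R x + t *\<^sub>R y)"
      using t unfolding F_def[symmetric] by (simp add: field_simps)
  qed
  then show ?thesis by (simp add: f_def)
qed

lemma simplex_env_vertex:
  assumes "finite J" "L \<ge> 0" "j \<in> J"
  shows "\<beta> j \<le> simplex_env J z \<beta> L (z j)"
proof -
  define p where "p i = (if i = j then 1 else 0 :: real)" for i
  have "p \<in> prob_simplex J" using assms by (simp add: p_def prob_simplex_def)
  moreover have "(\<Sum>i\<in>J. \<beta> i * p i) = \<beta> j"
    using assms by (simp add: p_def if_distrib[of "\<lambda>x. _ * x"] sum.delta cong: if_cong)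
  moreover have "bary J z p = z j"
    using assms by (simp add: bary_def p_def if_distrib[of "\<lambda>x. x *\<^sub>R _"] sum.delta cong: if_cong)
  ultimately show ?thesis using simplex_env_ge[OF assms(1,2), of p \<beta> "z j" z] by simp
qed

text \<open>The bound \<open>V\<close> belongs to the true quadratic cost. The correction is the
  Huber defect at a distance that no barycentre exceeds, and it vanishes as soon as
  \<open>s * L\<close> reaches this distance.\<close>

lemma sup_conv_simplex_env_le:
  assumes J: "finite J" "J \<noteq> {}" and L: "L \<ge> 0" and s: "s > 0"
    and le: "\<And>p. p \<in> prob_simplex J \<Longrightarrow> (\<Sum>j\<in>J. \<beta> j * p j) - (N (x - bary J z p))\<^sup>2 / (2 * s) \<le> V"
  shows "sup_conv s (simplex_env J z \<beta> L) x
    \<le> V + (max 0 (N x + (\<Sum>j\<in>J. N (z j)) - s * L))\<^sup>2 / (2 * s)" (is "_ \<le> V + ?T")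
proof (rule sup_conv_le)
  fix y
  have "simplex_env J z \<beta> L y \<le> V + ?T + 1 / (2 * s) * (N (x - y))\<^sup>2"
  proof (rule simplex_env_le[OF J])
    fix p assume p: "p \<in> prob_simplex J"
    define w where "w = N (x - bary J z p)"
    have "w \<le> N x + N (bary J z p)" using N_triangle[of x "- bary J z p"] by (simp add: w_def)
    with N_bary_le[OF J(1) p, of z] have w: "w \<le> N x + (\<Sum>j\<in>J. N (z j))" by simp
    have "(max 0 (w - s * L))\<^sup>2 / (2 * s) \<le> ?T" using w s by (intro divide_right_mono power_mono) auto
    moreover have "w\<^sup>2 / (2 * s) - (max 0 (w - s * L))\<^sup>2 / (2 * s)
        \<le> L * N (y - bary J z p) + (N (x - y))\<^sup>2 / (2 * s)"
      using N_triangle_diff[of x "bary J z p" y] by (intro huber_ineq s L) (auto simp: w_def)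
    ultimately show "(\<Sum>j\<in>J. \<beta> j * p j) - L * N (y - bary J z p) \<le> V + ?T + 1 / (2 * s) * (N (x - y))\<^sup>2"
      using le[OF p] by (simp add: w_def)
  qed
  then show "simplex_env J z \<beta> L y - 1 / (2 * s) * (N (x - y))\<^sup>2 \<le> V + ?T" by simp
qed

end

section \<open>Approximation by finite transport problems\<close>

context norm_prob
begin

lemma integral_simple_function:
  fixes s :: "'a \<Rightarrow> 'b" and h :: "'b \<Rightarrow> real"
  assumes s: "simple_function M s"
  shows "integrable M (\<lambda>x. h (s x))"
    and "(\<integral>x. h (s x) \<partial>M) = (\<Sum>y\<in>range s. measure M (s -` {y}) * h y)"
proof -
  have fin: "finite (range s)" and meas: "s -` {y} \<in> sets M" for y
    using simple_functionD[OF s] by auto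
  have eq: "h (s x) = (\<Sum>y\<in>range s. h y * indicator (s -` {y}) x)" for x
    using fin by (simp add: indicator_def if_distrib sum.delta' cong: if_cong)
  show "integrable M (\<lambda>x. h (s x))"
    unfolding eq using meas by (intro Bochner_Integration.integrable_sum integrable_mult_right) (auto simp: less_top[symmetric])
  show "(\<integral>x. h (s x) \<partial>M) = (\<Sum>y\<in>range s. measure M (s -` {y}) * h y)"
    unfolding eq using meas
    by (subst Bochner_Integration.integral_sum) (auto simp: less_top[symmetric] mult.commute)
qed

lemma second_moment_affine:
  assumes "integrable M (\<lambda>x. (norm x)\<^sup>2)"
  shows "integrable M (\<lambda>x. (a * norm x + c)\<^sup>2)"
proof -
  have "(a * norm x + c)\<^sup>2 = a\<^sup>2 * (norm x)\<^sup>2 + 2 * a * c * norm x + c\<^sup>2" for x :: 'a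
    by (simp add: power2_eq_square algebra_simps)
  moreover have "integrable M (\<lambda>x. a\<^sup>2 * (norm x)\<^sup>2 + 2 * a * c * norm x + c\<^sup>2)"
    using assms integrable_norm
    by (intro Bochner_Integration.integrable_add integrable_mult_right) auto
  ultimately show ?thesis by presburger
qed

text \<open>Simple approximants with norm at most \<open>2 * norm x\<close> converge in mean square
  by dominated convergence, with majorant \<open>(3 * norm x)\<^sup>2\<close>.\<close>

lemma quantization:
  assumes m2: "integrable M (\<lambda>x. (norm x)\<^sup>2)" and e: "e > 0"
  obtains s where "simple_function M s" "integrable M (\<lambda>x. (norm (x - s x))\<^sup>2)"
    "(\<integral>x. (norm (x - s x))\<^sup>2 \<partial>M) < e"
proof -
  have "(\<lambda>x. x) \<in> borel_measurable M" by simp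
  from borel_measurable_implies_sequence_metric[OF this, of 0]
  obtain F where F: "\<And>i. simple_function M (F i)" "\<And>x. (\<lambda>i. F i x) \<longlonglongrightarrow> x"
    "\<And>i x. dist (F i x) 0 \<le> 2 * dist x 0" by auto
  have [measurable]: "F i \<in> borel_measurable M" for i by (rule borel_measurable_simple_function[OF F(1)])
  have bound: "(norm (x - F i x))\<^sup>2 \<le> (3 * norm x + 0)\<^sup>2" for i x
    using F(3)[of i x, unfolded dist_0_norm] norm_triangle_ineq4[of x "F i x"]
    by (intro power_mono) auto
  have w: "integrable M (\<lambda>x. (3 * norm x + 0)\<^sup>2)" by (rule second_moment_affine[OF m2])
  have "(\<lambda>i. \<integral>x. (norm (x - F i x))\<^sup>2 \<partial>M) \<longlonglongrightarrow> (\<integral>x. 0 \<partial>M)"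
  proof (rule integral_dominated_convergence[OF _ _ w])
    show "AE x in M. (\<lambda>i. (norm (x - F i x))\<^sup>2) \<longlonglongrightarrow> 0"
    proof (rule AE_I2)
      fix x
      have "(\<lambda>i. (norm (x - F i x))\<^sup>2) \<longlonglongrightarrow> (norm (x - x))\<^sup>2" by (intro tendsto_intros F)
      then show "(\<lambda>i. (norm (x - F i x))\<^sup>2) \<longlonglongrightarrow> 0" by simp
    qed
  qed (use bound in auto)
  then have "\<forall>\<^sub>F i in sequentially. (\<integral>x. (norm (x - F i x))\<^sup>2 \<partial>M) < e"
    using e by (intro order_tendstoD(2)) auto
  then obtain i where i: "(\<integral>x. (norm (x - F i x))\<^sup>2 \<partial>M) < e" by (auto dest: eventually_happens)
  have "integrable M (\<lambda>x. (norm (x - F i x))\<^sup>2)"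
    using bound by (intro integrable_dominated[OF w]) auto
  with F(1) i show ?thesis by (intro that)
qed

lemma integral_N_sq_le:
  fixes f :: "'a \<Rightarrow> 'a"
  assumes C: "\<And>x. N x \<le> C * norm x" and [measurable]: "f \<in> borel_measurable M"
    and f: "integrable M (\<lambda>x. (norm (f x))\<^sup>2)"
  shows "integrable M (\<lambda>x. (N (f x))\<^sup>2)" "(\<integral>x. (N (f x))\<^sup>2 \<partial>M) \<le> C\<^sup>2 * (\<integral>x. (norm (f x))\<^sup>2 \<partial>M)"
proof -
  have bound: "(N (f x))\<^sup>2 \<le> C\<^sup>2 * (norm (f x))\<^sup>2" for x
    using power_mono[OF C[of "f x"], of 2] by (simp add: power_mult_distrib)
  show int: "integrable M (\<lambda>x. (N (f x))\<^sup>2)"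
    by (rule integrable_dominated[OF integrable_mult_right[OF f, of "C\<^sup>2"]]) (use bound in auto)
  have "(\<integral>x. (N (f x))\<^sup>2 \<partial>M) \<le> (\<integral>x. C\<^sup>2 * (norm (f x))\<^sup>2 \<partial>M)"
    by (intro integral_mono int integrable_mult_right f bound)
  then show "(\<integral>x. (N (f x))\<^sup>2 \<partial>M) \<le> C\<^sup>2 * (\<integral>x. (norm (f x))\<^sup>2 \<partial>M)" by simp
qed

text \<open>The function \<open>z \<circ> u\<close> is the conditional expectation of the identity given a finite partition.\<close>

lemma barycentric_quantization:
  assumes m2: "integrable M (\<lambda>x. (norm x)\<^sup>2)" and d: "d > 0"
  obtains u z :: "'a \<Rightarrow> 'a" and w J where "simple_function M u" "finite J"
    "\<And>y. y \<in> J \<Longrightarrow> 0 < w y" "(\<Sum>y\<in>J. w y) = 1" "\<And>h. (\<integral>x. h (u x) \<partial>M) = (\<Sum>y\<in>J. w y * h y :: real)"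
    "\<And>y. w y = measure M (u -` {y})" "AE x in M. u x \<in> J"
    "\<And>y. y \<in> J \<Longrightarrow> (\<integral>x. indicator (u -` {y}) x *\<^sub>R x \<partial>M) = w y *\<^sub>R z y"
    "(\<integral>x. (N (x - z (u x)))\<^sup>2 \<partial>M) \<le> d" "integrable M (\<lambda>x. (N (x - z (u x)))\<^sup>2)"
proof -
  obtain C where C: "C > 0" "\<And>x. N x \<le> C * norm x" using N_upper by auto
  \<comment> \<open>The optimality of conditional means is a Euclidean fact, so the error is
    controlled in \<open>norm\<close>, and \<open>C\<close> converts it to \<open>N\<close> at the
    end.\<close>
  obtain u where u: "simple_function M u" "integrable M (\<lambda>x. (norm (x - u x))\<^sup>2)"
    "(\<integral>x. (norm (x - u x))\<^sup>2 \<partial>M) < d / C\<^sup>2"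
    using quantization[OF m2, of "d / C\<^sup>2"] C d by auto
  have [measurable]: "u \<in> borel_measurable M" by (rule borel_measurable_simple_function[OF u(1)])
  define A where "A y = u -` {y}" for y
  define w where "w y = measure M (A y)" for y
  \<comment> \<open>Values of measure zero are dropped so that all weights are positive, as the
    division by \<open>w y\<close> and the later repair of the marginal require.\<close>
  define J where "J = {y \<in> range u. 0 < w y}"
  have Am [measurable]: "A y \<in> sets M" for y
    using simple_functionD(2)[OF u(1), of "{y}"] by (simp add: A_def)
  have finJ: "finite J" using simple_functionD(1)[OF u(1)] by (simp add: J_def)
  have w0: "w y \<ge> 0" for y by (simp add: w_def)
  have int_u: "(\<integral>x. h (u x) \<partial>M) = (\<Sum>y\<in>J. w y * h y)" for h :: "'a \<Rightarrow> real"
  proof -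
    have "(\<integral>x. h (u x) \<partial>M) = (\<Sum>y\<in>range u. w y * h y)"
      unfolding w_def A_def by (rule integral_simple_function(2)[OF u(1)])
    also have "\<dots> = (\<Sum>y\<in>J. w y * h y)"
      using simple_functionD(1)[OF u(1)] w0
      by (intro sum.mono_neutral_right) (auto simp: J_def less_le)
    finally show ?thesis .
  qed
  have w: "(\<Sum>y\<in>J. w y) = 1" "\<And>y. y \<in> J \<Longrightarrow> 0 < w y"
    using int_u[of "\<lambda>_. 1"] prob_space by (auto simp: J_def)
  have uJ: "AE x in M. u x \<in> J"
  proof -
    have "(\<integral>x. indicator (- J) (u x) \<partial>M) = (\<Sum>y\<in>J. w y * indicator (- J) y)"
      by (rule int_u)
    also have "\<dots> = 0" by simp
    finally have "AE x in M. (indicator (- J) (u x) :: real) = 0"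
      using integral_simple_function(1)[OF u(1)]
      by (subst (asm) integral_nonneg_eq_0_iff_AE) auto
    then show ?thesis by eventually_elim (auto simp: indicator_def split: if_splits)
  qed
  have ind_int: "integrable M (\<lambda>x. indicator (A y) x *\<^sub>R x)" for y
    by (rule integrable_mult_indicator[OF Am integrable_id])
  define z where "z y = (1 / w y) *\<^sub>R (\<integral>x. indicator (A y) x *\<^sub>R x \<partial>M)" for y
  have z_mean: "(\<integral>x. indicator (A y) x *\<^sub>R x \<partial>M) = w y *\<^sub>R z y" if "y \<in> J" for y
    using w(2)[OF that] by (simp add: z_def)
  have zu_int: "integrable M (\<lambda>x. (norm (x - z (u x)))\<^sup>2)"
  proof -
    have "(\<lambda>x. z (u x)) \<in> borel_measurable M"
      by (rule measurable_compose[OF measurable_simple_function[OF u(1)]]) simp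
    then have [measurable]: "(\<lambda>x. (norm (x - z (u x)))\<^sup>2) \<in> borel_measurable M" by measurable
    show ?thesis
    proof (rule integrable_dominated)
      show "integrable M (\<lambda>x. 2 * (norm x)\<^sup>2 + 2 * (norm (z (u x)))\<^sup>2)"
        using m2 integral_simple_function(1)[OF u(1), of "\<lambda>y. (norm (z y))\<^sup>2"] by simp
      fix x
      have "(norm (x - z (u x)))\<^sup>2 \<le> (norm x + norm (z (u x)))\<^sup>2"
        by (intro power_mono norm_triangle_ineq4) simp
      also have "\<dots> \<le> 2 * (norm x)\<^sup>2 + 2 * (norm (z (u x)))\<^sup>2"
        using zero_le_power2[of "norm x - norm (z (u x))"] by (simp add: power2_diff power2_sum)
      finally show "\<bar>(norm (x - z (u x)))\<^sup>2\<bar> \<le> 2 * (norm x)\<^sup>2 + 2 * (norm (z (u x)))\<^sup>2" by simp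
    qed measurable
  qed
  have err: "(\<integral>x. (N (x - z (u x)))\<^sup>2 \<partial>M) \<le> d" "integrable M (\<lambda>x. (N (x - z (u x)))\<^sup>2)"
  proof -
    \<comment> \<open>The cross term in the expansion of the square of
      \<open>x - u x = (x - z (u x)) + (z (u x) - u x)\<close>. It integrates to 0 on each cell, so
      replacing the values of u by conditional means does not increase the error.\<close>
    define F where "F x = (\<Sum>y\<in>J. indicator (A y) x * ((x - z y) \<bullet> (z y - y)))" for x
    have Fi: "integrable M (\<lambda>x. indicator (A y) x * ((x - z y) \<bullet> (z y - y)))"
      "(\<integral>x. indicator (A y) x * ((x - z y) \<bullet> (z y - y)) \<partial>M) = 0" if y: "y \<in> J" for y
    proof -
      have Aw: "integrable M (indicator (A y) :: 'a \<Rightarrow> real)" "(\<integral>x. indicator (A y) x \<partial>M) = w y"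
        using sets_M by (auto simp: w_def less_top[symmetric])
      have eq: "(\<lambda>x. indicator (A y) x * ((x - z y) \<bullet> (z y - y)))
          = (\<lambda>x. (indicator (A y) x *\<^sub>R x) \<bullet> (z y - y) - indicator (A y) x * (z y \<bullet> (z y - y)))"
        by (auto simp: inner_diff_left algebra_simps)
      have 1: "integrable M (\<lambda>x. (indicator (A y) x *\<^sub>R x) \<bullet> (z y - y))"
        using ind_int by (rule integrable_inner_left)
      have 2: "integrable M (\<lambda>x. indicator (A y) x * (z y \<bullet> (z y - y)))"
        using Aw(1) by (rule integrable_mult_left)
      show "integrable M (\<lambda>x. indicator (A y) x * ((x - z y) \<bullet> (z y - y)))"
        unfolding eq using 1 2 by (rule Bochner_Integration.integrable_diff)
      show "(\<integral>x. indicator (A y) x * ((x - z y) \<bullet> (z y - y)) \<partial>M) = 0"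
        unfolding eq Bochner_Integration.integral_diff[OF 1 2] integral_inner_left[OF ind_int]
          z_mean[OF y] Bochner_Integration.integral_mult_left_zero Aw(2) by simp
    qed
    have F: "integrable M F" "(\<integral>x. F x \<partial>M) = 0"
      unfolding F_def[abs_def] using Fi by (auto simp: Bochner_Integration.integral_sum)
    have "(\<integral>x. (norm (x - z (u x)))\<^sup>2 + 2 * F x \<partial>M) \<le> (\<integral>x. (norm (x - u x))\<^sup>2 \<partial>M)"
    proof (rule integral_mono_AE)
      show "integrable M (\<lambda>x. (norm (x - z (u x)))\<^sup>2 + 2 * F x)" using F zu_int by simp
      show "AE x in M. (norm (x - z (u x)))\<^sup>2 + 2 * F x \<le> (norm (x - u x))\<^sup>2"
        using uJ
      proof eventually_elim
        case (elim x)
        have "F x = (\<Sum>y\<in>J. if y = u x then (x - z y) \<bullet> (z y - y) else 0)"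
          unfolding F_def by (intro sum.cong refl) (auto simp: A_def indicator_def)
        also have "\<dots> = (x - z (u x)) \<bullet> (z (u x) - u x)" using elim finJ by simp
        finally have Fx: "F x = (x - z (u x)) \<bullet> (z (u x) - u x)" .
        have "(norm (a + b))\<^sup>2 = (norm a)\<^sup>2 + 2 * (a \<bullet> b) + (norm b)\<^sup>2" for a b :: 'a
          by (simp add: power2_norm_eq_inner inner_add_left inner_add_right inner_commute)
        from this[of "x - z (u x)" "z (u x) - u x"]
        have "(norm (x - u x))\<^sup>2 = (norm (x - z (u x)))\<^sup>2 + 2 * F x + (norm (z (u x) - u x))\<^sup>2"
          unfolding Fx by simp
        then show ?case by simp
      qed
    qed (rule u(2))
    then have bd: "(\<integral>x. (norm (x - z (u x)))\<^sup>2 \<partial>M) \<le> d / C\<^sup>2"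
      using F zu_int u(3) by simp
    have [measurable]: "(\<lambda>x. z (u x)) \<in> borel_measurable M"
      by (rule measurable_compose[OF measurable_simple_function[OF u(1)]]) simp
    have meas: "(\<lambda>x. x - z (u x)) \<in> borel_measurable M" by measurable
    show "integrable M (\<lambda>x. (N (x - z (u x)))\<^sup>2)" by (rule integral_N_sq_le(1)[OF C(2) meas zu_int])
    have "(\<integral>x. (N (x - z (u x)))\<^sup>2 \<partial>M) \<le> C\<^sup>2 * (\<integral>x. (norm (x - z (u x)))\<^sup>2 \<partial>M)"
      by (rule integral_N_sq_le(2)[OF C(2) meas zu_int])
    also have "\<dots> \<le> d" using bd C by (simp add: field_simps)
    finally show "(\<integral>x. (N (x - z (u x)))\<^sup>2 \<partial>M) \<le> d" .
  qed
  show ?thesis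
    by (rule that[OF u(1) finJ w(2,1) int_u _ uJ z_mean[unfolded A_def] err]) (auto simp: w_def A_def)
qed

text \<open>The finite problem between the values of s and \<open>J\<close> is solved by
  \<open>finite_penalty_duality\<close>, whose dual hypothesis is met by testing \<open>dual\<close>
  on the envelopes of arbitrary multipliers. Passing from x to \<open>s x\<close> and back
  contributes one factor \<open>1 + e\<close> each.\<close>

lemma approx_transport:
  fixes z :: "'j \<Rightarrow> 'a"
  assumes m2: "integrable M (\<lambda>x. (norm x)\<^sup>2)"
    and J: "finite J" "J \<noteq> {}" and w: "\<And>j. j \<in> J \<Longrightarrow> 0 < w j" "(\<Sum>j\<in>J. w j) = 1"
    and \<sigma>: "\<sigma> > 0" and e: "e > 0"
    and dual: "\<And>L f. conc_lip L f \<Longrightarrow> (\<Sum>j\<in>J. w j * f (z j)) \<le> (\<integral>x. sup_conv \<sigma> f x \<partial>M) + K"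
  obtains s :: "'a \<Rightarrow> 'a" and q :: "'a \<Rightarrow> 'j \<Rightarrow> real" where "simple_function M s" "\<And>a. q a \<in> prob_simplex J"
    "\<And>j. j \<in> J \<Longrightarrow> (\<integral>x. q (s x) j \<partial>M) = w j"
    "(\<integral>\<^sup>+x. ennreal (1/2 * (N (x - bary J z (q (s x))))\<^sup>2) \<partial>M) \<le> ennreal (\<sigma> * (1 + e)\<^sup>2 * (K + e))"
proof -
  \<comment> \<open>The two terms of the minimum pay for the quantisation error once in each
    direction, in \<open>D1\<close> and in \<open>D2\<close>.\<close>
  define d0 where "d0 = min (2 * \<sigma> * e * (e / 4)) (\<sigma> * (1 + e)\<^sup>2 * (e / 4) * (2 * e / (1 + e)))"
  have d0: "d0 > 0" using e \<sigma> by (simp add: d0_def)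
  obtain C where C: "C > 0" "\<And>x. N x \<le> C * norm x" using N_upper by auto
  obtain s where s0: "simple_function M s" "integrable M (\<lambda>x. (norm (x - s x))\<^sup>2)"
    "(\<integral>x. (norm (x - s x))\<^sup>2 \<partial>M) < d0 / C\<^sup>2"
    using quantization[OF m2, of "d0 / C\<^sup>2"] C d0 by auto
  have [measurable]: "s \<in> borel_measurable M" by (rule borel_measurable_simple_function[OF s0(1)])
  have "C\<^sup>2 * (\<integral>x. (norm (x - s x))\<^sup>2 \<partial>M) < d0" using s0(3) C(1) by (simp add: field_simps)
  then have s: "simple_function M s" "integrable M (\<lambda>x. (N (x - s x))\<^sup>2)" "(\<integral>x. (N (x - s x))\<^sup>2 \<partial>M) < d0"
    using integral_N_sq_le[OF C(2) _ s0(2)] s0(1) by auto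
  define D where "D = (\<integral>x. (N (x - s x))\<^sup>2 \<partial>M)"
  have D1: "D / (2 * \<sigma> * e) \<le> e / 4"
    using s(3) e \<sigma> by (simp add: D_def d0_def field_simps)
  have D2: "(1 + 1 / e) / 2 * D \<le> \<sigma> * (1 + e)\<^sup>2 * (e / 4)"
  proof -
    have "D \<le> \<sigma> * (1 + e)\<^sup>2 * (e / 4) * (2 * e / (1 + e))" using s(3) by (simp add: D_def d0_def)
    then have "(1 + 1 / e) / 2 * D \<le> (1 + 1 / e) / 2 * (\<sigma> * (1 + e)\<^sup>2 * (e / 4) * (2 * e / (1 + e)))"
      using e by (intro mult_left_mono) auto
    also have "\<dots> = \<sigma> * (1 + e)\<^sup>2 * (e / 4) * ((1 + 1 / e) / 2 * (2 * e / (1 + e)))" by simp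
    also have "(1 + 1 / e) / 2 * (2 * e / (1 + e)) = 1"
    proof -
      have "1 + 1 / e = (1 + e) / e" "1 + e \<noteq> 0" using e by (auto simp: field_simps)
      then show ?thesis using e by simp
    qed
    finally show ?thesis by simp
  qed
  define Y where "Y = range s"
  define m where "m y = measure M (s -` {y})" for y
  have finY: "finite Y" using simple_functionD(1)[OF s(1)] by (simp add: Y_def)
  have int_s: "(\<integral>x. h (s x) \<partial>M) = (\<Sum>y\<in>Y. m y * h y)" for h :: "'a \<Rightarrow> real"
    unfolding Y_def m_def by (rule integral_simple_function(2)[OF s(1)])
  have m: "0 \<le> m y" "(\<Sum>y\<in>Y. m y) = 1" for y
    using int_s[of "\<lambda>_. 1"] prob_space by (auto simp: m_def)
  \<comment> \<open>Smaller than \<open>1 / \<sigma>\<close> by the factor \<open>1 + e\<close> that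
    Young's inequality costs when x is replaced by \<open>s x\<close>.\<close>
  define \<kappa> where "\<kappa> = 1 / (\<sigma> * (1 + e))"
  have \<kappa>: "\<kappa> > 0" using \<sigma> e by (simp add: \<kappa>_def)
  define c where "c y p = \<kappa> / 2 * (N (y - bary J z p))\<^sup>2" for y p
  define R where "R = (\<Sum>j\<in>J. N (z j))"
  have R0: "R \<ge> 0" by (auto simp: R_def intro: sum_nonneg)
  have "\<exists>q. (\<forall>y\<in>Y. q y \<in> prob_simplex J) \<and> (\<forall>j\<in>J. (\<Sum>y\<in>Y. m y * q y j) = w j) \<and>
      (\<Sum>y\<in>Y. m y * c y (q y)) \<le> (K + e / 4) + e / 4"
  proof (rule finite_penalty_duality[OF finY J m w])
    show "c y (\<lambda>j. (1 - t) * p j + t * q j) \<le> (1 - t) * c y p + t * c y q"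
      if "0 \<le> t" "t \<le> 1" for y p q t
    proof -
      have "y - bary J z (\<lambda>j. (1 - t) * p j + t * q j) = (1 - t) *\<^sub>R (y - bary J z p) + t *\<^sub>R (y - bary J z q)"
        unfolding bary_mix by (simp add: algebra_simps)
      then have "(N (y - bary J z (\<lambda>j. (1 - t) * p j + t * q j)))\<^sup>2
          \<le> (1 - t) * (N (y - bary J z p))\<^sup>2 + t * (N (y - bary J z q))\<^sup>2"
        using convex_onD[OF convex_on_N_sq, of t "y - bary J z p" "y - bary J z q"] that by simp
      then have "\<kappa> / 2 * (N (y - bary J z (\<lambda>j. (1 - t) * p j + t * q j)))\<^sup>2
          \<le> \<kappa> / 2 * ((1 - t) * (N (y - bary J z p))\<^sup>2 + t * (N (y - bary J z q))\<^sup>2)"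
        using \<kappa> by (intro mult_left_mono) auto
      also have "\<dots> = (1 - t) * c y p + t * c y q"
        unfolding c_def distrib_left by (simp add: mult_ac)
      finally show ?thesis unfolding c_def .
    qed
    show "0 \<le> c y p \<and> c y p \<le> \<kappa> / 2 * ((\<Sum>y\<in>Y. N y) + R)\<^sup>2"
      if "y \<in> Y" "p \<in> prob_simplex J" for y p
    proof
      show "0 \<le> c y p" using \<kappa> by (simp add: c_def)
      have "N (y - bary J z p) \<le> N y + N (bary J z p)" using N_triangle[of y "- bary J z p"] by simp
      also have "\<dots> \<le> (\<Sum>y\<in>Y. N y) + R"
        unfolding R_def using that finY by (intro add_mono member_le_sum N_bary_le J) auto
      finally show "c y p \<le> \<kappa> / 2 * ((\<Sum>y\<in>Y. N y) + R)\<^sup>2"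
        unfolding c_def using \<kappa> by (intro mult_left_mono power_mono) auto
    qed
    show "e / 4 > 0" using e by simp
    fix \<beta> :: "'j \<Rightarrow> real" and d :: real assume d: "d > 0"
    define v where "v y p = (\<Sum>j\<in>J. \<beta> j * p j) - c y p" for y p
    \<comment> \<open>Almost maximisers suffice, since the dual hypothesis of the finite problem
      tolerates the error d.\<close>
    have "\<exists>q\<in>prob_simplex J. \<forall>p\<in>prob_simplex J. v y p \<le> v y q + d" for y
    proof -
      have bdd: "bdd_above (v y ` prob_simplex J)"
      proof (rule bdd_aboveI2)
        fix p assume "p \<in> prob_simplex J"
        then show "v y p \<le> (\<Sum>j\<in>J. \<bar>\<beta> j\<bar>)"
          using simplex_linear_le[OF J(1), of p \<beta>] \<kappa> unfolding v_def c_def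
          by (smt (verit) zero_le_power2 mult_nonneg_nonneg divide_nonneg_nonneg)
      qed
      have "Sup (v y ` prob_simplex J) - d < Sup (v y ` prob_simplex J)" using d by simp
      then obtain q where q: "q \<in> prob_simplex J" "Sup (v y ` prob_simplex J) - d < v y q"
        using less_cSupD[of "v y ` prob_simplex J"] simplex_ne[OF J] by blast
      have "v y p \<le> v y q + d" if "p \<in> prob_simplex J" for p
        using cSup_upper[OF imageI[OF that] bdd] q(2) by linarith
      with q(1) show ?thesis by blast
    qed
    then obtain q where q: "\<And>y. q y \<in> prob_simplex J"
      "\<And>y p. p \<in> prob_simplex J \<Longrightarrow> v y p \<le> v y (q y) + d" by metis
    \<comment> \<open>The Huber defect of the envelope with slope n. It vanishes pointwise for large
      n, and the second moment provides the majorant for its integral.\<close>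
    define T where "T n x = (max 0 (N x + R - \<sigma> * real n))\<^sup>2 / (2 * \<sigma>)" for n x
    define U where "U x = v (s x) (q (s x)) + d + (N (x - s x))\<^sup>2 / (2 * \<sigma> * e)" for x
    have vi: "integrable M (\<lambda>x. v (s x) (q (s x)))" by (rule integral_simple_function(1)[OF s(1)])
    have Ui: "integrable M U" unfolding U_def using vi s(2) by simp
    have U: "(\<integral>x. U x \<partial>M) = (\<Sum>y\<in>Y. m y * v y (q y)) + d + D / (2 * \<sigma> * e)"
      unfolding U_def using vi s(2) int_s[of "\<lambda>y. v y (q y)"] prob_space by (simp add: D_def)
    have T_bound: "0 \<le> T n x" "T n x \<le> (C * norm x + R)\<^sup>2 / (2 * \<sigma>)" for n x
    proof -
      show "0 \<le> T n x" using \<sigma> by (simp add: T_def)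
      have "max 0 (N x + R - \<sigma> * real n) \<le> C * norm x + R"
        using C(2)[of x] C(1) R0 \<sigma> by (simp add: add_increasing2)  (smt (verit) mult_nonneg_nonneg of_nat_0_le_iff)
      then show "T n x \<le> (C * norm x + R)\<^sup>2 / (2 * \<sigma>)"
        unfolding T_def using \<sigma> by (intro divide_right_mono power_mono) auto
    qed
    have Wi: "integrable M (\<lambda>x. (C * norm x + R)\<^sup>2 / (2 * \<sigma>))"
      using second_moment_affine[OF m2] by simp
    have Tm [measurable]: "T n \<in> borel_measurable M" for n unfolding T_def by measurable
    have Ti: "integrable M (T n)" for n
      using T_bound by (intro integrable_dominated[OF Wi Tm]) simp
    have T_lim: "(\<lambda>n. \<integral>x. T n x \<partial>M) \<longlonglongrightarrow> (\<integral>x. 0 \<partial>M)"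
    proof (rule integral_dominated_convergence[OF _ _ Wi])
      show "AE x in M. (\<lambda>n. T n x) \<longlonglongrightarrow> 0"
      proof (rule AE_I2)
        fix x
        obtain k where k: "(N x + R) / \<sigma> \<le> real k" using real_arch_simple by blast
        have "T n x = 0" if "k \<le> n" for n
        proof -
          have "(N x + R) / \<sigma> \<le> real n" using k that by (meson of_nat_mono order_trans)
          then have "N x + R - \<sigma> * real n \<le> 0" using \<sigma> by (simp add: field_simps)
          then show ?thesis by (simp add: T_def max_def)
        qed
        then have "\<forall>\<^sub>F n in sequentially. T n x = 0" by (intro eventually_sequentiallyI[of k])
        then show "(\<lambda>n. T n x) \<longlonglongrightarrow> 0" by (rule tendsto_eventually)
      qed
    qed (use T_bound in auto)
    have step: "(\<Sum>j\<in>J. \<beta> j * w j) \<le> (\<integral>x. U x \<partial>M) + K + (\<integral>x. T n x \<partial>M)" for n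
    proof -
      define f where "f = simplex_env J z \<beta> (real n)"
      have f: "conc_lip (real n) f" unfolding f_def by (rule conc_lip_simplex_env[OF J]) simp
      have "(\<Sum>j\<in>J. \<beta> j * w j) \<le> (\<Sum>j\<in>J. w j * f (z j))"
        using w(1) simplex_env_vertex[OF J(1), of "real n" _ \<beta> z]
        by (intro sum_mono) (auto simp: f_def mult.commute intro!: mult_left_mono less_imp_le)
      also have "\<dots> \<le> (\<integral>x. sup_conv \<sigma> f x \<partial>M) + K" by (rule dual[OF f])
      also have "(\<integral>x. sup_conv \<sigma> f x \<partial>M) \<le> (\<integral>x. U x + T n x \<partial>M)"
      proof (rule integral_mono)
        show "integrable M (sup_conv \<sigma> f)" by (rule integrable_conc_lip[OF conc_lip_sup_conv[OF f \<sigma>]])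
        show "integrable M (\<lambda>x. U x + T n x)" using Ui Ti by simp
        fix x
        show "sup_conv \<sigma> f x \<le> U x + T n x"
          unfolding f_def T_def R_def
        proof (rule sup_conv_simplex_env_le[OF J _ \<sigma>])
          fix p assume p: "p \<in> prob_simplex J"
          define b where "b = bary J z p"
          have "(N (s x - b))\<^sup>2 \<le> (1 + e) * (N (x - b))\<^sup>2 + (1 + 1 / e) * (N (s x - x))\<^sup>2"
            using N_sq_add_le[OF e, of "x - b" "s x - x"] by simp
          then have "\<kappa> / 2 * (N (s x - b))\<^sup>2
              \<le> \<kappa> / 2 * ((1 + e) * (N (x - b))\<^sup>2 + (1 + 1 / e) * (N (s x - x))\<^sup>2)"
            using \<kappa> by (intro mult_left_mono) auto
          also have "\<dots> = (\<kappa> * (1 + e)) / 2 * (N (x - b))\<^sup>2 + (\<kappa> * (1 + 1 / e)) / 2 * (N (x - s x))\<^sup>2"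
          proof -
            have "k / 2 * (a * A + c * B) = k * a / 2 * A + k * c / 2 * B" for k a c A B :: real
              by (simp add: algebra_simps)
            then show ?thesis by (simp only: N_commute[of "s x" x])
          qed
          also have "\<kappa> * (1 + e) = 1 / \<sigma>" using e \<sigma> by (simp add: \<kappa>_def)
          also have "\<kappa> * (1 + 1 / e) = 1 / (\<sigma> * e)"
          proof -
            have "1 + 1 / e = (1 + e) / e" using e by (simp add: field_simps)
            then show ?thesis using e \<sigma> by (simp add: \<kappa>_def)
          qed
          finally have "c (s x) p \<le> (N (x - b))\<^sup>2 / (2 * \<sigma>) + (N (x - s x))\<^sup>2 / (2 * \<sigma> * e)"
            by (simp add: c_def b_def mult_ac)
          then show "(\<Sum>j\<in>J. \<beta> j * p j) - (N (x - bary J z p))\<^sup>2 / (2 * \<sigma>) \<le> U x"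
            using q(2)[OF p, of "s x"] unfolding U_def v_def b_def by linarith
        qed simp
      qed
      also have "(\<integral>x. U x + T n x \<partial>M) = (\<integral>x. U x \<partial>M) + (\<integral>x. T n x \<partial>M)" using Ui Ti by simp
      finally show ?thesis by simp
    qed
    have "(\<lambda>n. (\<integral>x. U x \<partial>M) + K + (\<integral>x. T n x \<partial>M)) \<longlonglongrightarrow> (\<integral>x. U x \<partial>M) + K + (\<integral>x. 0 \<partial>M)"
      by (intro tendsto_intros T_lim)
    then have "(\<Sum>j\<in>J. \<beta> j * w j) \<le> (\<integral>x. U x \<partial>M) + K + (\<integral>x. 0 \<partial>M)"
      using step by (intro LIMSEQ_le_const) auto
    then have "(\<Sum>j\<in>J. \<beta> j * w j) \<le> (\<Sum>y\<in>Y. m y * v y (q y)) + d + (K + e / 4)"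
      using U D1 by simp
    moreover have "(\<Sum>y\<in>Y. m y * (c y (q y) - (\<Sum>j\<in>J. \<beta> j * q y j))) = - (\<Sum>y\<in>Y. m y * v y (q y))"
      unfolding sum_negf[symmetric] v_def by (intro sum.cong refl) (simp add: algebra_simps)
    ultimately show "\<exists>q. (\<forall>y\<in>Y. q y \<in> prob_simplex J) \<and>
        (\<Sum>y\<in>Y. m y * (c y (q y) - (\<Sum>j\<in>J. \<beta> j * q y j))) + (\<Sum>j\<in>J. \<beta> j * w j) \<le> (K + e / 4) + d"
      using q(1) by (intro exI[of _ q]) auto
  qed
  then obtain q where q: "\<And>y. y \<in> Y \<Longrightarrow> q y \<in> prob_simplex J" "\<And>j. j \<in> J \<Longrightarrow> (\<Sum>y\<in>Y. m y * q y j) = w j"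
    "(\<Sum>y\<in>Y. m y * c y (q y)) \<le> (K + e / 4) + e / 4" by blast
  \<comment> \<open>Off the values of s the weights are set to \<open>w\<close>, so that every
    \<open>r a\<close> lies in the simplex.\<close>
  define r where "r a = (if a \<in> Y then q a else w)" for a
  have rs: "r (s x) = q (s x)" for x by (simp add: r_def Y_def)
  show ?thesis
  proof (rule that[OF s(1), of r])
    show "r a \<in> prob_simplex J" for a
      using q(1) w by (auto simp: r_def prob_simplex_def less_imp_le)
    show "(\<integral>x. r (s x) j \<partial>M) = w j" if "j \<in> J" for j
      unfolding rs using int_s[of "\<lambda>y. q y j"] q(2)[OF that] by simp
    have ci: "integrable M (\<lambda>x. c (s x) (q (s x)))" by (rule integral_simple_function(1)[OF s(1)])
    have "(\<integral>\<^sup>+x. ennreal (1/2 * (N (x - bary J z (r (s x))))\<^sup>2) \<partial>M)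
        \<le> (\<integral>\<^sup>+x. ennreal (\<sigma> * (1 + e)\<^sup>2 * c (s x) (q (s x)) + (1 + 1 / e) / 2 * (N (x - s x))\<^sup>2) \<partial>M)"
    proof (intro nn_integral_mono ennreal_leI)
      fix x
      define b where "b = bary J z (q (s x))"
      have "(N (x - b))\<^sup>2 \<le> (1 + e) * (N (s x - b))\<^sup>2 + (1 + 1 / e) * (N (x - s x))\<^sup>2"
        using N_sq_add_le[OF e, of "s x - b" "x - s x"] by simp
      moreover have "\<sigma> * (1 + e)\<^sup>2 * c (s x) (q (s x)) = (1 + e) / 2 * (N (s x - b))\<^sup>2"
      proof -
        have "1 + e \<noteq> 0" using e by simp
        then have "\<sigma> * (1 + e)\<^sup>2 * \<kappa> = 1 + e" using \<sigma> by (simp add: \<kappa>_def power2_eq_square)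
        then have "(\<sigma> * (1 + e)\<^sup>2 * \<kappa>) / 2 * (N (s x - b))\<^sup>2 = (1 + e) / 2 * (N (s x - b))\<^sup>2" by simp
        then show ?thesis by (simp add: c_def b_def mult.assoc)
      qed
      ultimately show "1/2 * (N (x - bary J z (r (s x))))\<^sup>2
          \<le> \<sigma> * (1 + e)\<^sup>2 * c (s x) (q (s x)) + (1 + 1 / e) / 2 * (N (x - s x))\<^sup>2"
        unfolding rs b_def[symmetric] by (simp add: field_simps)
    qed
    also have "\<dots> = ennreal (\<integral>x. \<sigma> * (1 + e)\<^sup>2 * c (s x) (q (s x)) + (1 + 1 / e) / 2 * (N (x - s x))\<^sup>2 \<partial>M)"
    proof (rule nn_integral_eq_integral)
      show "integrable M (\<lambda>x. \<sigma> * (1 + e)\<^sup>2 * c (s x) (q (s x)) + (1 + 1 / e) / 2 * (N (x - s x))\<^sup>2)"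
        by (intro Bochner_Integration.integrable_add integrable_mult_right ci s(2))
    qed (use \<sigma> e \<kappa> in \<open>auto simp: c_def\<close>)
    also have "(\<integral>x. \<sigma> * (1 + e)\<^sup>2 * c (s x) (q (s x)) + (1 + 1 / e) / 2 * (N (x - s x))\<^sup>2 \<partial>M)
        = \<sigma> * (1 + e)\<^sup>2 * (\<Sum>y\<in>Y. m y * c y (q y)) + (1 + 1 / e) / 2 * D"
      using ci s(2) int_s[of "\<lambda>y. c y (q y)"] by (simp add: D_def)
    also have "\<dots> \<le> \<sigma> * (1 + e)\<^sup>2 * ((K + e / 4) + e / 4) + \<sigma> * (1 + e)\<^sup>2 * (e / 4)"
      using q(3) D2 \<sigma> by (intro add_mono mult_left_mono) auto
    also have "\<dots> = \<sigma> * (1 + e)\<^sup>2 * (K + e / 4 + e / 4 + e / 4)" by (simp add: algebra_simps)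
    also have "\<dots> \<le> \<sigma> * (1 + e)\<^sup>2 * (K + e)" using e \<sigma> by (intro mult_left_mono) auto
    finally show "(\<integral>\<^sup>+x. ennreal (1/2 * (N (x - bary J z (r (s x))))\<^sup>2) \<partial>M)
        \<le> ennreal (\<sigma> * (1 + e)\<^sup>2 * (K + e))" by (simp add: ennreal_leI)
  qed
qed

end

section \<open>From the gradient inequality to the transport inequality\<close>

context norm_prob
begin

text \<open>A coupling with a density relative to the product measure disintegrates by construction:
  the first marginal comes from the normalisation of each kernel measure, the second from
  \<open>marg\<close>.\<close>

lemma transport_cost_le_density:
  fixes h :: "'a \<Rightarrow> 'a \<Rightarrow> real"
  assumes "prob_space \<nu>" and sets_\<nu>: "sets \<nu> = sets borel" and h0: "\<And>x y. 0 \<le> h x y"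
    and hm: "(\<lambda>(x, y). h x y) \<in> borel_measurable (borel \<Otimes>\<^sub>M borel)"
    and kernel: "(\<lambda>x. density \<nu> (\<lambda>y. ennreal (h x y))) \<in> borel \<rightarrow>\<^sub>M prob_algebra borel"
    and marg: "AE y in \<nu>. (\<integral>\<^sup>+x. ennreal (h x y) \<partial>M) = 1"
  shows "transport_cost N \<nu> M \<le> (\<integral>\<^sup>+x. ennreal (1/2 * (N (x - (\<integral>y. h x y *\<^sub>R y \<partial>\<nu>)))\<^sup>2) \<partial>M)"
proof -
  interpret \<nu>: prob_space \<nu> by fact
  interpret pr: pair_sigma_finite M \<nu> by unfold_locales
  define p where "p x = density \<nu> (\<lambda>y. ennreal (h x y))" for x
  define \<pi> where "\<pi> = density (M \<Otimes>\<^sub>M \<nu>) (\<lambda>(x, y). ennreal (h x y))"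
  have sets_pair: "sets (M \<Otimes>\<^sub>M \<nu>) = sets (borel \<Otimes>\<^sub>M borel)"
    by (intro sets_pair_measure_cong sets_M sets_\<nu>)
  have hs' [measurable]: "(\<lambda>(x, y). ennreal (h x y)) \<in> borel_measurable (M \<Otimes>\<^sub>M \<nu>)"
    using hm sets_pair by (simp cong: measurable_cong_sets)
  have hx [measurable]: "h x \<in> borel_measurable \<nu>" for x
    using measurable_compose[OF measurable_Pair1' hm, of x] sets_\<nu> by (simp cong: measurable_cong_sets)
  have hy [measurable]: "(\<lambda>x. h x y) \<in> borel_measurable M" for y
    using measurable_compose[OF measurable_Pair2' hm, of y] by simp
  have px: "prob_space (p x)" for x
    using measurable_space[OF kernel, of x] by (auto simp: space_prob_algebra p_def)
  have \<pi>_eq: "emeasure \<pi> B = (\<integral>\<^sup>+x. (\<integral>\<^sup>+y. indicator B (x, y) \<partial>p x) \<partial>M)"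
    if B: "B \<in> sets (borel \<Otimes>\<^sub>M borel)" for B
  proof -
    have Bm [measurable]: "B \<in> sets (M \<Otimes>\<^sub>M \<nu>)" using B sets_pair by simp
    have "emeasure \<pi> B = (\<integral>\<^sup>+z. (case z of (x, y) \<Rightarrow> ennreal (h x y)) * indicator B z \<partial>(M \<Otimes>\<^sub>M \<nu>))"
      unfolding \<pi>_def by (rule emeasure_density[OF hs' Bm])
    also have "\<dots> = (\<integral>\<^sup>+x. \<integral>\<^sup>+y. ennreal (h x y) * indicator B (x, y) \<partial>\<nu> \<partial>M)"
      by (subst \<nu>.nn_integral_fst[symmetric]) auto
    also have "\<dots> = (\<integral>\<^sup>+x. (\<integral>\<^sup>+y. indicator B (x, y) \<partial>p x) \<partial>M)"
      unfolding p_def by (intro nn_integral_cong) (subst nn_integral_density, auto)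
    finally show ?thesis .
  qed
  have sets_\<pi>: "sets \<pi> = sets (borel \<Otimes>\<^sub>M borel)" by (simp add: \<pi>_def sets_pair)
  have space_\<pi>: "space \<pi> = UNIV" using sets_eq_imp_space_eq[OF sets_\<pi>] by (simp add: space_pair_measure)
  have dis: "disintegrates M p \<pi>" using \<pi>_eq kernel by (simp add: disintegrates_def p_def[abs_def])
  have "distr \<pi> borel fst = M"
  proof (rule measure_eqI)
    show "sets (distr \<pi> borel fst) = sets M" by (simp add: sets_M)
    fix B assume "B \<in> sets (distr \<pi> borel fst)"
    then have B [measurable]: "B \<in> sets borel" by simp
    have "emeasure (distr \<pi> borel fst) B = emeasure \<pi> (fst -` B \<inter> space \<pi>)"
      by (rule emeasure_distr) (auto simp: sets_\<pi> cong: measurable_cong_sets)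
    also have "fst -` B \<inter> space \<pi> = B \<times> UNIV" by (auto simp: space_\<pi>)
    also have "emeasure \<pi> (B \<times> UNIV) = (\<integral>\<^sup>+x. (\<integral>\<^sup>+y. indicator (B \<times> UNIV) (x, y) \<partial>p x) \<partial>M)"
      by (rule \<pi>_eq) (auto intro!: pair_measureI)
    also have "\<dots> = (\<integral>\<^sup>+x. indicator B x \<partial>M)"
    proof (rule nn_integral_cong)
      fix x
      have "(\<integral>\<^sup>+y. indicator (B \<times> UNIV) (x, y) \<partial>p x) = (\<integral>\<^sup>+y. indicator B x \<partial>p x)"
        by (rule nn_integral_cong) (auto simp: indicator_def)
      also have "\<dots> = indicator B x" using prob_space.emeasure_space_1[OF px] by simp
      finally show "(\<integral>\<^sup>+y. indicator (B \<times> UNIV) (x, y) \<partial>p x) = indicator B x" .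
    qed
    also have "\<dots> = emeasure M B" using B by (intro nn_integral_indicator) (simp add: sets_M)
    finally show "emeasure (distr \<pi> borel fst) B = emeasure M B" .
  qed
  moreover have "distr \<pi> borel snd = \<nu>"
  proof (rule measure_eqI)
    show "sets (distr \<pi> borel snd) = sets \<nu>" by (simp add: sets_\<nu>)
    fix B assume "B \<in> sets (distr \<pi> borel snd)"
    then have B [measurable]: "B \<in> sets borel" by simp
    have Bm: "UNIV \<times> B \<in> sets (M \<Otimes>\<^sub>M \<nu>)" unfolding sets_pair by (intro pair_measureI) auto
    have "emeasure (distr \<pi> borel snd) B = emeasure \<pi> (snd -` B \<inter> space \<pi>)"
      by (rule emeasure_distr) (auto simp: sets_\<pi> cong: measurable_cong_sets)
    also have "snd -` B \<inter> space \<pi> = UNIV \<times> B" by (auto simp: space_\<pi>)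
    also have "emeasure \<pi> (UNIV \<times> B)
        = (\<integral>\<^sup>+z. (case z of (x, y) \<Rightarrow> ennreal (h x y)) * indicator (UNIV \<times> B) z \<partial>(M \<Otimes>\<^sub>M \<nu>))"
      unfolding \<pi>_def by (rule emeasure_density[OF hs' Bm])
    also have "\<dots> = (\<integral>\<^sup>+y. \<integral>\<^sup>+x. ennreal (h x y) * indicator (UNIV \<times> B) (x, y) \<partial>M \<partial>\<nu>)"
      using Bm by (subst pr.nn_integral_snd[symmetric]) auto
    also have "\<dots> = (\<integral>\<^sup>+y. indicator B y \<partial>\<nu>)"
    proof (rule nn_integral_cong_AE)
      show "AE y in \<nu>. (\<integral>\<^sup>+x. ennreal (h x y) * indicator (UNIV \<times> B) (x, y) \<partial>M) = indicator B y"
        using marg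
      proof eventually_elim
        case (elim y)
        have "(\<integral>\<^sup>+x. ennreal (h x y) * indicator (UNIV \<times> B) (x, y) \<partial>M)
            = (\<integral>\<^sup>+x. ennreal (h x y) * indicator B y \<partial>M)"
          by (rule nn_integral_cong) (auto simp: indicator_def)
        also have "\<dots> = (\<integral>\<^sup>+x. ennreal (h x y) \<partial>M) * indicator B y"
          by (rule nn_integral_multc) measurable
        finally show ?case using elim by simp
      qed
    qed
    also have "\<dots> = emeasure \<nu> B" using B by (intro nn_integral_indicator) (simp add: sets_\<nu>)
    finally show "emeasure (distr \<pi> borel snd) B = emeasure \<nu> B" .
  qed
  ultimately have cpl: "\<pi> \<in> couplings M \<nu>" using sets_\<pi> by (simp add: couplings_def)
  have bary_p: "(\<integral>y. y \<partial>p x) = (\<integral>y. h x y *\<^sub>R y \<partial>\<nu>)" for x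
    unfolding p_def
  proof (rule integral_density)
    show "(\<lambda>y. y) \<in> borel_measurable \<nu>" using sets_\<nu> by (simp cong: measurable_cong_sets)
  qed (use hx h0 in auto)
  have "transport_cost N \<nu> M \<le> (\<integral>\<^sup>+x. ennreal (bary_cost N x (p x)) \<partial>M)"
    unfolding transport_cost_def using cpl dis by (intro INF_lower2[of "(\<pi>, p)"]) auto
  then show ?thesis by (simp add: bary_cost_def bary_p)
qed

theorem T2_dual_imp_transport_cost_le:
  assumes eb: "T2_dual b" and \<nu>P: "\<nu> \<in> P1" and fin: "rel_entropy \<nu> M = ereal H" and e: "e > 0"
  shows "transport_cost N \<nu> M \<le> ennreal ((1 + e) ^ 3 * (b * H + 2 * e))"
proof -
  interpret \<nu>: norm_prob N \<nu>
    using \<nu>P by (simp add: norm_prob_def norm_prob_axioms_def norm_fun_axioms P1_def)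
  have b: "b > 0" using eb by (simp add: T2_dual_def)
  obtain g where g [measurable]: "g \<in> borel_measurable M" and g0: "\<And>x. 0 \<le> g x"
    and \<nu>: "\<nu> = density M g" and ent: "integrable M (\<lambda>x. g x * ln (g x))"
    and H': "rel_entropy \<nu> M = ereal (\<integral>x. g x * ln (g x) \<partial>M)"
    using rel_entropy_finiteE[of \<nu>] fin \<nu>.prob_space_axioms \<nu>.sets_M by auto
  have H: "H = (\<integral>x. g x * ln (g x) \<partial>M)" using fin H' by simp
  have \<nu>_int: "(\<integral>x. f x \<partial>\<nu>) = (\<integral>x. g x * f x \<partial>M)"
    "integrable \<nu> f \<longleftrightarrow> integrable M (\<lambda>x. g x * f x)"
    if "f \<in> borel_measurable M" for f :: "'a \<Rightarrow> real"
  proof -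
    show "(\<integral>x. f x \<partial>\<nu>) = (\<integral>x. g x * f x \<partial>M)"
      unfolding \<nu> using that g0 by (intro integral_real_density) auto
    show "integrable \<nu> f \<longleftrightarrow> integrable M (\<lambda>x. g x * f x)"
      unfolding \<nu> using that g0 by (intro integrable_real_density) auto
  qed
  have gi: "integrable M g" "(\<integral>x. g x \<partial>M) = 1"
    using \<nu>_int[of "\<lambda>_. 1"] \<nu>.prob_space by (auto dest: sym)
  \<comment> \<open>The constant density 1 has entropy 0, so \<open>M\<close> itself has a second
    moment.\<close>
  have m2: "integrable M (\<lambda>x. (norm x)\<^sup>2)"
    using T2_dual_second_moment[OF eb, of "\<lambda>_. 1"] by simp
  have \<nu>m2: "integrable \<nu> (\<lambda>x. (norm x)\<^sup>2)"
    using T2_dual_second_moment[OF eb gi(1) g0 ent] by (simp add: \<nu>_int)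
  \<comment> \<open>The budget \<open>2 * e * e\<close> becomes e after division by the
    \<open>2 * e\<close> that belongs to sup-convolution at time e.\<close>
  obtain u z :: "'a \<Rightarrow> 'a" and w J where u: "simple_function \<nu> u" and finJ: "finite J"
    and w: "\<And>y. y \<in> J \<Longrightarrow> 0 < w y" "(\<Sum>y\<in>J. w y) = 1"
    and int_u: "\<And>h. (\<integral>x. h (u x) \<partial>\<nu>) = (\<Sum>y\<in>J. w y * h y :: real)"
    and w_def: "\<And>y. w y = measure \<nu> (u -` {y})" and uJ: "AE x in \<nu>. u x \<in> J"
    and z_mean: "\<And>y. y \<in> J \<Longrightarrow> (\<integral>x. indicator (u -` {y}) x *\<^sub>R x \<partial>\<nu>) = w y *\<^sub>R z y"
    and err: "(\<integral>x. (N (x - z (u x)))\<^sup>2 \<partial>\<nu>) \<le> 2 * e * e" "integrable \<nu> (\<lambda>x. (N (x - z (u x)))\<^sup>2)"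
  proof (rule \<nu>.barycentric_quantization[OF \<nu>m2, of "2 * e * e"])
    show "0 < 2 * e * e" using e by simp
  qed (rule that)
  have Jne: "J \<noteq> {}" using w(2) by auto
  have w0: "w y \<ge> 0" for y by (simp add: w_def)
  define A where "A y = u -` {y}" for y
  have wA: "measure \<nu> (A y) = w y" for y by (simp add: w_def A_def)
  have Am [measurable]: "A y \<in> sets borel" for y
    using simple_functionD(2)[OF u, of "{y}"] \<nu>.sets_M by (simp add: A_def)
  have ind_int: "integrable \<nu> (\<lambda>x. indicator (A y) x *\<^sub>R x)" for y
    using \<nu>.integrable_id by (intro integrable_mult_indicator) (auto simp: \<nu>.sets_M)
  have dual: "(\<Sum>y\<in>J. w y * f (z y)) \<le> (\<integral>x. sup_conv (1 + e) f x \<partial>M) + (b * H + e)"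
    if f: "conc_lip L f" for L f
  proof -
    \<comment> \<open>Sup-convolution at time e absorbs the displacement from x to the mean
      \<open>z (u x)\<close> of its cell.\<close>
    define h where "h = sup_conv e f"
    have h: "conc_lip L h" unfolding h_def by (rule conc_lip_sup_conv[OF f e])
    have hb: "conc_lip (1 / b * L) (\<lambda>x. 1 / b * h x)" using b by (intro conc_lip_scale h) auto
    have "(\<Sum>y\<in>J. w y * f (z y)) = (\<integral>x. f (z (u x)) \<partial>\<nu>)"
      by (rule int_u[of "\<lambda>y. f (z y)", symmetric])
    also have "\<dots> \<le> (\<integral>x. h x + (N (x - z (u x)))\<^sup>2 / (2 * e) \<partial>\<nu>)"
    proof (rule integral_mono)
      show "integrable \<nu> (\<lambda>x. f (z (u x)))" by (rule \<nu>.integral_simple_function(1)[OF u])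
      show "integrable \<nu> (\<lambda>x. h x + (N (x - z (u x)))\<^sup>2 / (2 * e))"
        using err(2) \<nu>.integrable_conc_lip[OF h] by simp
      show "f (z (u x)) \<le> h x + (N (x - z (u x)))\<^sup>2 / (2 * e)" for x
        using sup_conv_ge[OF f e, of "z (u x)" x] by (simp add: h_def)
    qed
    also have "\<dots> = (\<integral>x. h x \<partial>\<nu>) + (\<integral>x. (N (x - z (u x)))\<^sup>2 \<partial>\<nu>) / (2 * e)"
      using err(2) \<nu>.integrable_conc_lip[OF h] by simp
    also have "(\<integral>x. (N (x - z (u x)))\<^sup>2 \<partial>\<nu>) / (2 * e) \<le> e" using err(1) e by (simp add: field_simps)
    also have "(\<integral>x. h x \<partial>\<nu>) = b * (\<integral>x. g x * (1 / b * h x) \<partial>M)"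
      using b \<nu>_int(1)[OF borel_M[OF conc_lipD(6)[OF h]]] by simp
    also have "\<dots> \<le> b * (H + ln (\<integral>x. exp (1 / b * h x) \<partial>M))"
    proof (intro mult_left_mono)
      have "integrable M (\<lambda>x. g x * (1 / b * h x))"
        using \<nu>.integrable_conc_lip[OF hb] \<nu>_int(2)[OF borel_M[OF conc_lipD(6)[OF hb]]] by blast
      then show "(\<integral>x. g x * (1 / b * h x) \<partial>M) \<le> H + ln (\<integral>x. exp (1 / b * h x) \<partial>M)"
        unfolding H by (rule donsker_varadhan[OF hb gi(1) g0 gi(2) ent])
    qed (use b in simp)
    also have "\<dots> = b * H + b * ln (\<integral>x. exp (h x / b) \<partial>M)" by (simp add: algebra_simps)
    also have "b * ln (\<integral>x. exp (h x / b) \<partial>M) \<le> (\<integral>x. sup_conv 1 h x \<partial>M)"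
      using eb h by (auto simp: T2_dual_def)
    also have "(\<integral>x. sup_conv 1 h x \<partial>M) \<le> (\<integral>x. sup_conv (1 + e) f x \<partial>M)"
      using e sup_conv_sup_conv_le[OF f e zero_less_one]
      by (intro integral_mono integrable_conc_lip[OF conc_lip_sup_conv[OF h]]
          integrable_conc_lip[OF conc_lip_sup_conv[OF f]]) (auto simp: h_def add.commute)
    finally show ?thesis by simp
  qed
  obtain s :: "'a \<Rightarrow> 'a" and q :: "'a \<Rightarrow> 'a \<Rightarrow> real" where s: "simple_function M s"
    and q: "\<And>a. q a \<in> prob_simplex J" "\<And>j. j \<in> J \<Longrightarrow> (\<integral>x. q (s x) j \<partial>M) = w j"
    and cost: "(\<integral>\<^sup>+x. ennreal (1/2 * (N (x - bary J z (q (s x))))\<^sup>2) \<partial>M)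
      \<le> ennreal ((1 + e) * (1 + e)\<^sup>2 * (b * H + e + e))"
  proof (rule approx_transport[where w = w and z = z and \<sigma> = "1 + e" and e = e and K = "b * H + e",
        OF m2 finJ Jne])
    show "0 < w j" if "j \<in> J" for j by (rule w(1)[OF that])
    show "(\<Sum>j\<in>J. w j) = 1" by (rule w(2))
    show "0 < 1 + e" "0 < e" using e by auto
    show "(\<Sum>j\<in>J. w j * f (z j)) \<le> (\<integral>x. sup_conv (1 + e) f x \<partial>M) + (b * H + e)"
      if "conc_lip L f" for L f by (rule dual[OF that])
    fix s :: "'a \<Rightarrow> 'a" and q :: "'a \<Rightarrow> 'a \<Rightarrow> real"
    assume sq: "simple_function M s" "\<And>a. q a \<in> prob_simplex J"
      "\<And>j. j \<in> J \<Longrightarrow> (\<integral>x. q (s x) j \<partial>M) = w j"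
      "(\<integral>\<^sup>+x. ennreal (1/2 * (N (x - bary J z (q (s x))))\<^sup>2) \<partial>M)
        \<le> ennreal ((1 + e) * (1 + e)\<^sup>2 * (b * H + e + e))"
    show thesis by (rule that[OF sq])
  qed
  \<comment> \<open>The weight \<open>q a j\<close> is spread over the cell \<open>A j\<close> with
    density \<open>1 / w j\<close> relative to \<open>\<nu>\<close>; as \<open>z j\<close> is the
    mean of that cell, barycentres are preserved.\<close>
  define h where "h a y = (\<Sum>j\<in>J. q a j / w j * indicator (A j) y)" for a y
  have q0: "0 \<le> q a j" if "j \<in> J" for a j using q(1)[of a] that by (auto simp: prob_simplex_def)
  have h0: "0 \<le> h a y" for a y
    unfolding h_def using q0 w0 by (intro sum_nonneg) auto
  have qs [measurable]: "(\<lambda>x. q (s x) j) \<in> borel_measurable borel" for j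
    using measurable_compose[OF measurable_simple_function[OF s], of "\<lambda>a. q a j" borel] by simp
  have hs [measurable]: "(\<lambda>(x, y). h (s x) y) \<in> borel_measurable (borel \<Otimes>\<^sub>M borel)"
    unfolding h_def by measurable
  have hi: "integrable \<nu> (h a)" for a
    unfolding h_def[abs_def] using \<nu>.sets_M
    by (intro Bochner_Integration.integrable_sum integrable_mult_right) (auto simp: less_top[symmetric])
  have h1: "(\<integral>y. h a y \<partial>\<nu>) = 1" for a
  proof -
    have "(\<integral>y. h a y \<partial>\<nu>) = (\<Sum>j\<in>J. q a j / w j * w j)"
      unfolding h_def using \<nu>.sets_M
      by (subst Bochner_Integration.integral_sum) (auto simp: less_top[symmetric] wA)
    also have "\<dots> = (\<Sum>j\<in>J. q a j)" by (intro sum.cong refl) (use w(1) in fastforce)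
    finally show ?thesis using q(1)[of a] by (simp add: prob_simplex_def)
  qed
  have h1n: "(\<integral>\<^sup>+y. ennreal (h a y) \<partial>\<nu>) = 1" for a
    using nn_integral_eq_integral[OF hi, of a] h0 h1 by simp
  have h2: "AE y in \<nu>. (\<integral>\<^sup>+x. ennreal (h (s x) y) \<partial>M) = 1"
    using uJ
  proof eventually_elim
    case (elim y)
    have hy: "h a y = q a (u y) / w (u y)" for a
    proof -
      have "h a y = (\<Sum>j\<in>J. if j = u y then q a j / w j else 0)"
        unfolding h_def by (intro sum.cong refl) (auto simp: A_def indicator_def)
      then show ?thesis using elim finJ by simp
    qed
    have "(\<integral>\<^sup>+x. ennreal (h (s x) y) \<partial>M) = ennreal (\<integral>x. q (s x) (u y) / w (u y) \<partial>M)"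
      unfolding hy using q0[OF elim] w(1)[OF elim] integral_simple_function(1)[OF s]
      by (intro nn_integral_eq_integral) auto
    also have "(\<integral>x. q (s x) (u y) / w (u y) \<partial>M) = 1" using q(2)[OF elim] w(1)[OF elim] by simp
    finally show ?case by simp
  qed
  have hm' [measurable]: "h a \<in> borel_measurable \<nu>" for a
    using borel_measurable_integrable[OF hi] .
  \<comment> \<open>The kernel factors through the finitely many values of s, so its measurability
    reduces to that of a map on a discrete space.\<close>
  have kernel: "(\<lambda>x. density \<nu> (\<lambda>y. ennreal (h (s x) y))) \<in> borel \<rightarrow>\<^sub>M prob_algebra borel"
  proof -
    have "s \<in> borel \<rightarrow>\<^sub>M count_space UNIV"
      using measurable_simple_function[OF s] sets_M by (simp cong: measurable_cong_sets)
    moreover have "(\<lambda>a. density \<nu> (\<lambda>y. ennreal (h a y))) \<in> count_space UNIV \<rightarrow>\<^sub>M prob_algebra borel"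
      using h1n by (auto simp: space_prob_algebra \<nu>.sets_M emeasure_density intro!: prob_spaceI)
    ultimately show ?thesis by (rule measurable_compose)
  qed
  have bary_h: "(\<integral>y. h (s x) y *\<^sub>R y \<partial>\<nu>) = bary J z (q (s x))" for x
  proof -
    have "(\<integral>y. h (s x) y *\<^sub>R y \<partial>\<nu>) = (\<integral>y. (\<Sum>j\<in>J. (q (s x) j / w j) *\<^sub>R (indicator (A j) y *\<^sub>R y)) \<partial>\<nu>)"
      by (simp add: h_def scaleR_sum_left)
    also have "\<dots> = (\<Sum>j\<in>J. (q (s x) j / w j) *\<^sub>R (\<integral>y. indicator (A j) y *\<^sub>R y \<partial>\<nu>))"
    proof (subst Bochner_Integration.integral_sum)
      show "integrable \<nu> (\<lambda>y. (q (s x) j / w j) *\<^sub>R (indicator (A j) y *\<^sub>R y))" for j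
        by (intro integrable_scaleR_right ind_int)
    qed (simp only: integral_scaleR_right)
    also have "\<dots> = bary J z (q (s x))"
      unfolding bary_def
    proof (rule sum.cong[OF refl])
      fix j assume j: "j \<in> J"
      show "(q (s x) j / w j) *\<^sub>R (\<integral>y. indicator (A j) y *\<^sub>R y \<partial>\<nu>) = q (s x) j *\<^sub>R z j"
        unfolding z_mean[OF j, folded A_def] using w(1)[OF j] by simp
    qed
    finally show ?thesis .
  qed
  have "transport_cost N \<nu> M \<le> (\<integral>\<^sup>+x. ennreal (1/2 * (N (x - (\<integral>y. h (s x) y *\<^sub>R y \<partial>\<nu>)))\<^sup>2) \<partial>M)"
    by (rule transport_cost_le_density[OF \<nu>.prob_space_axioms \<nu>.sets_M h0 hs kernel h2])
  also have "\<dots> \<le> ennreal ((1 + e) * (1 + e)\<^sup>2 * (b * H + e + e))" unfolding bary_h by (rule cost)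
  also have "(1 + e) * (1 + e)\<^sup>2 * (b * H + e + e) = (1 + e) ^ 3 * (b * H + 2 * e)"
    by (simp add: power2_eq_square power3_eq_cube)
  finally show ?thesis .
qed

theorem T2_dual_imp_T2_plus:
  assumes eb: "T2_dual b"
  shows "T2_plus N M b"
  unfolding T2_plus_def
proof
  fix \<nu> :: "'a measure" assume \<nu>P: "\<nu> \<in> P1"
  have b: "b > 0" using eb by (simp add: T2_dual_def)
  show "enn2ereal (transport_cost N \<nu> M) \<le> ereal b * rel_entropy \<nu> M"
  proof (cases "rel_entropy \<nu> M = \<infinity>")
    case True
    then show ?thesis using b by simp
  next
    case False
    then obtain H where H: "rel_entropy \<nu> M = ereal H"
      by (auto simp: rel_entropy_def split: if_splits)
    have le: "transport_cost N \<nu> M \<le> ennreal ((1 + e) ^ 3 * (b * H + 2 * e))" if "e > 0" for e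
      by (rule T2_dual_imp_transport_cost_le[OF eb \<nu>P H that])
    have "transport_cost N \<nu> M \<noteq> \<infinity>" using le[of 1] by (auto simp: top_unique)
    then obtain t where t: "t \<ge> 0" "transport_cost N \<nu> M = ennreal t"
      by (cases "transport_cost N \<nu> M") auto
    \<comment> \<open>A nonnegative bound is what allows the \<open>ennreal\<close> inequality to be
      read as one between reals.\<close>
    have pos: "0 \<le> H"
    proof -
      obtain g where g: "g \<in> borel_measurable M" "\<And>x. 0 \<le> g x" "\<nu> = density M g"
        "integrable M (\<lambda>x. g x * ln (g x))" "rel_entropy \<nu> M = ereal (\<integral>x. g x * ln (g x) \<partial>M)"
        using rel_entropy_finiteE[of \<nu>] False \<nu>P by (auto simp: P1_def)
      have "information_space M (exp 1)" by unfold_locales simp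
      then have "0 \<le> KL_divergence (exp 1) M (density M g)"
        using g \<nu>P by (intro information_space.KL_nonneg) (auto simp: P1_def log_def)
      then show ?thesis using H False g(3) by (auto simp: rel_entropy_def split: if_splits)
    qed
    have "t \<le> (1 + e) ^ 3 * (b * H + 2 * e)" if "e > 0" for e
      using le[OF that] that b pos unfolding t(2) by (subst (asm) ennreal_le_iff) auto
    then have ev: "\<forall>\<^sub>F e in at_right 0. t \<le> (1 + e) ^ 3 * (b * H + 2 * e)"
      by (auto simp: eventually_at_filter)
    have lim: "((\<lambda>e. (1 + e) ^ 3 * (b * H + 2 * e)) \<longlongrightarrow> (1 + 0) ^ 3 * (b * H + 2 * 0)) (at_right 0)"
      by (intro tendsto_intros)
    have "t \<le> (1 + 0) ^ 3 * (b * H + 2 * 0)"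
      by (rule tendsto_lowerbound[OF lim ev]) simp
    then show ?thesis unfolding t(2) H using t(1) by (simp add: enn2ereal_ennreal)
  qed
qed

theorem gradient_log_Sobolev_imp_T2_plus:
  assumes "gradient_log_Sobolev N M \<rho> lam" "strictly_convex_norm (dual_norm N)" "\<rho> > 0" "lam > 0"
  shows "T2_plus N M ((\<rho> + lam) / (\<rho> * lam))"
proof (rule T2_dual_imp_T2_plus)
  show "T2_dual ((\<rho> + lam) / (\<rho> * lam))"
    using gradient_log_Sobolev_imp_exp_integral_le[OF assms refl] assms(3,4)
    by (auto simp: T2_dual_def)
qed

end

section \<open>The equivalence\<close>

theorem theorem8p15:
  fixes N :: "real ^ 'm \<Rightarrow> real" and \<mu> :: "(real ^ 'm) measure"
  assumes "is_norm N"
    and "strictly_convex_norm (dual_norm N)"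
    and "\<mu> \<in> P1"
  shows
    "((\<exists>b>0. T2_plus N \<mu> b) \<longleftrightarrow> (\<exists>lam>0. \<exists>C>0. inf_conv_log_Sobolev N \<mu> lam C))
   \<and> ((\<exists>lam>0. \<exists>C>0. inf_conv_log_Sobolev N \<mu> lam C) \<longleftrightarrow>
        (\<exists>\<rho>>0. \<exists>lam'>0. gradient_log_Sobolev N \<mu> \<rho> lam'))
   \<and> (\<forall>b>0. T2_plus N \<mu> b \<longrightarrow>
        (\<forall>lam. 0 < lam \<and> lam < 1 / b \<longrightarrow> inf_conv_log_Sobolev N \<mu> lam (1 / (1 - b * lam))))
   \<and> (\<forall>lam>0. \<forall>C>0. inf_conv_log_Sobolev N \<mu> lam C \<longrightarrow>
        (\<forall>lam'. 0 < lam' \<and> lam' < lam \<longrightarrow> gradient_log_Sobolev N \<mu> ((lam - lam') / C) lam'))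
   \<and> (\<forall>\<rho>>0. \<forall>lam'>0. gradient_log_Sobolev N \<mu> \<rho> lam' \<longrightarrow>
        T2_plus N \<mu> ((\<rho> + lam') / (\<rho> * lam')))"
proof -
  interpret norm_prob N \<mu>
    using assms(1,3) by (simp add: norm_prob_def norm_prob_axioms_def norm_fun_def P1_def)
  have 12: "inf_conv_log_Sobolev N \<mu> lam (1 / (1 - b * lam))"
    if "b > 0" "T2_plus N \<mu> b" "0 < lam" "lam < 1 / b" for b lam
    using T2_plus_imp_inf_conv_log_Sobolev that by blast
  have 23: "gradient_log_Sobolev N \<mu> ((lam - lam') / C) lam'"
    if "C > 0" "inf_conv_log_Sobolev N \<mu> lam C" "0 < lam'" "lam' < lam" for lam C lam'
    using inf_conv_imp_gradient_log_Sobolev that by blast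
  have 31: "T2_plus N \<mu> ((\<rho> + lam') / (\<rho> * lam'))"
    if "\<rho> > 0" "lam' > 0" "gradient_log_Sobolev N \<mu> \<rho> lam'" for \<rho> lam'
    using gradient_log_Sobolev_imp_T2_plus[OF that(3) assms(2) that(1,2)] .
  \<comment> \<open>Existence follows from any admissible \<open>lam\<close>; half of the upper
    limit \<open>1 / b\<close> is taken, which makes the constant 2.\<close>
  have ex12: "\<exists>lam>0. \<exists>C>0. inf_conv_log_Sobolev N \<mu> lam C" if "b > 0" "T2_plus N \<mu> b" for b
    using 12[OF that, of "1 / (2 * b)"] that(1)
    by (intro exI[of _ "1 / (2 * b)"] exI[of _ "1 / (1 - b * (1 / (2 * b)))"] conjI) (auto simp: divide_simps)
  have ex23: "\<exists>\<rho>>0. \<exists>lam'>0. gradient_log_Sobolev N \<mu> \<rho> lam'"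
    if "lam > 0" "C > 0" "inf_conv_log_Sobolev N \<mu> lam C" for lam C
    using 23[OF that(2,3), of "lam / 2"] that(1,2)
    by (intro exI[of _ "(lam - lam / 2) / C"] exI[of _ "lam / 2"] conjI) auto
  have ex31: "\<exists>b>0. T2_plus N \<mu> b" if "\<rho> > 0" "lam' > 0" "gradient_log_Sobolev N \<mu> \<rho> lam'" for \<rho> lam'
    using 31[OF that] that(1,2) by (intro exI[of _ "(\<rho> + lam') / (\<rho> * lam')"] conjI) auto
  show ?thesis
  proof (intro conjI)
    show "(\<exists>b>0. T2_plus N \<mu> b) \<longleftrightarrow> (\<exists>lam>0. \<exists>C>0. inf_conv_log_Sobolev N \<mu> lam C)"
    proof (rule iffI; elim exE conjE)
      fix b assume "b > 0" "T2_plus N \<mu> b"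
      then show "\<exists>lam>0. \<exists>C>0. inf_conv_log_Sobolev N \<mu> lam C" by (rule ex12)
    next
      fix lam C assume "lam > 0" "C > 0" "inf_conv_log_Sobolev N \<mu> lam C"
      then obtain \<rho> lam' where "\<rho> > 0" "lam' > 0" "gradient_log_Sobolev N \<mu> \<rho> lam'"
        using ex23 by meson
      then show "\<exists>b>0. T2_plus N \<mu> b" by (rule ex31)
    qed
    show "(\<exists>lam>0. \<exists>C>0. inf_conv_log_Sobolev N \<mu> lam C) \<longleftrightarrow>
        (\<exists>\<rho>>0. \<exists>lam'>0. gradient_log_Sobolev N \<mu> \<rho> lam')"
    proof (rule iffI; elim exE conjE)
      fix lam C assume "lam > 0" "C > 0" "inf_conv_log_Sobolev N \<mu> lam C"
      then show "\<exists>\<rho>>0. \<exists>lam'>0. gradient_log_Sobolev N \<mu> \<rho> lam'" by (rule ex23)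
    next
      fix \<rho> lam' assume "\<rho> > 0" "lam' > 0" "gradient_log_Sobolev N \<mu> \<rho> lam'"
      then obtain b where "b > 0" "T2_plus N \<mu> b" using ex31 by meson
      then show "\<exists>lam>0. \<exists>C>0. inf_conv_log_Sobolev N \<mu> lam C" by (rule ex12)
    qed
  qed (use 12 23 31 in simp_all)
qed

end
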